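(* Let $\mathcal{X}$ be an SPD with a dominating process $\hat{X}$, and let $\hat{T} := \inf\{t\ge 0 : \hat{X}_t = 0\}$ (with $\inf\emptyset=\infty$). Then the following are equivalent: (1) $\mathcal{X}$ satisfies DSV for $\hat{X}$. (2) There exists a supermartingale deflator $Y$ for $\mathcal{X}$ which is adapted, $P$-a.s. right-continuous, strictly positive on $\llbracket 0,\hat{T}\llbracket$ and satisfies $\liminf_{t\upuparrows\hat{T}} \hat{X}_tY_t > 0$ $P$-a.s.
   Context: Work on a filtered probability space $(\Omega,\mathcal{F},\mathbb{F},P)$, $\mathbb{F}=(\mathcal{F}_t)_{t\ge0}$ satisfying the usual conditions, $\mathcal{F}_0$ trivial; convention $0/0=1$. Stochastic intervals such as $\llbracket 0,\tau\llbracket=\{(\omega,t)\in\Omega\times[0,\infty): 0\le t<\tau(\omega)\}$ are subsets of $\Omega\times[0,\infty)$. For a process $X$ and $t_0\in(0,\infty]$, $\liminf_{t\upuparrows t_0}X_t$ denotes the left limit inferior over $t<t_0$ (for $t_0=\infty$ it is $\liminf_{t\to\infty}$). A set of processes (SP) is a set $\mathcal{X}$ of processes such that: (A) each $X\in\mathcal{X}$ is an adapted, nonnegative, $P$-a.s. right-continuous process on $[0,\infty)$ with $X_0=1$; (C) for $X,X'\in\mathcal{X}$ and $\alpha\in[0,1]$, $(1-\alpha)X+\alpha X'\in\mathcal{X}$; (D) for all $t\in[0,\infty)$, $A\in\mathcal{F}_t$, $X\in\mathcal{X}$ and $X'\in\mathcal{X}$ with $\{X'_t=0\}\subseteq\{X_t=0\}$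 on $A$, the process $I_{A^c}X_\cdot + I_A (X_{t\wedge\cdot}/X'_t)X'_{t\vee\cdot}$ belongs to $\mathcal{X}$. An SP is an SPD (set of processes with a dominating process) if there is $\hat{X}\in\mathcal{X}$ with $\{\hat{X}=0\}\subseteq\{X=0\}$ (as subsets of $\Omega\times[0,\infty)$) for all $X\in\mathcal{X}$; such $\hat X$ is called a dominating process. An SPD $\mathcal{X}$ satisfies dynamic share viability (DSV) for $\hat{X}$ if the set $\{\liminf_{t\upuparrows\hat{T}} X_t/\hat{X}_t : X\in\mathcal{X}\}$ is bounded in $L^0$ (bounded in probability). A process $Y$ is a supermartingale deflator (SMD) for $\mathcal{X}$ if $XY$ is a supermartingale for every $X\in\mathcal{X}$. *)

theory Defs
  imports "HOL-Probability.Probability"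
begin

text \<open>Processes are functions of type real => 'a => real (time first); only times t >= 0
  and outcomes in the space of M are relevant.\<close>

definition ratio :: "real \<Rightarrow> real \<Rightarrow> real" where
  "ratio a b = (if a = 0 \<and> b = 0 then 1 else a / b)"

definition usual_filtered_prob_space :: "'a measure \<Rightarrow> (real \<Rightarrow> 'a measure) \<Rightarrow> bool" where
  "usual_filtered_prob_space M F \<longleftrightarrow>
     prob_space M \<and>
     (\<forall>t. subalgebra M (F t)) \<and>
     (\<forall>s t. 0 \<le> s \<longrightarrow> s \<le> t \<longrightarrow> sets (F s) \<subseteq> sets (F t)) \<and>
     (\<forall>t\<ge>0. sets (F t) = (\<Inter>s\<in>{t<..}. sets (F s))) \<and>
     (\<forall>A N. N \<in> null_sets M \<longrightarrow> A \<subseteq> N \<longrightarrow> A \<in> sets (F 0)) \<and>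
     (\<forall>A\<in>sets (F 0). measure M A = 0 \<or> measure M A = 1)"

definition adapted :: "(real \<Rightarrow> 'a measure) \<Rightarrow> (real \<Rightarrow> 'a \<Rightarrow> real) \<Rightarrow> bool" where
  "adapted F X \<longleftrightarrow> (\<forall>t\<ge>0. X t \<in> borel_measurable (F t))"

definition as_right_continuous :: "'a measure \<Rightarrow> (real \<Rightarrow> 'a \<Rightarrow> real) \<Rightarrow> bool" where
  "as_right_continuous M X \<longleftrightarrow>
     (AE \<omega> in M. \<forall>t\<ge>0. ((\<lambda>s. X s \<omega>) \<longlongrightarrow> X t \<omega>) (at_right t))"

definition same_process :: "'a measure \<Rightarrow> (real \<Rightarrow> 'a \<Rightarrow> real) \<Rightarrow> (real \<Rightarrow> 'a \<Rightarrow> real) \<Rightarrow> bool" where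
  "same_process M X Z \<longleftrightarrow> (\<forall>t\<ge>0. \<forall>\<omega>\<in>space M. X t \<omega> = Z t \<omega>)"

definition in_procs :: "'a measure \<Rightarrow> (real \<Rightarrow> 'a \<Rightarrow> real) \<Rightarrow> (real \<Rightarrow> 'a \<Rightarrow> real) set \<Rightarrow> bool" where
  "in_procs M Z \<X> \<longleftrightarrow> (\<exists>X\<in>\<X>. same_process M X Z)"

text \<open>Concatenation in (D): I_{A^c} X_s + I_A (X_{t /\ s} / X'_t) X'_{t \/ s}, read as
  X_s for s <= t and (X_t / X'_t) X'_s for s >= t (on A), with 0/0 = 1.\<close>
definition concat_proc :: "'a set \<Rightarrow> real \<Rightarrow> (real \<Rightarrow> 'a \<Rightarrow> real) \<Rightarrow> (real \<Rightarrow> 'a \<Rightarrow> real)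
    \<Rightarrow> real \<Rightarrow> 'a \<Rightarrow> real" where
  "concat_proc A t X X' s \<omega> =
     (if \<omega> \<in> A then (if s \<le> t then X s \<omega> else ratio (X t \<omega>) (X' t \<omega>) * X' s \<omega>) else X s \<omega>)"

definition set_of_processes :: "'a measure \<Rightarrow> (real \<Rightarrow> 'a measure) \<Rightarrow> (real \<Rightarrow> 'a \<Rightarrow> real) set \<Rightarrow> bool" where
  "set_of_processes M F \<X> \<longleftrightarrow>
     (\<forall>X\<in>\<X>. adapted F X \<and> (\<forall>t\<ge>0. \<forall>\<omega>\<in>space M. 0 \<le> X t \<omega>) \<and> as_right_continuous M X
              \<and> (\<forall>\<omega>\<in>space M. X 0 \<omega> = 1)) \<and>
     (\<forall>X\<in>\<X>. \<forall>X'\<in>\<X>. \<forall>\<alpha>::real. 0 \<le> \<alpha> \<longrightarrow> \<alpha> \<le> 1 \<longrightarrow>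
        in_procs M (\<lambda>t \<omega>. (1 - \<alpha>) * X t \<omega> + \<alpha> * X' t \<omega>) \<X>) \<and>
     (\<forall>t\<ge>0. \<forall>A\<in>sets (F t). \<forall>X\<in>\<X>. \<forall>X'\<in>\<X>.
        (\<forall>\<omega>\<in>A. X' t \<omega> = 0 \<longrightarrow> X t \<omega> = 0) \<longrightarrow> in_procs M (concat_proc A t X X') \<X>)"

definition dominating_process :: "'a measure \<Rightarrow> (real \<Rightarrow> 'a \<Rightarrow> real) set \<Rightarrow> (real \<Rightarrow> 'a \<Rightarrow> real) \<Rightarrow> bool" where
  "dominating_process M \<X> Xh \<longleftrightarrow> Xh \<in> \<X> \<and>
     (\<forall>X\<in>\<X>. \<forall>t\<ge>0. \<forall>\<omega>\<in>space M. Xh t \<omega> = 0 \<longrightarrow> X t \<omega> = 0)"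

definition SPD :: "'a measure \<Rightarrow> (real \<Rightarrow> 'a measure) \<Rightarrow> (real \<Rightarrow> 'a \<Rightarrow> real) set \<Rightarrow> bool" where
  "SPD M F \<X> \<longleftrightarrow> set_of_processes M F \<X> \<and> (\<exists>Xh. dominating_process M \<X> Xh)"

definition first_zero :: "(real \<Rightarrow> 'a \<Rightarrow> real) \<Rightarrow> 'a \<Rightarrow> ereal" where
  "first_zero X \<omega> = Inf {ereal t | t. 0 \<le> t \<and> X t \<omega> = 0}"

definition left_liminf :: "(real \<Rightarrow> real) \<Rightarrow> ereal \<Rightarrow> ereal" where
  "left_liminf f t0 =
     (if t0 = \<infinity> then Liminf at_top (\<lambda>t. ereal (f t))
      else Liminf (at (real_of_ereal t0) within {0..<real_of_ereal t0}) (\<lambda>t. ereal (f t)))"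

text \<open>Boundedness in probability (in L^0) of a family of [0,oo]-valued random variables,
  using outer probability so that no measurability is presupposed.\<close>
definition bounded_in_L0 :: "'a measure \<Rightarrow> ('a \<Rightarrow> ereal) set \<Rightarrow> bool" where
  "bounded_in_L0 M S \<longleftrightarrow>
     (\<forall>\<epsilon>>0. \<exists>c::real. \<forall>\<xi>\<in>S. \<exists>N\<in>sets M.
        {\<omega>\<in>space M. \<bar>\<xi> \<omega>\<bar> > ereal c} \<subseteq> N \<and> measure M N \<le> \<epsilon>)"

definition DSV :: "'a measure \<Rightarrow> (real \<Rightarrow> 'a \<Rightarrow> real) set \<Rightarrow> (real \<Rightarrow> 'a \<Rightarrow> real) \<Rightarrow> bool" where
  "DSV M \<X> Xh \<longleftrightarrow>
     bounded_in_L0 M ((\<lambda>X \<omega>. left_liminf (\<lambda>t. ratio (X t \<omega>) (Xh t \<omega>)) (first_zero Xh \<omega>)) ` \<X>)"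

definition supermartingale :: "'a measure \<Rightarrow> (real \<Rightarrow> 'a measure) \<Rightarrow> (real \<Rightarrow> 'a \<Rightarrow> real) \<Rightarrow> bool" where
  "supermartingale M F Z \<longleftrightarrow>
     adapted F Z \<and> (\<forall>t\<ge>0. integrable M (Z t)) \<and>
     (\<forall>s t. 0 \<le> s \<longrightarrow> s \<le> t \<longrightarrow> (AE \<omega> in M. real_cond_exp M (F s) (Z t) \<omega> \<le> Z s \<omega>))"

definition SMD :: "'a measure \<Rightarrow> (real \<Rightarrow> 'a measure) \<Rightarrow> (real \<Rightarrow> 'a \<Rightarrow> real) set \<Rightarrow> (real \<Rightarrow> 'a \<Rightarrow> real) \<Rightarrow> bool" where
  "SMD M F \<X> Y \<longleftrightarrow> (\<forall>X\<in>\<X>. supermartingale M F (\<lambda>t \<omega>. X t \<omega> * Y t \<omega>))"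

end

theory Submission
  imports Defs "HOL-Real_Asymp.Real_Asymp"
begin

text \<open>Put R = X / Xh on [0, T) with T the first zero of Xh. Given a deflator Y, the nonnegative
  supermartingale XY stopped at T obeys the maximal inequality with a bound independent of X, and XhY
  stays away from 0 near T, so the limits of R = XY / (XhY) are bounded in probability.

  Conversely, the payoffs eventually dominated by R near T form a convex set which is bounded in
  probability, hence E[gf] is at most 1 for all payoffs f and some g > 0. Let w(t) be the essential
  supremum of E[gf | F t] over the payoffs f of those X which equal Xh at time t. The concatenation property
  makes this family closed under pasting and w R a supermartingale for every X. Moreover w(t) is at
  least E[g | F t] before T, so it stays away from 0. The right limits of w along the dyadic
  numbers, divided by Xh, form the required deflator.\<close>

section \<open>Convex sets bounded in probability\<close>

text \<open>\<open>T\<close> is not the end of time: nothing keeps \<open>Xh\<close> at 0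
  afterwards, and the sign of a deflator is prescribed before \<open>T\<close> only, so XY may
  become negative beyond \<open>T\<close>. Hence the maximal inequality uses nonnegativity before
  \<open>T\<close> and, at \<open>T\<close>, only the value 0 with right limit 0. Its bound is the
  same for all X because every X starts at 1.

  Paths need not have left limits, so R has only a limit inferior at \<open>T\<close>, and its
  measurability is not at hand. Payoffs are therefore measurable minorants of R near
  \<open>T\<close>. They also combine well: a convex combination of minorants is a minorant of the
  combined process.

  Restarting X at time s divides by its value there, which may vanish. Mixing in a fraction of
  \<open>Xh\<close> prevents this, and the fraction tends to 0 at the end.

  Finally, w is determined at each fixed time only up to a null set depending on that time, so its
  paths carry no meaning until they are rebuilt from countably many times. This is why upcrossings
  are counted along the dyadic numbers, and why right continuity of X and \<open>Xh\<close> is what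
  carries the result to all times.\<close>

lemma (in prob_space) integrable_inverse_one_plus:
  fixes f :: "'a \<Rightarrow> real"
  assumes "f \<in> borel_measurable M" and "\<And>x. x \<in> space M \<Longrightarrow> 0 \<le> f x"
  shows "integrable M (\<lambda>x. 1 / (1 + f x))"
  by (rule integrable_const_bound[where B=1]) (use assms in \<open>auto intro!: AE_I2 simp: divide_le_eq_1 add_pos_nonneg\<close>)

text \<open>The value at the midpoint is the harmonic mean of u = 1/(1+x) and v = 1/(1+y). It falls
  short of the arithmetic mean by (u-v)^2 / (2(u+v)), and u + v \<le> 2: strict convexity with a
  quantitative gap.\<close>

lemma inverse_one_plus_midpoint:
  fixes x y :: real
  assumes "0 \<le> x" "0 \<le> y"
  shows "1 / (1 + (x + y) / 2) \<le> (1 / (1 + x) + 1 / (1 + y)) / 2 - (1 / (1 + x) - 1 / (1 + y))\<^sup>2 / 4"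
proof -
  define u v where "u = 1 / (1 + x)" and "v = 1 / (1 + y)"
  have u: "0 < u" "u \<le> 1" and v: "0 < v" "v \<le> 1" using assms by (auto simp: u_def v_def)
  have xy: "x = 1 / u - 1" "y = 1 / v - 1" using assms by (auto simp: u_def v_def)
  have "1 / (1 + (x + y) / 2) = 2 * u * v / (u + v)"
    unfolding xy using u v by (simp add: field_simps)
  also have "\<dots> = (u + v) / 2 - (u - v)\<^sup>2 / (2 * (u + v))"
    using u v by (simp add: field_simps power2_eq_square)
  also have "\<dots> \<le> (u + v) / 2 - (u - v)\<^sup>2 / 4"
    using u v by (intro diff_left_mono divide_left_mono) auto
  finally show ?thesis by (simp add: u_def v_def)
qed

text \<open>The quotient on the right is the decrease of 1/(1+f) per unit step from x towards y,
  which tends to u^2 (y - x) as a tends to 0. The summand 1 absorbs the contribution of x, and the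
  denominator on the left tends to 1.\<close>

lemma inverse_one_plus_perturb:
  fixes x y a :: real
  assumes "0 \<le> x" "0 \<le> y" "0 < a" "a \<le> 1"
  defines "u \<equiv> 1 / (1 + x)"
  shows "u\<^sup>2 * y / (1 + a * (u * y)) \<le> (u - 1 / (1 + ((1 - a) * x + a * y))) / a + 1"
proof -
  define w where "w = (1 - a) * x + a * y"
  have w: "0 \<le> w" "w \<le> x + a * y"
    using assms mult_left_le_one_le[of x "1 - a"] by (auto simp: w_def)
  have p: "0 < 1 + x + a * y" using assms by (simp add: add_pos_nonneg)
  have *: "1 + a * (u * y) = (1 + x + a * y) / (1 + x)" using assms by (simp add: field_simps)
  have "u\<^sup>2 * y / (1 + a * (u * y)) = y / ((1 + x) * (1 + x + a * y))"
    unfolding * using assms p by (simp add: power2_eq_square)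
  also have "\<dots> \<le> y / ((1 + x) * (1 + w))"
    using assms w by (intro divide_left_mono mult_left_mono mult_pos_pos) auto
  also have "\<dots> = (y - x) / ((1 + x) * (1 + w)) + x / ((1 + x) * (1 + w))"
    by (simp add: add_divide_distrib[symmetric])
  also have "(y - x) / ((1 + x) * (1 + w)) = (u - 1 / (1 + w)) / a"
  proof -
    have "(u - 1 / (1 + w)) = (w - x) / ((1 + x) * (1 + w))"
      using assms w by (simp add: field_simps)
    also have "w - x = a * (y - x)" by (simp add: w_def algebra_simps)
    finally show ?thesis using assms by simp
  qed
  also have "x / ((1 + x) * (1 + w)) \<le> 1"
  proof -
    have "1 * x \<le> (1 + w) * (1 + x)" using assms w by (intro mult_mono) auto
    then show ?thesis using assms w by (simp add: mult.commute)
  qed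
  finally show ?thesis by (simp add: w_def)
qed

text \<open>A minimising sequence of the functional f |-> E[1 / (1 + f)] has 1 / (1 + f) convergent, by
  strict convexity; the first order condition at the limit U says that U^2 is the desired density.\<close>

lemma (in prob_space) convex_L0_bounded_imp_L1_bounded:
  fixes C :: "('a \<Rightarrow> real) set"
  assumes ne: "C \<noteq> {}"
    and meas: "\<And>f. f \<in> C \<Longrightarrow> f \<in> borel_measurable M"
    and nn: "\<And>f x. f \<in> C \<Longrightarrow> x \<in> space M \<Longrightarrow> 0 \<le> f x"
    and conv: "\<And>f h a. f \<in> C \<Longrightarrow> h \<in> C \<Longrightarrow> 0 \<le> a \<Longrightarrow> a \<le> 1 \<Longrightarrow>
                 (\<lambda>x. (1 - a) * f x + a * h x) \<in> C"
    and bdd: "\<And>\<epsilon>. 0 < \<epsilon> \<Longrightarrow> \<exists>c. \<forall>f\<in>C. prob {x\<in>space M. c < f x} \<le> \<epsilon>"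
  shows "\<exists>g\<in>borel_measurable M. (\<forall>x\<in>space M. 0 < g x) \<and>
           (\<forall>f\<in>C. (\<integral>\<^sup>+x. ennreal (g x * f x) \<partial>M) \<le> 1)"
proof -
  define I where "I f = (\<integral>x. 1 / (1 + f x) \<partial>M)" for f :: "'a \<Rightarrow> real"
  define m where "m = Inf (I ` C)"
  have int: "integrable M (\<lambda>x. 1 / (1 + f x))" if "f \<in> C" for f
    using integrable_inverse_one_plus meas nn that by blast
  have I0: "0 \<le> I f" if "f \<in> C" for f
    unfolding I_def using nn[OF that] by (intro integral_nonneg_AE AE_I2) auto
  have bddb: "bdd_below (I ` C)" using I0 by (auto intro!: bdd_belowI[of _ 0])
  have m_le: "m \<le> I f" if "f \<in> C" for f
    unfolding m_def using bddb that by (auto intro: cInf_lower)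
  \<comment> \<open>The square root (1/4)^n of this rate is summable, which will make
    \<open>u n\<close> converge almost surely and not just along a subsequence.\<close>
  have "\<exists>f\<in>C. I f < m + (1/16)^n" for n :: nat
    using cInf_lessD[of "I ` C" "m + (1/16)^n"] ne unfolding m_def by auto
  then obtain f where fC: "\<And>n. f n \<in> C" and fI: "\<And>n. I (f n) < m + (1/16)^n" by metis
  have fm[measurable]: "f n \<in> borel_measurable M" for n using meas fC by auto
  define u where "u n x = 1 / (1 + f n x)" for n x
  have um[measurable]: "u n \<in> borel_measurable M" for n unfolding u_def by measurable
  have u01: "0 < u n x" "u n x \<le> 1" if "x \<in> space M" for n x
    using nn[OF fC that, of n] by (auto simp: u_def)
  have uint: "integrable M (u n)" for n using int[OF fC[of n]] by (simp add: u_def[abs_def])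
  have uIint: "(\<integral>x. u n x \<partial>M) = I (f n)" for n unfolding u_def I_def ..
  have sqint: "integrable M (\<lambda>x. (u n x - u (Suc n) x)\<^sup>2)" for n
  proof (rule integrable_const_bound[where B=1])
    show "AE x in M. norm ((u n x - u (Suc n) x)\<^sup>2) \<le> 1"
    proof (rule AE_I2)
      fix x assume "x \<in> space M"
      then have "\<bar>u n x - u (Suc n) x\<bar> \<le> 1" using u01[of x n] u01[of x "Suc n"] by linarith
      then show "norm ((u n x - u (Suc n) x)\<^sup>2) \<le> 1" by (simp add: abs_square_le_1)
    qed
  qed simp
  have sq: "(\<integral>x. (u n x - u (Suc n) x)\<^sup>2 \<partial>M) \<le> 4 * (1/16)^n" for n
  proof -
    have midC: "(\<lambda>x. (f n x + f (Suc n) x) / 2) \<in> C"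
      using conv[OF fC[of n] fC[of "Suc n"], of "1/2"] by (simp add: field_simps)
    \<comment> \<open>The midpoint cannot beat the infimum m, while both endpoints are within
      (1/16)^n of it; this squeezes the convexity gap.\<close>
    have "m \<le> (\<integral>x. 1 / (1 + (f n x + f (Suc n) x) / 2) \<partial>M)"
      using m_le[OF midC] by (simp add: I_def)
    also have "\<dots> \<le> (\<integral>x. (u n x + u (Suc n) x) / 2 - (u n x - u (Suc n) x)\<^sup>2 / 4 \<partial>M)"
      unfolding u_def
      by (intro integral_mono int[OF midC] inverse_one_plus_midpoint nn[OF fC])
        (use uint sqint in \<open>auto simp: u_def[symmetric]\<close>)
    also have "\<dots> = (I (f n) + I (f (Suc n))) / 2 - (\<integral>x. (u n x - u (Suc n) x)\<^sup>2 \<partial>M) / 4"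
      using uint sqint by (simp add: uIint)
    finally have "(\<integral>x. (u n x - u (Suc n) x)\<^sup>2 \<partial>M) / 4 \<le> (I (f n) + I (f (Suc n))) / 2 - m" by linarith
    moreover have "I (f (Suc n)) < m + (1/16)^n"
      by (rule less_le_trans[OF fI add_left_mono]) (rule power_decreasing, auto)
    moreover have "D \<le> 4 * e" if "D / 4 \<le> (a + b) / 2 - m" "b < m + e" "a < m + e" for D a b e :: real
      using that by argo
    ultimately show ?thesis using fI[of n] by blast
  qed
  have absint: "(\<integral>\<^sup>+x. ennreal \<bar>u (Suc n) x - u n x\<bar> \<partial>M) \<le> ennreal (3 * (1/4)^n)" for n
  proof -
    \<comment> \<open>The inequality 2 d \<le> 4^n d^2 + 4^(-n) turns the bound on squares, of order
      16^(-n), into a summable bound on first moments.\<close>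
    have "\<bar>u (Suc n) x - u n x\<bar> \<le> (4^n * (u n x - u (Suc n) x)\<^sup>2 + (1/4)^n) / 2" for x
    proof -
      define d where "d = \<bar>u (Suc n) x - u n x\<bar>"
      have e: "(4::real)^n = 2^n * 2^n" "(1/4::real)^n = (1/2)^n * (1/2)^n" "(2::real)^n * (1/2)^n = 1"
        by (simp_all flip: power_mult_distrib)
      have "0 \<le> (2^n * d - (1/2)^n)\<^sup>2" by simp
      also have "\<dots> = 4^n * d\<^sup>2 + (1/4)^n - 2 * (2^n * (1/2)^n) * d"
        unfolding e(1,2) by (simp only: power2_eq_square algebra_simps)
      also have "\<dots> = 4^n * d\<^sup>2 + (1/4)^n - 2 * d" unfolding e(3) by simp
      finally show ?thesis unfolding d_def by (simp add: power2_commute)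
    qed
    then have "(\<integral>\<^sup>+x. ennreal \<bar>u (Suc n) x - u n x\<bar> \<partial>M)
        \<le> (\<integral>\<^sup>+x. ennreal ((4^n * (u n x - u (Suc n) x)\<^sup>2 + (1/4)^n) / 2) \<partial>M)"
      by (intro nn_integral_mono ennreal_leI) auto
    also have "\<dots> = ennreal (\<integral>x. (4^n * (u n x - u (Suc n) x)\<^sup>2 + (1/4)^n) / 2 \<partial>M)"
      using sqint by (intro nn_integral_eq_integral) auto
    also have "(\<integral>x. (4^n * (u n x - u (Suc n) x)\<^sup>2 + (1/4)^n) / 2 \<partial>M)
        = (4^n * (\<integral>x. (u n x - u (Suc n) x)\<^sup>2 \<partial>M) + (1/4)^n) / 2"
      using sqint by (simp add: prob_space)
    also have "\<dots> \<le> (4^n * (4 * (1/16)^n) + (1/4)^n) / 2"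
      using sq[of n] by (intro divide_right_mono add_right_mono mult_left_mono) auto
    also have "\<dots> = 5/2 * (1/4)^n" by (simp flip: power_mult_distrib)
    also have "\<dots> \<le> 3 * (1/4)^n" by simp
    finally show ?thesis by (simp add: ennreal_leI)
  qed
  have AEsum: "AE x in M. summable (\<lambda>n. \<bar>u (Suc n) x - u n x\<bar>)"
  proof -
    have "(\<integral>\<^sup>+x. (\<Sum>n. ennreal \<bar>u (Suc n) x - u n x\<bar>) \<partial>M) = (\<Sum>n. \<integral>\<^sup>+x. ennreal \<bar>u (Suc n) x - u n x\<bar> \<partial>M)"
      by (intro nn_integral_suminf) auto
    also have "\<dots> \<le> (\<Sum>n. ennreal (3 * (1/4)^n))" by (intro suminf_le absint) auto
    also have "\<dots> = ennreal (\<Sum>n. 3 * (1/4)^n)"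
      by (intro suminf_ennreal2 summable_mult summable_geometric) auto
    also have "\<dots> < \<infinity>" by simp
    finally have "AE x in M. (\<Sum>n. ennreal \<bar>u (Suc n) x - u n x\<bar>) \<noteq> \<infinity>"
      by (intro nn_integral_PInf_AE) auto
    then show ?thesis by eventually_elim (auto intro: summable_suminf_not_top)
  qed
  define U where "U x = lim (\<lambda>n. u n x)" for x
  have Um[measurable]: "U \<in> borel_measurable M" unfolding U_def by measurable
  have lim: "AE x in M. (\<lambda>n. u n x) \<longlonglongrightarrow> U x"
    using AEsum
  proof eventually_elim
    case (elim x)
    then have "summable (\<lambda>n. u (Suc n) x - u n x)" by (rule summable_rabs_cancel)
    then have "(\<lambda>n. \<Sum>i<n. u (Suc i) x - u i x) \<longlonglongrightarrow> (\<Sum>n. u (Suc n) x - u n x)" by (rule summable_LIMSEQ)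
    then have "(\<lambda>n. u n x - u 0 x) \<longlonglongrightarrow> (\<Sum>n. u (Suc n) x - u n x)" by (simp only: sum_lessThan_telescope[of "\<lambda>i. u i x"])
    then have "(\<lambda>n. u n x - u 0 x + u 0 x) \<longlonglongrightarrow> (\<Sum>n. u (Suc n) x - u n x) + u 0 x" by (intro tendsto_intros)
    then have "convergent (\<lambda>n. u n x)" by (auto simp: convergent_def)
    then show ?case unfolding U_def by (simp add: convergent_LIMSEQ_iff)
  qed
  \<comment> \<open>Boundedness in probability enters here. Where U is not positive,
    \<open>u n\<close> is eventually below \<delta>, that is, \<open>f n\<close> exceeds c, and each
    \<open>f n\<close> does so with probability at most \<epsilon>.\<close>
  have "prob {x\<in>space M. U x \<le> 0} \<le> \<epsilon>" if \<epsilon>: "0 < \<epsilon>" for \<epsilon>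
  proof -
    obtain c where c: "\<And>h. h \<in> C \<Longrightarrow> prob {x\<in>space M. c < h x} \<le> \<epsilon>" using bdd[OF \<epsilon>] by blast
    define \<delta> where "\<delta> = 1 / (1 + \<bar>c\<bar>)"
    have \<delta>: "0 < \<delta>" by (simp add: \<delta>_def)
    define A where "A N = {x\<in>space M. \<forall>n\<ge>N. u n x < \<delta>}" for N :: nat
    have Am[measurable]: "A N \<in> sets M" for N unfolding A_def by measurable
    have A_le: "prob (A N) \<le> \<epsilon>" for N
    proof -
      have "A N \<subseteq> {x\<in>space M. c < f N x}"
      proof
        fix x assume "x \<in> A N"
        then have w: "x \<in> space M" "inverse (1 + f N x) < inverse (1 + \<bar>c\<bar>)"
          by (simp_all add: A_def u_def \<delta>_def inverse_eq_divide)
        have "1 + \<bar>c\<bar> < 1 + f N x"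
          by (rule inverse_less_imp_less[OF w(2)]) (use nn[OF fC w(1), of N] in linarith)
        then show "x \<in> {x\<in>space M. c < f N x}" using w by auto
      qed
      then have "prob (A N) \<le> prob {x\<in>space M. c < f N x}" by (intro finite_measure_mono) auto
      then show ?thesis using c[OF fC[of N]] by simp
    qed
    have "incseq A" unfolding incseq_def A_def by auto
    then have "(\<lambda>N. prob (A N)) \<longlonglongrightarrow> prob (\<Union>N. A N)" by (intro finite_Lim_measure_incseq) auto
    then have UA: "prob (\<Union>N. A N) \<le> \<epsilon>" using A_le by (intro LIMSEQ_le_const2) auto
    have "prob {x\<in>space M. U x \<le> 0} \<le> prob (\<Union>N. A N)"
    proof (rule finite_measure_mono_AE)
      show "AE x in M. x \<in> {x\<in>space M. U x \<le> 0} \<longrightarrow> x \<in> (\<Union>N. A N)"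
        using lim
      proof (eventually_elim, intro impI)
        fix x assume l: "(\<lambda>n. u n x) \<longlonglongrightarrow> U x" and w: "x \<in> {x\<in>space M. U x \<le> 0}"
        have "U x < \<delta>" using w \<delta> by simp
        with l have "\<forall>\<^sub>F n in sequentially. u n x < \<delta>" by (rule order_tendstoD(2))
        then show "x \<in> (\<Union>N. A N)" using w by (auto simp: A_def eventually_sequentially)
      qed
    qed simp
    then show ?thesis using UA by simp
  qed
  then have "prob {x\<in>space M. U x \<le> 0} \<le> 0" by (rule field_le_epsilon) simp
  then have "{x\<in>space M. U x \<le> 0} \<in> null_sets M"
    by (intro null_setsI) (auto simp: emeasure_eq_measure measure_le_0_iff)
  then have Upos: "AE x in M. 0 < U x"
    by (rule AE_I') auto
  \<comment> \<open>The value 1 on the null set where U is not positive makes g strictly positive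
    everywhere.\<close>
  define g where "g x = (if 0 < U x then (U x)\<^sup>2 else 1)" for x
  have gm: "g \<in> borel_measurable M" unfolding g_def by measurable
  have gpos: "0 < g x" for x by (simp add: g_def)
  have "(\<integral>\<^sup>+x. ennreal (g x * h x) \<partial>M) \<le> 1" if hC: "h \<in> C" for h
  proof -
    have [measurable]: "h \<in> borel_measurable M" using meas hC by auto
    \<comment> \<open>The step tends to 0, but more slowly than the optimality gap (1/16)^n of
      \<open>f n\<close>, so that their quotient (1/8)^n vanishes in the limit.\<close>
    define a where "a n = (1/2::real)^n" for n :: nat
    have a: "0 < a n" "a n \<le> 1" for n by (auto simp: a_def power_le_one)
    define v where "v n x = (u n x)\<^sup>2 * h x / (1 + a n * (u n x * h x))" for n x
    have vm[measurable]: "v n \<in> borel_measurable M" for n unfolding v_def by measurable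
    have v_le: "(\<integral>\<^sup>+x. ennreal (v n x) \<partial>M) \<le> ennreal (1 + (1/8)^n)" for n
    proof -
      define w where "w x = (1 - a n) * f n x + a n * h x" for x
      have wC: "w \<in> C" unfolding w_def using conv[OF fC[of n] hC, of "a n"] a[of n] by simp
      have vw: "v n x \<le> (u n x - 1 / (1 + w x)) / a n + 1" if "x \<in> space M" for x
        unfolding v_def u_def w_def using that by (intro inverse_one_plus_perturb nn[OF fC] nn[OF hC] a)
      have v0: "0 \<le> v n x" if "x \<in> space M" for x
        unfolding v_def using u01[OF that, of n] nn[OF hC that] a(1)[of n] by (intro divide_nonneg_nonneg) auto
      have wint: "integrable M (\<lambda>x. (u n x - 1 / (1 + w x)) / a n + 1)"
        using uint int[OF wC] by auto
      have "(\<integral>\<^sup>+x. ennreal (v n x) \<partial>M) \<le> (\<integral>\<^sup>+x. ennreal ((u n x - 1 / (1 + w x)) / a n + 1) \<partial>M)"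
        by (intro nn_integral_mono ennreal_leI vw)
      also have "\<dots> = ennreal (\<integral>x. (u n x - 1 / (1 + w x)) / a n + 1 \<partial>M)"
        by (intro nn_integral_eq_integral wint AE_I2) (rule order_trans[OF v0 vw])
      also have "(\<integral>x. (u n x - 1 / (1 + w x)) / a n + 1 \<partial>M) = (I (f n) - I w) / a n + 1"
        using uint int[OF wC] by (simp add: uIint I_def[of w] prob_space)
      also have "\<dots> \<le> (1/16)^n / a n + 1"
      proof (intro add_right_mono divide_right_mono)
        have "a - c \<le> e" if "a < m + e" "m \<le> c" for a c e :: real using that by simp
        then show "I (f n) - I w \<le> (1/16)^n" using fI[of n] m_le[OF wC] by blast
      qed (use a(1)[of n] in simp)
      also have "(1/16)^n / a n + 1 = 1 + (1/8)^n"
        unfolding a_def by (subst power_divide[symmetric]) simp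
      finally show ?thesis by (simp add: ennreal_leI)
    qed
    have "AE x in M. (\<lambda>n. ennreal (v n x)) \<longlonglongrightarrow> ennreal (g x * h x)"
      using lim Upos
    proof eventually_elim
      case (elim x)
      have a: "a \<longlonglongrightarrow> 0" unfolding a_def by (rule LIMSEQ_realpow_zero) auto
      have "(\<lambda>n. v n x) \<longlonglongrightarrow> (U x)\<^sup>2 * h x / (1 + 0 * (U x * h x))"
        unfolding v_def using elim a by (intro tendsto_intros) auto
      then show ?case using elim by (simp add: g_def)
    qed
    then have "AE x in M. ennreal (g x * h x) = liminf (\<lambda>n. ennreal (v n x))"
      by eventually_elim (simp add: lim_imp_Liminf)
    then have "(\<integral>\<^sup>+x. ennreal (g x * h x) \<partial>M) = (\<integral>\<^sup>+x. liminf (\<lambda>n. ennreal (v n x)) \<partial>M)"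
      by (rule nn_integral_cong_AE)
    also have "\<dots> \<le> liminf (\<lambda>n. \<integral>\<^sup>+x. ennreal (v n x) \<partial>M)" by (intro nn_integral_liminf) auto
    also have "\<dots> \<le> liminf (\<lambda>n. ennreal (1 + (1/8)^n))" by (intro Liminf_mono always_eventually) (use v_le in auto)
    also have "\<dots> = 1"
    proof (intro lim_imp_Liminf)
      have "(\<lambda>n. ennreal (1 + (1/8)^n)) \<longlonglongrightarrow> ennreal (1 + 0)"
        by (intro tendsto_ennrealI tendsto_add LIMSEQ_realpow_zero tendsto_const) auto
      then show "(\<lambda>n. ennreal (1 + (1/8)^n)) \<longlonglongrightarrow> 1" by simp
    qed simp
    finally show ?thesis .
  qed
  then show ?thesis using gm gpos by (intro bexI[of _ g]) auto
qed

section \<open>Essential suprema of families closed under pasting\<close>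

text \<open>Pasting along the set where one conditional expectation exceeds another shows that the
  conditional expectations of members of C are directed upwards, so that their essential supremum Z
  is an increasing limit of a sequence of them. This gives the second inequality; the first says
  that Z dominates each of them. Test functions \<xi> allow both to be used as plain inequalities
  between integrals.\<close>

lemma (in prob_space) essential_supremum_of_pasting_family:
  fixes C :: "('a \<Rightarrow> ennreal) set" and G :: "'a measure"
  assumes sub: "subalgebra M G" and ne: "C \<noteq> {}"
    and meas: "\<And>f. f \<in> C \<Longrightarrow> f \<in> borel_measurable M"
    and paste: "\<And>f h A. f \<in> C \<Longrightarrow> h \<in> C \<Longrightarrow> A \<in> sets G \<Longrightarrow> (\<lambda>x. if x \<in> A then f x else h x) \<in> C"
    and bdd: "\<And>f. f \<in> C \<Longrightarrow> (\<integral>\<^sup>+x. f x \<partial>M) \<le> 1"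
  shows "\<exists>Z\<in>borel_measurable G.
      (\<forall>f\<in>C. \<forall>\<xi>\<in>borel_measurable G. (\<integral>\<^sup>+x. f x * \<xi> x \<partial>M) \<le> (\<integral>\<^sup>+x. Z x * \<xi> x \<partial>M)) \<and>
      (\<forall>\<xi>\<in>borel_measurable G. (\<integral>\<^sup>+x. Z x * \<xi> x \<partial>M) \<le> (SUP f\<in>C. \<integral>\<^sup>+x. f x * \<xi> x \<partial>M))"
proof -
  let ?J = "\<lambda>f \<xi>. \<integral>\<^sup>+x. f x * \<xi> x \<partial>M" and ?I = "\<lambda>f. \<integral>\<^sup>+x. f x \<partial>M"
  interpret G: finite_measure_subalgebra M G by unfold_locales (rule sub)
  have GM: "f \<in> borel_measurable M" if "f \<in> borel_measurable G" for f :: "'a \<Rightarrow> ennreal"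
    using measurable_from_subalg[OF sub that] .
  have setsGM: "A \<in> sets M" if "A \<in> sets G" for A using sub that by (auto simp: subalgebra_def)
  have spG: "space G = space M" using sub by (simp add: subalgebra_def)
  define E where "E f = nn_cond_exp M G f" for f
  have Em: "E f \<in> borel_measurable G" for f unfolding E_def by simp
  \<comment> \<open>\<open>rep Z f\<close> says that Z is a version of the conditional expectation
    of the single member f of C, expressed through test functions.\<close>
  define rep where "rep Z f \<longleftrightarrow> Z \<in> borel_measurable G \<and> f \<in> C \<and>
      (\<forall>\<xi>\<in>borel_measurable G. ?J Z \<xi> = ?J f \<xi>)" for Z f
  have repE: "rep (E f) f" if "f \<in> C" for f
    unfolding rep_def E_def using G.nn_cond_exp_intg[OF _ meas[OF that]] that by (auto simp: mult.commute)
  have repmax: "\<exists>h. rep (\<lambda>x. max (Z x) (Z' x)) h" if r: "rep Z f" "rep Z' f'" for Z Z' f f'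
  proof (intro exI)
    define A where "A = {x\<in>space G. Z' x < Z x}"
    have [measurable]: "Z \<in> borel_measurable G" "Z' \<in> borel_measurable G" using r by (auto simp: rep_def)
    have A: "A \<in> sets G" unfolding A_def by measurable
    define h where "h = (\<lambda>x. if x \<in> A then f x else f' x)"
    have fC: "f \<in> C" "f' \<in> C" using r by (auto simp: rep_def)
    have [measurable]: "f \<in> borel_measurable M" "f' \<in> borel_measurable M" "A \<in> sets M"
      "Z \<in> borel_measurable M" "Z' \<in> borel_measurable M"
      using fC meas setsGM A by (auto intro: GM)
    show "rep (\<lambda>x. max (Z x) (Z' x)) h"
      unfolding rep_def
    proof (intro conjI ballI)
      show "(\<lambda>x. max (Z x) (Z' x)) \<in> borel_measurable G" by measurable
      show "h \<in> C" unfolding h_def using fC A by (rule paste)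
      fix \<xi> :: "'a \<Rightarrow> ennreal" assume \<xi>: "\<xi> \<in> borel_measurable G"
      then have [measurable]: "\<xi> \<in> borel_measurable M" by (rule GM)
      have m1: "(\<lambda>x. \<xi> x * indicator A x) \<in> borel_measurable G" "(\<lambda>x. \<xi> x * indicator (space G - A) x) \<in> borel_measurable G"
        using \<xi> A by measurable
      have "(\<integral>\<^sup>+x. max (Z x) (Z' x) * \<xi> x \<partial>M)
          = (\<integral>\<^sup>+x. Z x * (\<xi> x * indicator A x) + Z' x * (\<xi> x * indicator (space G - A) x) \<partial>M)"
        by (intro nn_integral_cong) (auto simp: A_def spG max_def indicator_def)
      also have "\<dots> = (\<integral>\<^sup>+x. Z x * (\<xi> x * indicator A x) \<partial>M) + (\<integral>\<^sup>+x. Z' x * (\<xi> x * indicator (space G - A) x) \<partial>M)"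
        using m1 by (intro nn_integral_add) (auto intro!: borel_measurable_times_ennreal GM)
      also have "\<dots> = (\<integral>\<^sup>+x. f x * (\<xi> x * indicator A x) \<partial>M) + (\<integral>\<^sup>+x. f' x * (\<xi> x * indicator (space G - A) x) \<partial>M)"
        using r m1 by (auto simp: rep_def)
      also have "\<dots> = (\<integral>\<^sup>+x. f x * (\<xi> x * indicator A x) + f' x * (\<xi> x * indicator (space G - A) x) \<partial>M)"
        using spG by (intro nn_integral_add[symmetric]) (simp_all, measurable)
      also have "\<dots> = ?J h \<xi>"
        by (intro nn_integral_cong) (auto simp: h_def spG indicator_def)
      finally show "(\<integral>\<^sup>+x. max (Z x) (Z' x) * \<xi> x \<partial>M) = ?J h \<xi>" .
    qed
  qed
  define S where "S = (SUP f\<in>C. \<integral>\<^sup>+x. f x \<partial>M)"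
  have S1: "S \<le> 1" unfolding S_def by (intro SUP_least bdd)
  have rep_le: "?I Z \<le> S" if "rep Z f" for Z f
  proof -
    have "?I Z = ?I f"
      using that unfolding rep_def by (auto dest!: bspec[where x="\<lambda>_. 1"])
    also have "\<dots> \<le> S" unfolding S_def using that by (intro SUP_upper) (auto simp: rep_def)
    finally show ?thesis .
  qed
  obtain s :: "nat \<Rightarrow> ennreal" where "range s \<subseteq> (\<lambda>f. \<integral>\<^sup>+x. f x \<partial>M) ` C" and s: "S = (SUP n. s n)"
    using ennreal_Sup_countable_SUP[of "(\<lambda>f. \<integral>\<^sup>+x. f x \<partial>M) ` C"] ne unfolding S_def by (metis image_is_empty)
  then have "s n \<in> (\<lambda>f. \<integral>\<^sup>+x. f x \<partial>M) ` C" for n by (simp only: image_subset_iff) simp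
  then have "\<exists>f\<in>C. ?I f = s n" for n by (metis (no_types, lifting) imageE)
  then obtain f where fC: "\<And>n. f n \<in> C" and fs: "\<And>n. ?I (f n) = s n" by metis
  \<comment> \<open>Running maxima of conditional expectations along a sequence whose expectations
    have supremum S. By \<open>repmax\<close> each maximum is still represented by one member of C,
    so its integral is at most S.\<close>
  define Zn where "Zn = rec_nat (E (f 0)) (\<lambda>n z x. max (z x) (E (f (Suc n)) x))"
  have Zn: "Zn 0 = E (f 0)" "Zn (Suc n) = (\<lambda>x. max (Zn n x) (E (f (Suc n)) x))" for n
    by (simp_all add: Zn_def)
  have repZn: "\<exists>h. rep (Zn n) h" for n
    by (induction n) (use Zn repE fC repmax in \<open>metis+\<close>)
  then obtain h where h: "\<And>n. rep (Zn n) (h n)" by metis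
  have inc: "incseq Zn" by (rule incseq_SucI) (auto simp: Zn le_fun_def)
  have Znm[measurable]: "Zn n \<in> borel_measurable G" for n using h by (auto simp: rep_def)
  have ZnM[measurable]: "Zn n \<in> borel_measurable M" for n by (rule GM) simp
  have EZn: "E (f n) x \<le> Zn n x" for n x by (cases n) (auto simp: Zn)
  define Z where "Z x = (SUP n. Zn n x)" for x
  have Zm[measurable]: "Z \<in> borel_measurable G" unfolding Z_def by measurable
  have ZM[measurable]: "Z \<in> borel_measurable M" by (rule GM) simp
  have intZ: "?J Z \<xi> = (SUP n. \<integral>\<^sup>+x. Zn n x * \<xi> x \<partial>M)" if \<xi>: "\<xi> \<in> borel_measurable M" for \<xi>
  proof -
    note \<xi>[measurable]
    have "?J Z \<xi> = (\<integral>\<^sup>+x. (SUP n. Zn n x * \<xi> x) \<partial>M)"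
      unfolding Z_def by (simp add: SUP_mult_right_ennreal)
    also have "\<dots> = (SUP n. \<integral>\<^sup>+x. Zn n x * \<xi> x \<partial>M)"
      by (intro nn_integral_monotone_convergence_SUP)
        (use inc in \<open>auto simp: incseq_def le_fun_def intro!: mult_right_mono\<close>)
    finally show ?thesis .
  qed
  have SZ: "S \<le> ?I Z"
    unfolding s
  proof (rule SUP_least)
    fix n
    have "s n = ?I (E (f n))"
      using repE[OF fC[of n]] fs[of n] unfolding rep_def by (auto dest!: bspec[where x="\<lambda>_. 1"])
    also have "\<dots> \<le> ?I Z"
      by (intro nn_integral_mono order_trans[OF EZn[of n]]) (auto simp: Z_def intro: SUP_upper)
    finally show "s n \<le> ?I Z" .
  qed
  have ZS: "?I Z \<le> S"
    using intZ[of "\<lambda>_. 1"] rep_le[OF h] by (auto intro: SUP_least)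
  \<comment> \<open>The maximum of Z and \<open>E k\<close> is again a limit of represented
    functions, so its integral is at most S, the finite integral of Z. Hence it cannot exceed Z on a
    set of positive probability.\<close>
  have EfZ: "AE x in M. E k x \<le> Z x" if kC: "k \<in> C" for k
  proof -
    have [measurable]: "E k \<in> borel_measurable M" by (rule GM) (rule Em)
    define W where "W x = max (Z x) (E k x)" for x
    have [measurable]: "W \<in> borel_measurable M" unfolding W_def by measurable
    have "?I W = (\<integral>\<^sup>+x. (SUP n. max (Zn n x) (E k x)) \<partial>M)"
      unfolding W_def Z_def by (simp add: max_def flip: sup_max SUP_sup_const2)
    also have "\<dots> = (SUP n. \<integral>\<^sup>+x. max (Zn n x) (E k x) \<partial>M)"
      by (intro nn_integral_monotone_convergence_SUP)
        (use inc in \<open>auto simp: incseq_def le_fun_def intro: le_max_iff_disj[THEN iffD2]\<close>)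
    also have "\<dots> \<le> S"
      by (rule SUP_least) (use repmax[OF h repE[OF kC]] rep_le in blast)
    finally have "?I W \<le> ?I Z" using SZ by simp
    moreover have fin: "?I Z \<noteq> \<infinity>"
      using order_trans[OF ZS S1] by (metis ennreal_one_neq_top infinity_ennreal_def top.extremum_uniqueI)
    moreover have "(\<integral>\<^sup>+x. W x - Z x \<partial>M) = ?I W - ?I Z"
      using fin by (intro nn_integral_diff) (auto simp: W_def)
    ultimately have "(\<integral>\<^sup>+x. W x - Z x \<partial>M) = 0"
      by (metis diff_eq_0_ennreal infinity_ennreal_def le_less_trans less_top)
    then have "AE x in M. W x - Z x = 0" by (subst (asm) nn_integral_0_iff_AE) auto
    moreover have "AE x in M. Z x \<noteq> \<infinity>" using fin by (intro nn_integral_PInf_AE) auto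
    ultimately show ?thesis
      by eventually_elim (auto simp: W_def diff_eq_0_iff_ennreal less_top)
  qed
  show ?thesis
  proof (intro bexI[OF _ Zm] conjI ballI)
    fix k \<xi> :: "'a \<Rightarrow> ennreal" assume kC: "k \<in> C" and \<xi>: "\<xi> \<in> borel_measurable G"
    have "?J k \<xi> = ?J (E k) \<xi>" using repE[OF kC] \<xi> by (auto simp: rep_def)
    also have "\<dots> \<le> ?J Z \<xi>"
      by (rule nn_integral_mono_AE) (use EfZ[OF kC] in \<open>eventually_elim, auto intro: mult_right_mono\<close>)
    finally show "?J k \<xi> \<le> ?J Z \<xi>" .
  next
    fix \<xi> :: "'a \<Rightarrow> ennreal" assume \<xi>: "\<xi> \<in> borel_measurable G"
    have "?J (Zn n) \<xi> \<le> (SUP f\<in>C. \<integral>\<^sup>+x. f x * \<xi> x \<partial>M)" for n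
      using h[of n] \<xi> by (auto simp: rep_def intro!: SUP_upper2[of "h n"])
    then show "?J Z \<xi> \<le> (SUP f\<in>C. \<integral>\<^sup>+x. f x * \<xi> x \<partial>M)"
      by (subst intZ[OF GM[OF \<xi>]]) (rule SUP_least)
  qed
qed

lemma (in prob_space) AE_from_probability_bounds:
  assumes B: "\<And>j::nat. B j \<in> sets M" and le: "\<And>j. 0 < j \<Longrightarrow> prob (B j) \<le> c / real j"
  shows "AE x in M. \<exists>j>0. x \<notin> B j"
proof -
  have B': "(\<Inter>j. B (Suc j)) \<in> sets M" using B by (intro sets.countable_INT) auto
  have "prob (\<Inter>j. B (Suc j)) \<le> c / real (Suc j)" for j
    by (rule order_trans[OF finite_measure_mono le[of "Suc j"]]) (auto intro: B)
  moreover have "(\<lambda>j. c / real (Suc j)) \<longlonglongrightarrow> 0" by real_asymp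
  ultimately have "prob (\<Inter>j. B (Suc j)) \<le> 0" by (intro LIMSEQ_le_const) auto
  then have "(\<Inter>j. B (Suc j)) \<in> null_sets M"
    using B' by (intro null_setsI) (auto simp: emeasure_eq_measure measure_le_0_iff)
  then show ?thesis by (rule AE_I') auto
qed

lemma (in prob_space) scaled_indicator:
  assumes "A \<in> sets M"
  shows "integrable M (\<lambda>x. c * indicator A x :: real)" "(\<integral>x. c * indicator A x \<partial>M) = c * prob A"
proof -
  have "integrable M (indicator A :: 'a \<Rightarrow> real)" using assms by (simp add: emeasure_eq_measure)
  then show "integrable M (\<lambda>x. c * indicator A x :: real)" by simp
  show "(\<integral>x. c * indicator A x \<partial>M) = c * prob A"
    using sets.sets_into_space[OF assms] by (simp add: Int_absorb2)
qed

section \<open>Paths with right limits\<close>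

text \<open>The position carried from index i to i + 1: buy below a, keep until the value exceeds b.
  It depends on the values up to index i only, so the strategy is predictable.\<close>

primrec holding :: "real \<Rightarrow> real \<Rightarrow> (nat \<Rightarrow> real) \<Rightarrow> nat \<Rightarrow> bool" where
  "holding a b x 0 \<longleftrightarrow> x 0 < a"
| "holding a b x (Suc i) \<longleftrightarrow> (if holding a b x i then x (Suc i) \<le> b else x (Suc i) < a)"

primrec upcrossings :: "real \<Rightarrow> real \<Rightarrow> (nat \<Rightarrow> real) \<Rightarrow> nat \<Rightarrow> nat" where
  "upcrossings a b x 0 = 0"
| "upcrossings a b x (Suc i) = upcrossings a b x i + (if holding a b x i \<and> b < x (Suc i) then 1 else 0)"

text \<open>Buying below a and selling above b gains b - a per completed upcrossing and loses at most the
  shortfall below a of a position still open at the end.\<close>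

lemma upcrossings_gain:
  assumes "a < b"
  shows "(b - a) * real (upcrossings a b x n) + (if holding a b x n then x n - a else 0)
    \<le> (\<Sum>i<n. (if holding a b x i then 1 else 0) * (x (Suc i) - x i))"
proof (induction n)
  case (Suc n)
  then show ?case using assms by (auto simp: algebra_simps)
qed auto

lemma upcrossings_mono: "m \<le> n \<Longrightarrow> upcrossings a b x m \<le> upcrossings a b x n"
  by (rule lift_Suc_mono_le[of "upcrossings a b x"]) auto

lemma holding_below: "a < b \<Longrightarrow> x p < a \<Longrightarrow> holding a b x p"
  by (cases p) auto

text \<open>A position is closed only by completing an upcrossing. As long as the count stagnates,
  the position stays open and the values stay at most b.\<close>

lemma holding_without_upcrossing:
  assumes "holding a b x p"
  shows "upcrossings a b x (p + k) = upcrossings a b x p \<Longrightarrow>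
    holding a b x (p + k) \<and> (0 < k \<longrightarrow> x (p + k) \<le> b)"
proof (induction k)
  case (Suc k)
  then have "upcrossings a b x (p + k) = upcrossings a b x p"
    using upcrossings_mono[of p "p + k" a b x] upcrossings_mono[of "p + k" "p + Suc k" a b x] by simp
  then show ?case using Suc by (auto split: if_splits)
qed (use assms in simp)

lemma upcrossings_increase:
  assumes "a < b" "x p < a" "b < x q" "p < q"
  shows "upcrossings a b x p < upcrossings a b x q"
proof (rule ccontr)
  assume "\<not> ?thesis"
  with upcrossings_mono[of p q a b x] assms have "upcrossings a b x (p + (q - p)) = upcrossings a b x p" by simp
  from holding_without_upcrossing[OF holding_below[of a b x p, OF assms(1,2)] this] assms show False by simp
qed

text \<open>Alternation of values below a and above b, read from right to left: an oscillation at a point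
  from the right produces such chains of every length.\<close>

primrec chain :: "real set \<Rightarrow> (real \<Rightarrow> real) \<Rightarrow> real \<Rightarrow> real \<Rightarrow> nat \<Rightarrow> real \<Rightarrow> bool" where
  "chain D x a b 0 e \<longleftrightarrow> True"
| "chain D x a b (Suc j) e \<longleftrightarrow> (\<exists>p\<in>D. \<exists>q\<in>D. p < q \<and> q \<le> e \<and> x p < a \<and> b < x q \<and> chain D x a b j p)"

lemma chain_mono: "D \<subseteq> D' \<Longrightarrow> chain D x a b j e \<Longrightarrow> chain D' x a b j e"
proof (induction j arbitrary: e)
  case (Suc j)
  then show ?case by (simp only: chain.simps) (meson subsetD)
qed simp

section \<open>Dyadic grids and approximation from the right\<close>

definition grid :: "nat \<Rightarrow> real set" where
  "grid m = range (\<lambda>i::nat. real i / 2 ^ m)"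

definition dyadics :: "real set" where
  "dyadics = (\<Union>m. grid m)"

lemma grid_Suc: "grid m \<subseteq> grid (Suc m)"
proof
  fix x assume "x \<in> grid m"
  then obtain i :: nat where "x = real i / 2 ^ m" by (auto simp: grid_def)
  then have "x = real (2 * i) / 2 ^ Suc m" by simp
  then show "x \<in> grid (Suc m)" unfolding grid_def by blast
qed

lemma grid_mono: "m \<le> n \<Longrightarrow> grid m \<subseteq> grid n"
  using grid_Suc by (rule lift_Suc_mono_le)

lemma dyadics_nonneg: "q \<in> dyadics \<Longrightarrow> 0 \<le> q"
  by (auto simp: dyadics_def grid_def)

lemma countable_dyadics: "countable dyadics"
  by (simp add: dyadics_def grid_def)

lemma nat_dyadic: "real N \<in> dyadics" "real N \<in> grid m"
proof -
  have "real N = real (N * 2 ^ m) / 2 ^ m" for m by simp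
  then show "real N \<in> grid m" for m unfolding grid_def by blast
  then show "real N \<in> dyadics" unfolding dyadics_def by blast
qed

text \<open>Floor plus one instead of the ceiling: the approximation lies strictly to the right of t
  even if t is on the grid, as right limits at t require.\<close>

definition dyadic_above :: "nat \<Rightarrow> real \<Rightarrow> real" where
  "dyadic_above n t = (of_int \<lfloor>t * 2 ^ n\<rfloor> + 1) / 2 ^ n"

lemma dyadic_above_gt: "t < dyadic_above n t"
  unfolding dyadic_above_def by (simp add: less_divide_eq)

lemma dyadic_above_le: "dyadic_above n t \<le> t + 1 / 2 ^ n"
  unfolding dyadic_above_def by (simp add: field_simps)

lemma dyadic_above_grid:
  assumes "0 \<le> t"
  shows "dyadic_above n t \<in> grid n"
proof -
  have "dyadic_above n t = real (nat (\<lfloor>t * 2 ^ n\<rfloor> + 1)) / 2 ^ n"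
    using assms by (simp add: dyadic_above_def)
  then show ?thesis unfolding grid_def by blast
qed

lemma dyadic_above_in: "0 \<le> t \<Longrightarrow> dyadic_above n t \<in> dyadics"
  using dyadic_above_grid by (auto simp: dyadics_def)

lemma dyadic_above_tendsto: "(\<lambda>n. dyadic_above n t) \<longlonglongrightarrow> t"
proof (rule tendsto_sandwich[OF always_eventually always_eventually])
  show "\<forall>n. t \<le> dyadic_above n t" using dyadic_above_gt by (simp add: less_imp_le)
  show "\<forall>n. dyadic_above n t \<le> t + 1 / 2 ^ n" using dyadic_above_le by simp
  have "(\<lambda>n. t + (1/2) ^ n) \<longlonglongrightarrow> t + 0" by (intro tendsto_intros LIMSEQ_realpow_zero) auto
  then show "(\<lambda>n. t + 1 / 2 ^ n) \<longlonglongrightarrow> t" by (simp add: power_one_over)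
qed simp

abbreviation right_dyadic :: "real \<Rightarrow> real filter" where
  "right_dyadic t \<equiv> at t within (dyadics \<inter> {t<..})"

lemma dyadic_above_filterlim: "0 \<le> t \<Longrightarrow> filterlim (\<lambda>n. dyadic_above n t) (right_dyadic t) sequentially"
  using dyadic_above_tendsto dyadic_above_gt dyadic_above_in
  by (auto simp: filterlim_at intro!: always_eventually) (metis less_irrefl)

lemma right_dyadic_nontrivial: "0 \<le> t \<Longrightarrow> right_dyadic t \<noteq> bot"
  using dyadic_above_filterlim[of t] by (auto simp: filterlim_def bot_unique filtermap_bot_iff)

lemma dyadic_dense:
  assumes "0 \<le> s" "s < t"
  obtains q where "q \<in> dyadics" "s < q" "q < t"
proof -
  have "\<forall>\<^sub>F n in sequentially. dyadic_above n s < t" using dyadic_above_tendsto assms(2) by (rule order_tendstoD)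
  then obtain n where "dyadic_above n s < t" by (auto simp: eventually_sequentially)
  then show thesis using that dyadic_above_in[OF assms(1)] dyadic_above_gt by blast
qed

lemma right_dyadic_eventually_less:
  "t < u \<Longrightarrow> \<forall>\<^sub>F q in right_dyadic t. t < q \<and> q < u \<and> q \<in> dyadics"
  unfolding eventually_at by (intro exI[of _ "u - t"]) (auto simp: dist_real_def)

text \<open>A chain of fixed length involves finitely many dyadic points and so lives on a single
  grid. This transfers bounds for discrete time to all dyadics.\<close>

lemma chain_grid:
  assumes "chain dyadics x a b j e"
  shows "\<exists>m. chain (grid m) x a b j e"
  using assms
proof (induction j arbitrary: e)
  case (Suc j)
  then obtain p q where pq: "p \<in> dyadics" "q \<in> dyadics" "p < q" "q \<le> e" "x p < a" "b < x q" "chain dyadics x a b j p"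
    by auto
  obtain m1 m2 m3 where m: "p \<in> grid m1" "q \<in> grid m2" "chain (grid m3) x a b j p"
    using pq(1,2) Suc.IH[OF pq(7)] by (auto simp: dyadics_def)
  define m where "m = max m1 (max m2 m3)"
  have m_le: "m1 \<le> m" "m2 \<le> m" "m3 \<le> m" by (auto simp: m_def)
  have "p \<in> grid m" "q \<in> grid m" "chain (grid m) x a b j p"
    using m grid_mono[of m1 m] grid_mono[of m2 m] chain_mono[OF grid_mono[of m3 m]] m_le by blast+
  then show ?case using pq by auto
qed auto

text \<open>Each link completes an upcrossing between its points p and q, and the rest of the chain
  ends at p, so no upcrossing is counted twice.\<close>

lemma chain_le_upcrossings:
  assumes "a < b" "chain (grid m) x a b j (real n / 2 ^ m)"
  shows "j \<le> upcrossings a b (\<lambda>i. x (real i / 2 ^ m)) n"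
  using assms(2)
proof (induction j arbitrary: n)
  case (Suc j)
  then obtain p q :: nat where pq: "real p / 2 ^ m < real q / 2 ^ m" "real q / 2 ^ m \<le> real n / 2 ^ m"
      "x (real p / 2 ^ m) < a" "b < x (real q / 2 ^ m)" "chain (grid m) x a b j (real p / 2 ^ m)"
    by (auto simp: grid_def)
  have "p < q" "q \<le> n" using pq(1,2) by (simp_all add: divide_less_cancel divide_le_cancel)
  then show ?case
    using Suc.IH[OF pq(5)] upcrossings_increase[of a b "\<lambda>i. x (real i / 2 ^ m)" p q] assms(1) pq(3,4)
      upcrossings_mono[of q n a b "\<lambda>i. x (real i / 2 ^ m)"] by simp
qed simp

text \<open>If the lower limit at t were smaller than the upper one, two rational levels would
  separate them, and both would be passed in every right neighbourhood of t, giving chains of every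
  length. Rational levels keep the number of exceptional sets countable; the bound K makes the limit
  finite.\<close>

lemma right_limit_exists:
  fixes x :: "real \<Rightarrow> real"
  assumes t: "0 \<le> t" "t < N"
    and bounds: "\<And>q. q \<in> dyadics \<Longrightarrow> q \<le> N \<Longrightarrow> 0 \<le> x q \<and> x q \<le> K"
    and osc: "\<And>a b. a \<in> \<rat> \<Longrightarrow> b \<in> \<rat> \<Longrightarrow> a < b \<Longrightarrow> \<exists>j. \<not> chain dyadics x a b j N"
  shows "\<exists>l. (x \<longlongrightarrow> l) (right_dyadic t)"
proof -
  let ?F = "right_dyadic t"
  have nt: "?F \<noteq> bot" by (rule right_dyadic_nontrivial[OF t(1)])
  have ev: "\<forall>\<^sub>F q in ?F. 0 \<le> x q \<and> x q \<le> K"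
    using right_dyadic_eventually_less[OF t(2)] by eventually_elim (use bounds in auto)
  have Sup_le: "Limsup ?F (\<lambda>q. ereal (x q)) \<le> Liminf ?F (\<lambda>q. ereal (x q))"
  proof (rule ccontr)
    assume "\<not> ?thesis"
    then have "Liminf ?F (\<lambda>q. ereal (x q)) < Limsup ?F (\<lambda>q. ereal (x q))" by simp
    then obtain c where c: "Liminf ?F (\<lambda>q. ereal (x q)) < ereal (real_of_rat c)" "ereal (real_of_rat c) < Limsup ?F (\<lambda>q. ereal (x q))"
      using ereal_dense3 by blast
    obtain d where d: "ereal (real_of_rat c) < ereal (real_of_rat d)" "ereal (real_of_rat d) < Limsup ?F (\<lambda>q. ereal (x q))"
      using ereal_dense3[OF c(2)] by blast
    define a b where "a = real_of_rat c" and "b = real_of_rat d"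
    have ab: "a < b" "a \<in> \<rat>" "b \<in> \<rat>" using d by (auto simp: a_def b_def)
    have lo: "\<exists>\<^sub>F q in ?F. x q < a"
    proof (rule ccontr)
      assume "\<not> (\<exists>\<^sub>F q in ?F. x q < a)"
      then have "ereal a \<le> Liminf ?F (\<lambda>q. ereal (x q))"
        by (intro Liminf_bounded) (simp add: frequently_def not_less)
      then show False using c(1) by (simp add: a_def)
    qed
    have hi: "\<exists>\<^sub>F q in ?F. b < x q"
    proof (rule ccontr)
      assume "\<not> (\<exists>\<^sub>F q in ?F. b < x q)"
      then have "Limsup ?F (\<lambda>q. ereal (x q)) \<le> ereal b"
        by (intro Limsup_bounded) (simp add: frequently_def not_less)
      then show False using d(2) by (simp add: b_def)
    qed
    \<comment> \<open>Built from right to left: the next link always fits strictly between t and the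
      previous one, since both levels are visited arbitrarily close to t.\<close>
    have "chain dyadics x a b j e" if "t < e" for j e
      using that
    proof (induction j arbitrary: e)
      case (Suc j)
      have "\<exists>\<^sub>F q in ?F. b < x q \<and> (t < q \<and> q < e \<and> q \<in> dyadics)"
        by (rule frequently_eventually_frequently[OF hi right_dyadic_eventually_less[OF Suc.prems]])
      then obtain q where q: "b < x q" "t < q" "q < e" "q \<in> dyadics" by (auto dest!: frequently_ex)
      have "\<exists>\<^sub>F p in ?F. x p < a \<and> (t < p \<and> p < q \<and> p \<in> dyadics)"
        by (rule frequently_eventually_frequently[OF lo right_dyadic_eventually_less[OF q(2)]])
      then obtain p where p: "x p < a" "t < p" "p < q" "p \<in> dyadics" by (auto dest!: frequently_ex)
      then show ?case unfolding chain.simps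
        using q Suc.IH[OF p(2)] by (intro bexI[of _ p] bexI[of _ q] conjI) auto
    qed simp
    then show False using osc[OF ab(2,3,1)] t(2) by blast
  qed
  define L where "L = Liminf ?F (\<lambda>q. ereal (x q))"
  have "0 \<le> L" unfolding L_def by (intro Liminf_bounded) (use ev in \<open>eventually_elim, simp\<close>)
  moreover have "L \<le> ereal K"
    unfolding L_def by (rule order_trans[OF Liminf_le_Limsup[OF nt] Limsup_bounded]) (use ev in \<open>eventually_elim, simp\<close>)
  ultimately obtain l where l: "L = ereal l" by (cases L) auto
  have "((\<lambda>q. ereal (x q)) \<longlongrightarrow> ereal l) ?F"
    using Sup_le Liminf_le_Limsup[OF nt, of "\<lambda>q. ereal (x q)"] l unfolding L_def
    by (intro limsup_le_liminf_real Liminf_eq_Limsup[OF nt]) auto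
  then show ?thesis by auto
qed

text \<open>Shortly after t the values at dyadics are within e/2 of \<open>l t\<close>; every
  \<open>l s\<close> there is a limit of such values and inherits the bound.\<close>

lemma right_limits_right_continuous:
  fixes x l :: "real \<Rightarrow> real"
  assumes t: "0 \<le> t" "t < N" and lim: "\<And>s. t \<le> s \<Longrightarrow> s < N \<Longrightarrow> (x \<longlongrightarrow> l s) (right_dyadic s)"
  shows "(l \<longlongrightarrow> l t) (at_right t)"
proof (rule tendstoI)
  fix e :: real assume e: "0 < e"
  have "\<forall>\<^sub>F q in right_dyadic t. dist (x q) (l t) < e / 2" using tendstoD[OF lim[OF order_refl t(2)], of "e/2"] e by simp
  then obtain d where d: "0 < d" "\<And>q. q \<in> dyadics \<Longrightarrow> t < q \<Longrightarrow> q < t + d \<Longrightarrow> dist (x q) (l t) < e / 2"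
    by (auto simp: eventually_at dist_real_def)
  have "dist (l s) (l t) < e" if s: "t < s" "s < min N (t + d)" for s
  proof -
    have "\<forall>\<^sub>F q in right_dyadic s. dist (x q) (l t) \<le> e / 2"
      using right_dyadic_eventually_less[of s "t + d"] s
      by (auto elim!: eventually_mono simp del: dist_real_def) (use d(2) in force)
    moreover have "((\<lambda>q. dist (x q) (l t)) \<longlongrightarrow> dist (l s) (l t)) (right_dyadic s)"
      using s by (intro tendsto_dist lim tendsto_const) auto
    ultimately have "dist (l s) (l t) \<le> e / 2"
      using right_dyadic_nontrivial[of s] s t by (intro tendsto_upperbound) auto
    then show ?thesis using e by simp
  qed
  then show "\<forall>\<^sub>F s in at_right t. dist (l s) (l t) < e"
    using t d unfolding eventually_at_right_field by (intro exI[of _ "min N (t + d)"]) auto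
qed

lemma upcrossings_le: "upcrossings a b x n \<le> n"
  by (induction n) auto

lemma grid_mono_seq: "mono (\<lambda>i. real i / 2 ^ m)" "0 \<le> real (0::nat) / 2 ^ m"
  by (auto intro!: monoI divide_right_mono)

section \<open>First zeros and limits at the first zero\<close>

lemma first_zero_nonneg: "0 \<le> first_zero X x"
  unfolding first_zero_def by (rule Inf_greatest) auto

lemma first_zero_le: "0 \<le> t \<Longrightarrow> X t x = 0 \<Longrightarrow> first_zero X x \<le> ereal t"
  unfolding first_zero_def by (rule Inf_lower) auto

lemma before_first_zero: "0 \<le> t \<Longrightarrow> ereal t < first_zero X x \<Longrightarrow> X t x \<noteq> 0"
  using first_zero_le[of t X x] by auto

lemma first_zero_attained:
  assumes rc: "\<And>t. 0 \<le> t \<Longrightarrow> ((\<lambda>s. X s x) \<longlongrightarrow> X t x) (at_right t)"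
    and t: "first_zero X x = ereal t"
  shows "X t x = 0"
proof (rule ccontr)
  assume nz: "X t x \<noteq> 0"
  have t0: "0 \<le> t" using first_zero_nonneg[of X x] t by simp
  have "\<forall>\<^sub>F s in at_right t. X s x \<noteq> 0" using tendsto_imp_eventually_ne[OF rc[OF t0] nz] .
  then obtain d where d: "t < d" "\<And>s. t < s \<Longrightarrow> s < d \<Longrightarrow> X s x \<noteq> 0"
    unfolding eventually_at_right_field by blast
  have "Inf {ereal t | t. 0 \<le> t \<and> X t x = 0} < ereal d" using t d(1) by (simp add: first_zero_def)
  then obtain s where s: "0 \<le> s" "X s x = 0" "s < d" by (auto simp: Inf_less_iff)
  moreover have "t \<le> s" using first_zero_le[OF s(1), of X x] s(2) t by simp
  ultimately show False using d(2)[of s] nz by (cases "s = t") auto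
qed

section \<open>The limit inferior from the left, tested at dyadic times\<close>

lemma Liminf_le_of_frequently:
  fixes f :: "'b \<Rightarrow> real"
  assumes "\<exists>\<^sub>F x in G. f x \<le> c"
  shows "Liminf G (\<lambda>x. ereal (f x)) \<le> ereal c"
proof (rule ccontr)
  assume "\<not> ?thesis"
  then have "\<forall>\<^sub>F x in G. ereal c < ereal (f x)" by (intro less_LiminfD) simp
  then have "\<forall>\<^sub>F x in G. \<not> f x \<le> c" by eventually_elim simp
  then show False using assms by (simp add: frequently_def)
qed

lemma frequently_dyadic_at_left:
  assumes "0 < (t::real)"
  shows "\<exists>\<^sub>F q in at t within {0..<t}. q \<in> dyadics"
  unfolding frequently_at
proof (intro allI impI)
  fix d :: real assume d: "0 < d"
  obtain q where "q \<in> dyadics" "max 0 (t - d) < q" "q < t"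
    using dyadic_dense[of "max 0 (t - d)" t] assms d by auto
  then show "\<exists>x\<in>{0..<t}. x \<noteq> t \<and> dist x t < d \<and> x \<in> dyadics"
    by (intro bexI[of _ q]) (auto simp: dist_real_def)
qed

text \<open>The alternatives involving n express closeness to t0 in one form for finite and infinite
  t0; at infinity only n \<le> q can hold. Dyadic times suffice because they accumulate at t0 from
  the left.\<close>

lemma left_liminf_le:
  fixes f :: "real \<Rightarrow> real"
  assumes t0: "0 < t0"
    and le: "\<And>q. q \<in> dyadics \<Longrightarrow> ereal q < t0 \<Longrightarrow> real n \<le> q \<or> t0 \<le> ereal (q + 1 / real (Suc n)) \<Longrightarrow> f q \<le> c"
  shows "left_liminf f t0 \<le> ereal c"
proof (cases t0)
  case (real t)
  then have t: "0 < t" using t0 by simp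
  have "\<forall>\<^sub>F q in at t within {0..<t}. t - 1 / real (Suc n) \<le> q \<and> q < t"
    unfolding eventually_at by (intro exI[of _ "1 / real (Suc n)"]) (auto simp: dist_real_def)
  then have "\<exists>\<^sub>F q in at t within {0..<t}. q \<in> dyadics \<and> t - 1 / real (Suc n) \<le> q \<and> q < t"
    by (rule frequently_eventually_frequently[OF frequently_dyadic_at_left[OF t]])
  then have "\<exists>\<^sub>F q in at t within {0..<t}. f q \<le> c"
    by (rule frequently_elim1) (use le real in \<open>auto simp: algebra_simps\<close>)
  then show ?thesis using real by (simp add: left_liminf_def Liminf_le_of_frequently)
next
  case PInf
  have "\<exists>\<^sub>F q in at_top. f q \<le> c"
    unfolding frequently_def eventually_at_top_linorder
  proof
    assume "\<exists>x. \<forall>q\<ge>x. \<not> f q \<le> c"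
    then obtain x where x: "\<And>q. x \<le> q \<Longrightarrow> \<not> f q \<le> c" by blast
    obtain N :: nat where N: "max x (real n) < real N" using reals_Archimedean2 by blast
    have "f (real N) \<le> c" using N PInf by (intro le nat_dyadic) auto
    then show False using x[of "real N"] N by simp
  qed
  then show ?thesis using PInf by (simp add: left_liminf_def Liminf_le_of_frequently)
qed (use t0 in simp)

text \<open>One number n controls both the lower bound and the distance from t0, so that the
  outcomes with positive limit inferior are exhausted by an increasing sequence of sets.\<close>

lemma left_liminf_pos_imp_bounded_below:
  fixes f :: "real \<Rightarrow> real"
  assumes "0 < left_liminf f t0" "0 \<le> t0"
  shows "\<exists>n. \<forall>q\<ge>0. ereal q < t0 \<longrightarrow> real n \<le> q \<or> t0 \<le> ereal (q + 1 / real (Suc n)) \<longrightarrow> 1 / real (Suc n) \<le> f q"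
proof (cases t0)
  case (real t)
  obtain c where c: "0 < c" "ereal c < left_liminf f t0"
    using ereal_dense2[OF assms(1)] by auto
  have "\<forall>\<^sub>F q in at t within {0..<t}. ereal c < ereal (f q)"
    using c(2) real by (intro less_LiminfD) (simp add: left_liminf_def)
  then obtain d where d: "0 < d" "\<And>q. 0 \<le> q \<Longrightarrow> q < t \<Longrightarrow> t - q < d \<Longrightarrow> c < f q"
    unfolding eventually_at by (auto simp: dist_real_def)
  obtain k where k: "1 / real (Suc k) < min c d" using nat_approx_posE[of "min c d"] c d by auto
  obtain l :: nat where l: "t < real l" using reals_Archimedean2 by blast
  \<comment> \<open>Since n is at least l > t, the alternative n \<le> q is impossible for q < t,
    and only the condition on the distance remains.\<close>
  define n where "n = max k l"
  have n: "1 / real (Suc n) \<le> 1 / real (Suc k)" by (intro divide_left_mono) (auto simp: n_def)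
  show ?thesis
  proof (intro exI[of _ n] allI impI)
    fix q assume q: "0 \<le> q" "ereal q < t0" "real n \<le> q \<or> t0 \<le> ereal (q + 1 / real (Suc n))"
    have "real l \<le> real n" by (simp add: n_def)
    then have "t \<le> q + 1 / real (Suc n)" using q real l by auto
    then have "c < f q" using q real n k by (intro d(2)) auto
    then show "1 / real (Suc n) \<le> f q" using n k by simp
  qed
next
  case PInf
  obtain c where c: "0 < c" "ereal c < left_liminf f t0"
    using ereal_dense2[OF assms(1)] by auto
  have "\<forall>\<^sub>F q in at_top. ereal c < ereal (f q)"
    using c(2) PInf by (intro less_LiminfD) (simp add: left_liminf_def)
  then obtain d where d: "\<And>q. d \<le> q \<Longrightarrow> c < f q" unfolding eventually_at_top_linorder by auto
  obtain k where k: "1 / real (Suc k) < c" using nat_approx_posE[OF c(1)] by auto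
  obtain l :: nat where l: "d < real l" using reals_Archimedean2 by blast
  define n where "n = max k l"
  have n: "1 / real (Suc n) \<le> 1 / real (Suc k)" by (intro divide_left_mono) (auto simp: n_def)
  show ?thesis
  proof (intro exI[of _ n] allI impI)
    fix q assume q: "0 \<le> q" "ereal q < t0" "real n \<le> q \<or> t0 \<le> ereal (q + 1 / real (Suc n))"
    have "real l \<le> real n" by (simp add: n_def)
    then have "c < f q" using q PInf l by (intro d) auto
    then show "1 / real (Suc n) \<le> f q" using n k by simp
  qed
qed (use assms in simp)

text \<open>Serves to remove the mixing weight a. For finite J, the case a = 1/2 first shows that I
  is finite; then a tends to 0 within the reals.\<close>

lemma ennreal_le_of_perturbed:
  fixes I J :: ennreal
  assumes "\<And>a::real. 0 < a \<Longrightarrow> a < 1 \<Longrightarrow> ennreal (1 - a) * I \<le> J + ennreal a"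
  shows "I \<le> J"
proof (cases J)
  case (real j)
  have "I \<noteq> \<top>"
  proof
    assume "I = \<top>"
    then have "\<top> \<le> J + ennreal (1/2)" using assms[of "1/2"] by (simp add: ennreal_mult_top)
    then show False using real by (simp add: top_unique flip: ennreal_plus)
  qed
  then obtain i where i: "I = ennreal i" "0 \<le> i" by (cases I) auto
  have le: "(1 - a) * i \<le> j + a" if "0 < a" "a < 1" for a
  proof -
    have "ennreal ((1 - a) * i) \<le> ennreal (j + a)"
      using assms[OF that] that i real by (simp add: ennreal_mult ennreal_plus)
    then show ?thesis by (subst (asm) ennreal_le_iff) (use that real in auto)
  qed
  have "(\<lambda>n. (1 - 1 / real (n + 2)) * i) \<longlonglongrightarrow> (1 - 0) * i"
    by (intro tendsto_intros) real_asymp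
  moreover have "(\<lambda>n. j + 1 / real (n + 2)) \<longlonglongrightarrow> j" by real_asymp
  ultimately have "(1 - 0) * i \<le> j"
    by (rule LIMSEQ_le) (use le in \<open>auto intro!: exI[of _ 0]\<close>)
  then show ?thesis using i real by (simp add: ennreal_leI)
qed simp

section \<open>Supermartingales and optional stopping\<close>

locale usual_filtration = prob_space M for M :: "'a measure" +
  fixes F :: "real \<Rightarrow> 'a measure"
  assumes usual: "usual_filtered_prob_space M F"
begin

lemma subalg: "subalgebra M (F t)"
  using usual by (simp add: usual_filtered_prob_space_def)

lemma space_F [simp]: "space (F t) = space M"
  using subalg[of t] by (simp add: subalgebra_def)

lemma space_M_in_F [simp]: "space M \<in> sets (F t)"
  using sets.top[of "F t"] by simp

lemma sets_F_M: "A \<in> sets (F t) \<Longrightarrow> A \<in> sets M"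
  using subalg[of t] by (auto simp: subalgebra_def)

lemma measurable_F_M: "f \<in> measurable (F t) N \<Longrightarrow> f \<in> measurable M N"
  using measurable_from_subalg[OF subalg] .

lemma sets_F_mono: "0 \<le> s \<Longrightarrow> s \<le> t \<Longrightarrow> A \<in> sets (F s) \<Longrightarrow> A \<in> sets (F t)"
  using usual unfolding usual_filtered_prob_space_def by (metis subsetD)

lemma measurable_F_mono:
  assumes "0 \<le> s" "s \<le> t" "f \<in> measurable (F s) N"
  shows "f \<in> measurable (F t) N"
proof (rule measurable_from_subalg[OF _ assms(3)])
  show "subalgebra (F t) (F s)"
    unfolding subalgebra_def
  proof (intro conjI subsetI)
    show "A \<in> sets (F t)" if "A \<in> sets (F s)" for A using assms(1,2) that by (rule sets_F_mono)
  qed simp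
qed

lemma sets_F_right:
  assumes "0 \<le> t" "\<And>s. t < s \<Longrightarrow> A \<in> sets (F s)"
  shows "A \<in> sets (F t)"
proof -
  have "sets (F t) = (\<Inter>s\<in>{t<..}. sets (F s))"
    using usual assms(1) unfolding usual_filtered_prob_space_def by blast
  then show ?thesis using assms(2) by auto
qed

lemma null_sets_F:
  assumes "N \<in> null_sets M" "A \<subseteq> N" "0 \<le> t"
  shows "A \<in> sets (F t)"
proof -
  have "A \<in> sets (F 0)" using usual assms unfolding usual_filtered_prob_space_def by blast
  then show ?thesis using sets_F_mono[of 0 t] assms by auto
qed

text \<open>By the usual conditions every subset of a null set belongs to \<open>F t\<close>, so
  events, and hence processes, may be changed on null sets without losing adaptedness.\<close>

lemma AE_sets_F:
  assumes A: "A \<in> sets (F t)" and t: "0 \<le> t" and B: "B \<subseteq> space M" and AE: "AE x in M. x \<in> A \<longleftrightarrow> x \<in> B"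
  shows "B \<in> sets (F t)"
proof -
  obtain N where N: "N \<in> null_sets M" "{x\<in>space M. \<not> (x \<in> A \<longleftrightarrow> x \<in> B)} \<subseteq> N"
    using AE by (auto simp: eventually_ae_filter)
  have As: "A \<subseteq> space M" using sets.sets_into_space[OF A] by simp
  have "B = (A - (N \<inter> A)) \<union> (N \<inter> B)" using N(2) As B by blast
  moreover have "N \<inter> A \<in> sets (F t)" "N \<inter> B \<in> sets (F t)"
    using null_sets_F[OF N(1) _ t] by auto
  ultimately show ?thesis using A by (metis sets.Diff sets.Un)
qed

lemma AE_measurable_F:
  assumes f: "f \<in> borel_measurable (F t)" and t: "0 \<le> t" and AE: "AE x in M. f x = g x"
  shows "g \<in> borel_measurable (F t)"
proof (rule measurableI)
  fix B :: "'b set" assume B: "B \<in> sets borel"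
  show "g -` B \<inter> space (F t) \<in> sets (F t)"
  proof (rule AE_sets_F[OF measurable_sets[OF f B] t])
    show "AE x in M. (x \<in> f -` B \<inter> space (F t)) = (x \<in> g -` B \<inter> space (F t))"
      using AE by eventually_elim auto
  qed auto
qed simp

text \<open>Testing with the event that the conditional expectation exceeds \<open>Z s\<close> shows
  that this event is null.\<close>

lemma supermartingaleI:
  assumes ad: "adapted F Z" and int: "\<And>t. 0 \<le> t \<Longrightarrow> integrable M (Z t)"
    and le: "\<And>s t A. 0 \<le> s \<Longrightarrow> s \<le> t \<Longrightarrow> A \<in> sets (F s) \<Longrightarrow>
      (\<integral>x. indicator A x * Z t x \<partial>M) \<le> (\<integral>x. indicator A x * Z s x \<partial>M)"
  shows "supermartingale M F Z"
  unfolding supermartingale_def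
proof (intro conjI allI impI ad int)
  fix s t :: real assume st: "0 \<le> s" "s \<le> t"
  then have t: "0 \<le> t" by simp
  interpret G: finite_measure_subalgebra M "F s" by unfold_locales (rule subalg)
  define D where "D x = real_cond_exp M (F s) (Z t) x - Z s x" for x
  have Zs: "Z s \<in> borel_measurable (F s)" using ad st by (simp add: adapted_def)
  have Dm: "D \<in> borel_measurable (F s)" unfolding D_def using Zs by measurable
  have Di: "integrable M D" unfolding D_def using int[OF st(1)] G.real_cond_exp_int(1)[OF int[OF t]] by simp
  define A where "A = {x\<in>space (F s). 0 < D x}"
  have A: "A \<in> sets (F s)" unfolding A_def using Dm by measurable
  let ?I = "\<lambda>f. \<integral>x. indicator A x * f x \<partial>M"
  have ii: "integrable M (\<lambda>x. indicator A x * Z s x)" "integrable M (\<lambda>x. indicator A x * real_cond_exp M (F s) (Z t) x)"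
    using integrable_mult_indicator[OF sets_F_M[OF A] int[OF st(1)]]
      integrable_mult_indicator[OF sets_F_M[OF A] G.real_cond_exp_int(1)[OF int[OF t]]] by simp_all
  have "?I D = ?I (real_cond_exp M (F s) (Z t)) - ?I (Z s)"
    using ii by (simp add: D_def right_diff_distrib)
  also have "?I (real_cond_exp M (F s) (Z t)) = ?I (Z t)"
    using G.real_cond_exp_intA[OF int[OF t] A] by (simp add: set_lebesgue_integral_def)
  finally have "?I D \<le> 0" using le[OF st A] by simp
  moreover have nn: "AE x in M. 0 \<le> indicator A x * D x" by (auto simp: A_def indicator_def)
  moreover have iD: "integrable M (\<lambda>x. indicator A x * D x)"
    using integrable_mult_indicator[OF sets_F_M[OF A] Di] by simp
  ultimately have "AE x in M. indicator A x * D x = 0"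
    using integral_nonneg_eq_0_iff_AE[OF iD nn] integral_nonneg_AE[OF nn] by simp
  then show "AE x in M. real_cond_exp M (F s) (Z t) x \<le> Z s x"
    using AE_space by eventually_elim (auto simp: A_def D_def indicator_def split: if_splits)
qed

lemma supermartingale_integral_le:
  assumes Z: "supermartingale M F Z" and st: "0 \<le> s" "s \<le> t" and A: "A \<in> sets (F s)"
  shows "(\<integral>x. indicator A x * Z t x \<partial>M) \<le> (\<integral>x. indicator A x * Z s x \<partial>M)"
proof -
  let ?I = "\<lambda>f. \<integral>x. indicator A x * f x \<partial>M"
  interpret G: finite_measure_subalgebra M "F s" by unfold_locales (rule subalg)
  have int: "integrable M (Z s)" "integrable M (Z t)" using Z st by (auto simp: supermartingale_def)
  have "?I (Z t) = ?I (real_cond_exp M (F s) (Z t))"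
    using G.real_cond_exp_intA[OF int(2) A] by (simp add: set_lebesgue_integral_def)
  also have "\<dots> \<le> ?I (Z s)"
  proof (rule integral_mono_AE)
    show "AE x in M. indicator A x * real_cond_exp M (F s) (Z t) x \<le> indicator A x * Z s x"
    proof -
      have "AE x in M. real_cond_exp M (F s) (Z t) x \<le> Z s x" using Z st unfolding supermartingale_def by blast
      then show ?thesis by eventually_elim (simp add: indicator_def)
    qed
  qed (use integrable_mult_indicator[OF sets_F_M[OF A] int(1)]
        integrable_mult_indicator[OF sets_F_M[OF A] G.real_cond_exp_int(1)[OF int(2)]] in simp_all)
  finally show ?thesis .
qed

text \<open>The sum is the gain from holding one share over step i on \<open>A i\<close>, an event
  known at the start of the step. The upcrossing inequality and optional stopping are both
  instances.\<close>

lemma supermartingale_transform: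
  fixes t :: "nat \<Rightarrow> real"
  assumes Z: "supermartingale M F Z" and t: "mono t" "0 \<le> t 0"
    and A: "\<And>i. i < n \<Longrightarrow> A i \<in> sets (F (t i))"
  shows "integrable M (\<lambda>x. \<Sum>i<n. indicator (A i) x * (Z (t (Suc i)) x - Z (t i) x))"
    and "(\<integral>x. (\<Sum>i<n. indicator (A i) x * (Z (t (Suc i)) x - Z (t i) x)) \<partial>M) \<le> 0"
proof -
  let ?G = "\<lambda>x. \<Sum>i<n. indicator (A i) x * (Z (t (Suc i)) x - Z (t i) x)"
  have t0: "0 \<le> t i" for i using t monoD[OF t(1), of 0 i] by simp
  have int: "integrable M (Z (t i))" for i using Z t0 by (simp add: supermartingale_def)
  have ii: "integrable M (\<lambda>x. indicator (A i) x * Z (t j) x)" if "i < n" for i j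
    using integrable_mult_indicator[OF sets_F_M[OF A[OF that]] int] by simp
  have i: "integrable M (\<lambda>x. indicator (A i) x * (Z (t (Suc i)) x - Z (t i) x))" if "i < n" for i
    using ii[OF that] by (simp add: right_diff_distrib)
  show "integrable M ?G"
    using i by (intro Bochner_Integration.integrable_sum) simp
  have "(\<integral>x. ?G x \<partial>M)
      = (\<Sum>i<n. \<integral>x. indicator (A i) x * (Z (t (Suc i)) x - Z (t i) x) \<partial>M)"
    using i by (intro Bochner_Integration.integral_sum) auto
  also have "\<dots> \<le> 0"
  proof (rule sum_nonpos)
    fix i assume "i \<in> {..<n}"
    then have "i < n" by simp
    then show "(\<integral>x. indicator (A i) x * (Z (t (Suc i)) x - Z (t i) x) \<partial>M) \<le> 0"
      using supermartingale_integral_le[OF Z t0 monoD[OF t(1), of i "Suc i"] A] ii by (simp add: right_diff_distrib)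
  qed
  finally show "(\<integral>x. ?G x \<partial>M) \<le> 0" .
qed

text \<open>The stopped value is the initial value plus the gain from staying invested until the
  first \<open>P k\<close>. The disjunct k = n enforces stopping at n at the latest and guarantees
  that the minimum exists.\<close>

lemma optional_stopping:
  fixes t :: "nat \<Rightarrow> real"
  assumes Z: "supermartingale M F Z" and t: "mono t" "0 \<le> t 0"
    and P: "\<And>i. i < n \<Longrightarrow> {x\<in>space M. P i x} \<in> sets (F (t i))"
  shows "integrable M (\<lambda>x. Z (t (LEAST k. P k x \<or> k = n)) x)"
    and "(\<integral>x. Z (t (LEAST k. P k x \<or> k = n)) x \<partial>M) \<le> (\<integral>x. Z (t 0) x \<partial>M)"
proof -
  define \<rho> where "\<rho> x = (LEAST k. P k x \<or> k = n)" for x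
  define A where "A i = {x\<in>space M. \<forall>k\<le>i. \<not> P k x}" for i
  have t0: "0 \<le> t i" for i using t monoD[OF t(1), of 0 i] by simp
  let ?G = "\<lambda>x. \<Sum>i<n. indicator (A i) x * (Z (t (Suc i)) x - Z (t i) x)"
  have Am: "A i \<in> sets (F (t i))" if "i < n" for i
  proof -
    have "{x\<in>space M. P k x} \<in> sets (F (t i))" if "k \<le> i" for k
      using sets_F_mono[OF t0 monoD[OF t(1) that] P] that \<open>i < n\<close> by auto
    then have "space (F (t i)) - (\<Union>k\<in>{..i}. {x\<in>space M. P k x}) \<in> sets (F (t i))"
      by (intro sets.compl_sets sets.finite_UN) auto
    also have "space (F (t i)) - (\<Union>k\<in>{..i}. {x\<in>space M. P k x}) = A i" by (auto simp: A_def)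
    finally show ?thesis .
  qed
  have int: "integrable M (Z (t 0))" using Z t by (simp add: supermartingale_def)
  have eq: "Z (t (\<rho> x)) x = Z (t 0) x + ?G x"
    if "x \<in> space M" for x
  proof -
    have \<rho>: "P (\<rho> x) x \<or> \<rho> x = n" unfolding \<rho>_def by (rule LeastI[of _ n]) simp
    have \<rho>n: "\<rho> x \<le> n" unfolding \<rho>_def by (rule Least_le) simp
    have less: "\<not> P k x" if "k < \<rho> x" for k using not_less_Least[OF that[unfolded \<rho>_def]] by simp
    have ind: "indicator (A i) x = (if i < \<rho> x then 1 else 0 :: real)" if "i < n" for i
      using \<open>x \<in> space M\<close> less \<rho> \<rho>n that by (auto simp: A_def indicator_def not_less)
    have "?G x
        = (\<Sum>i<n. if i < \<rho> x then Z (t (Suc i)) x - Z (t i) x else 0)"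
      by (intro sum.cong) (auto simp: ind)
    also have "\<dots> = (\<Sum>i<\<rho> x. Z (t (Suc i)) x - Z (t i) x)"
      using \<rho>n by (intro sum.mono_neutral_cong_right) auto
    also have "\<dots> = Z (t (\<rho> x)) x - Z (t 0) x"
      by (rule sum_lessThan_telescope[of "\<lambda>i. Z (t i) x"])
    finally show ?thesis by simp
  qed
  note tr = supermartingale_transform[OF Z t Am]
  have i2: "integrable M (\<lambda>x. Z (t 0) x + ?G x)"
    using tr(1) int by simp
  then have "integrable M (\<lambda>x. Z (t (\<rho> x)) x)"
    by (subst Bochner_Integration.integrable_cong[OF refl eq]) auto
  then show "integrable M (\<lambda>x. Z (t (LEAST k. P k x \<or> k = n)) x)" unfolding \<rho>_def .
  have "(\<integral>x. Z (t (\<rho> x)) x \<partial>M)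
      = (\<integral>x. Z (t 0) x + ?G x \<partial>M)"
    by (rule Bochner_Integration.integral_cong[OF refl eq])
  also have "\<dots> = (\<integral>x. Z (t 0) x \<partial>M) + (\<integral>x. ?G x \<partial>M)"
    using int tr(1) by (rule Bochner_Integration.integral_add)
  also have "\<dots> \<le> (\<integral>x. Z (t 0) x \<partial>M)" using tr(2) by simp
  finally show "(\<integral>x. Z (t (LEAST k. P k x \<or> k = n)) x \<partial>M) \<le> (\<integral>x. Z (t 0) x \<partial>M)" unfolding \<rho>_def .
qed

lemma nn_integral_indicator_eq_integral:
  assumes "integrable M f" "\<And>x. x \<in> space M \<Longrightarrow> 0 \<le> f x" "A \<in> sets M"
  shows "(\<integral>\<^sup>+x. ennreal (f x) * indicator A x \<partial>M) = ennreal (\<integral>x. indicator A x * f x \<partial>M)"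
proof -
  have "integrable M (\<lambda>x. indicator A x * f x)" using integrable_mult_indicator[OF assms(3,1)] by simp
  then have "(\<integral>\<^sup>+x. ennreal (indicator A x * f x) \<partial>M) = ennreal (\<integral>x. indicator A x * f x \<partial>M)"
    using assms(2) by (intro nn_integral_eq_integral) (auto simp: indicator_def)
  moreover have "(\<integral>\<^sup>+x. ennreal (indicator A x * f x) \<partial>M) = (\<integral>\<^sup>+x. ennreal (f x) * indicator A x \<partial>M)"
    by (intro nn_integral_cong) (auto simp: indicator_def)
  ultimately show ?thesis by simp
qed

lemma supermartingale_nn_integral_le:
  assumes Z: "supermartingale M F Z" and nn: "\<And>t x. 0 \<le> t \<Longrightarrow> x \<in> space M \<Longrightarrow> 0 \<le> Z t x"
    and st: "0 \<le> s" "s \<le> t" and A: "A \<in> sets (F s)"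
  shows "(\<integral>\<^sup>+x. ennreal (Z t x) * indicator A x \<partial>M) \<le> (\<integral>\<^sup>+x. ennreal (Z s x) * indicator A x \<partial>M)"
proof -
  have "integrable M (Z u)" if "0 \<le> u" for u using Z that by (simp add: supermartingale_def)
  then show ?thesis
    using st supermartingale_integral_le[OF Z st A] nn
    by (simp add: nn_integral_indicator_eq_integral sets_F_M[OF A] ennreal_leI)
qed

lemma supermartingaleI_nn_integral:
  assumes ad: "adapted F Z" and nn: "\<And>t x. 0 \<le> t \<Longrightarrow> x \<in> space M \<Longrightarrow> 0 \<le> Z t x"
    and fin: "(\<integral>\<^sup>+x. ennreal (Z 0 x) \<partial>M) < \<infinity>"
    and le: "\<And>s t A. 0 \<le> s \<Longrightarrow> s \<le> t \<Longrightarrow> A \<in> sets (F s) \<Longrightarrow>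
      (\<integral>\<^sup>+x. ennreal (Z t x) * indicator A x \<partial>M) \<le> (\<integral>\<^sup>+x. ennreal (Z s x) * indicator A x \<partial>M)"
  shows "supermartingale M F Z"
proof (rule supermartingaleI[OF ad])
  have Zm: "Z t \<in> borel_measurable M" if "0 \<le> t" for t
    using ad that measurable_F_M by (auto simp: adapted_def)
  show int: "integrable M (Z t)" if t: "0 \<le> t" for t
  proof (rule integrableI_nonneg[OF Zm[OF t]])
    show "AE x in M. 0 \<le> Z t x" using nn[OF t] by (rule AE_I2)
    have "(\<integral>\<^sup>+x. ennreal (Z t x) \<partial>M) = (\<integral>\<^sup>+x. ennreal (Z t x) * indicator (space (F 0)) x \<partial>M)"
      by (intro nn_integral_cong) simp
    also have "\<dots> \<le> (\<integral>\<^sup>+x. ennreal (Z 0 x) * indicator (space (F 0)) x \<partial>M)" by (rule le) (use t in auto)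
    also have "\<dots> = (\<integral>\<^sup>+x. ennreal (Z 0 x) \<partial>M)" by (intro nn_integral_cong) simp
    finally show "(\<integral>\<^sup>+x. ennreal (Z t x) \<partial>M) < \<infinity>" using fin by simp
  qed
  fix s t :: real and A assume st: "0 \<le> s" "s \<le> t" and A: "A \<in> sets (F s)"
  have "0 \<le> (\<integral>x. indicator A x * Z s x \<partial>M)"
    using nn[OF st(1)] by (intro integral_nonneg_AE AE_I2) (auto simp: indicator_def)
  moreover have "ennreal (\<integral>x. indicator A x * Z t x \<partial>M) \<le> ennreal (\<integral>x. indicator A x * Z s x \<partial>M)"
    using le[OF st A] st by (simp add: nn_integral_indicator_eq_integral int nn sets_F_M[OF A])
  ultimately show "(\<integral>x. indicator A x * Z t x \<partial>M) \<le> (\<integral>x. indicator A x * Z s x \<partial>M)" by simp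
qed

section \<open>Upcrossings, maximal inequality and right limits\<close>

lemma supermartingale_measurable:
  assumes "supermartingale M F Z" "0 \<le> t"
  shows "Z t \<in> borel_measurable (F t)" "Z t \<in> borel_measurable M"
  using assms measurable_F_M by (auto simp: supermartingale_def adapted_def)

lemma holding_measurable:
  assumes Z: "supermartingale M F Z"
  shows "{x\<in>space M. holding a b (\<lambda>i. Z (real i / 2 ^ m) x) i} \<in> sets (F (real i / 2 ^ m))"
proof (induction i)
  have Zm[measurable]: "Z (real i / 2 ^ m) \<in> borel_measurable (F (real i / 2 ^ m))" for i
    using supermartingale_measurable(1)[OF Z, of "real i / 2 ^ m"] by simp
  { case 0
    have "{x\<in>space (F (real 0 / 2 ^ m)). Z (real 0 / 2 ^ m) x < a} \<in> sets (F (real 0 / 2 ^ m))"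
      using Zm[of 0] by measurable
    then show ?case by simp
  next
    case (Suc i)
    let ?G = "F (real (Suc i) / 2 ^ m)" and ?z = "Z (real (Suc i) / 2 ^ m)"
    let ?H = "{x\<in>space M. holding a b (\<lambda>i. Z (real i / 2 ^ m) x) i}"
    have H: "?H \<in> sets ?G" by (rule sets_F_mono[OF _ _ Suc]) (auto intro: divide_right_mono)
    have 1: "{x\<in>space ?G. ?z x \<le> b} \<in> sets ?G" "{x\<in>space ?G. ?z x < a} \<in> sets ?G"
      using Zm[of "Suc i"] by measurable
    have "(?H \<inter> {x\<in>space ?G. ?z x \<le> b}) \<union> ({x\<in>space ?G. ?z x < a} - ?H) \<in> sets ?G"
      using H 1 by (intro sets.Un sets.Int sets.Diff)
    also have "(?H \<inter> {x\<in>space ?G. ?z x \<le> b}) \<union> ({x\<in>space ?G. ?z x < a} - ?H)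
        = {x\<in>space M. holding a b (\<lambda>i. Z (real i / 2 ^ m) x) (Suc i)}" by auto
    finally show ?case . }
qed

lemma upcrossings_measurable:
  assumes Z: "supermartingale M F Z"
  shows "(\<lambda>x. real (upcrossings a b (\<lambda>i. Z (real i / 2 ^ m) x) n)) \<in> borel_measurable M"
proof (induction n)
  case (Suc n)
  have [measurable]: "Z (real (Suc n) / 2 ^ m) \<in> borel_measurable M"
    using supermartingale_measurable(2)[OF Z, of "real (Suc n) / 2 ^ m"] by simp
  have [measurable]: "{x\<in>space M. holding a b (\<lambda>i. Z (real i / 2 ^ m) x) n} \<in> sets M"
    using holding_measurable[OF Z] by (rule sets_F_M)
  note Suc[measurable]
  have "(\<lambda>x. real (upcrossings a b (\<lambda>i. Z (real i / 2 ^ m) x) n) +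
      (if holding a b (\<lambda>i. Z (real i / 2 ^ m) x) n \<and> b < Z (real (Suc n) / 2 ^ m) x then 1 else 0)) \<in> borel_measurable M"
    by measurable
  then show ?case by (rule measurable_cong[THEN iffD1, rotated]) auto
qed simp

text \<open>Doob's argument: the strategy \<open>holding\<close> has nonpositive expected gain, and
  as Z is nonnegative a position left open loses at most \<open>max a 0\<close>. The bound depends
  neither on the mesh nor on the horizon.\<close>

lemma upcrossing_inequality:
  assumes Z: "supermartingale M F Z" and nn: "\<And>t x. 0 \<le> t \<Longrightarrow> x \<in> space M \<Longrightarrow> 0 \<le> Z t x"
    and ab: "a < b"
  shows "(b - a) * (\<integral>x. real (upcrossings a b (\<lambda>i. Z (real i / 2 ^ m) x) n) \<partial>M) \<le> max a 0"
proof -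
  let ?t = "\<lambda>i::nat. real i / 2 ^ m"
  let ?U = "\<lambda>x. upcrossings a b (\<lambda>i. Z (?t i) x) n"
  define H where "H i = {x\<in>space M. holding a b (\<lambda>i. Z (?t i) x) i}" for i
  have Hm: "H i \<in> sets (F (?t i))" for i unfolding H_def by (rule holding_measurable[OF Z])
  note tr = supermartingale_transform[OF Z grid_mono_seq[of m], of n H, OF Hm]
  have Ui: "integrable M (\<lambda>x. real (?U x))"
    by (rule integrable_const_bound[where B="real n"]) (auto simp: upcrossings_le intro: upcrossings_measurable[OF Z])
  have "(b - a) * (\<integral>x. real (?U x) \<partial>M) - max a 0 = (\<integral>x. (b - a) * real (?U x) - max a 0 \<partial>M)"
    using Ui by (simp add: prob_space)
  also have "\<dots> \<le> (\<integral>x. (\<Sum>i<n. indicator (H i) x * (Z (?t (Suc i)) x - Z (?t i) x)) \<partial>M)"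
  proof (rule integral_mono)
    show "integrable M (\<lambda>x. (b - a) * real (?U x) - max a 0)" using Ui by simp
    show "integrable M (\<lambda>x. \<Sum>i<n. indicator (H i) x * (Z (?t (Suc i)) x - Z (?t i) x))" by (rule tr(1))
    fix x assume w: "x \<in> space M"
    let ?x = "\<lambda>i. Z (?t i) x"
    have "(b - a) * real (?U x) - max a 0 \<le> (b - a) * real (?U x) + (if holding a b ?x n then ?x n - a else 0)"
      using nn[of "?t n" x] w by (auto simp: max_def)
    also have "\<dots> \<le> (\<Sum>i<n. (if holding a b ?x i then 1 else 0) * (?x (Suc i) - ?x i))"
      by (rule upcrossings_gain[OF ab])
    also have "\<dots> = (\<Sum>i<n. indicator (H i) x * (Z (?t (Suc i)) x - Z (?t i) x))"
      using w by (intro sum.cong) (auto simp: H_def indicator_def)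
    finally show "(b - a) * real (?U x) - max a 0 \<le> (\<Sum>i<n. indicator (H i) x * (Z (?t (Suc i)) x - Z (?t i) x))" .
  qed
  also have "\<dots> \<le> 0" by (rule tr(2))
  finally show ?thesis by simp
qed

lemma chain_measurable:
  assumes Z: "supermartingale M F Z" and D: "countable D" "\<And>q. q \<in> D \<Longrightarrow> 0 \<le> q"
  shows "{x\<in>space M. chain D (\<lambda>t. Z t x) a b j e} \<in> sets M"
proof (induction j arbitrary: e)
  case (Suc j)
  have 1: "{x\<in>space M. Z p x < a} \<in> sets M" "{x\<in>space M. b < Z p x} \<in> sets M" if "p \<in> D" for p
    using supermartingale_measurable(2)[OF Z D(2)[OF that]] by measurable
  have "(\<Union>p\<in>D. \<Union>q\<in>{q\<in>D. p < q \<and> q \<le> e}. {x\<in>space M. Z p x < a} \<inter> {x\<in>space M. b < Z q x}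
      \<inter> {x\<in>space M. chain D (\<lambda>t. Z t x) a b j p}) \<in> sets M"
  proof (intro sets.countable_UN''[OF D(1)] sets.countable_UN'')
    fix p show "countable {q\<in>D. p < q \<and> q \<le> e}" by (rule countable_subset[OF _ D(1)]) auto
  qed (use 1 Suc in auto)
  also have "(\<Union>p\<in>D. \<Union>q\<in>{q\<in>D. p < q \<and> q \<le> e}. {x\<in>space M. Z p x < a} \<inter> {x\<in>space M. b < Z q x}
      \<inter> {x\<in>space M. chain D (\<lambda>t. Z t x) a b j p}) = {x\<in>space M. chain D (\<lambda>t. Z t x) a b (Suc j) e}"
    by auto
  finally show ?case .
qed simp

text \<open>On every grid a chain of length j forces j upcrossings, so by Markov's inequality its
  probability is of order 1/j, uniformly in the mesh. The grids increase to the dyadics, and the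
  bound passes to the union.\<close>

lemma supermartingale_finitely_many_oscillations:
  assumes Z: "supermartingale M F Z" and nn: "\<And>t x. 0 \<le> t \<Longrightarrow> x \<in> space M \<Longrightarrow> 0 \<le> Z t x"
    and ab: "a < b"
  shows "AE x in M. \<exists>j. \<not> chain dyadics (\<lambda>t. Z t x) a b j (real N)"
proof -
  define B where "B D j = {x\<in>space M. chain D (\<lambda>t. Z t x) a b j (real N)}" for D j
  have Bm: "B dyadics j \<in> sets M" "B (grid m) j \<in> sets M" for j m
    unfolding B_def by (auto intro!: chain_measurable[OF Z] simp: countable_dyadics dyadics_nonneg grid_def)
  have grid_le: "prob (B (grid m) j) \<le> max a 0 / (b - a) / real j" if "0 < j" for m j
  proof -
    let ?n = "N * 2 ^ m"
    let ?U = "\<lambda>x. upcrossings a b (\<lambda>i. Z (real i / 2 ^ m) x) ?n"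
    have Ui: "integrable M (\<lambda>x. real (?U x))"
      by (rule integrable_const_bound[where B="real ?n"])
        (auto intro: upcrossings_measurable[OF Z] simp: upcrossings_le simp del: of_nat_mult of_nat_power)
    have "real j * prob (B (grid m) j) = (\<integral>x. real j * indicator (B (grid m) j) x \<partial>M)"
      using Bm by (simp only: scaled_indicator(2))
    also have "\<dots> \<le> (\<integral>x. real (?U x) \<partial>M)"
    proof (rule integral_mono)
      fix x assume w: "x \<in> space M"
      have "j \<le> ?U x" if "x \<in> B (grid m) j"
        using that by (intro chain_le_upcrossings[OF ab, of m "\<lambda>t. Z t x"]) (simp add: B_def)
      then show "real j * indicator (B (grid m) j) x \<le> real (?U x)" by (auto simp: indicator_def)
    qed (rule scaled_indicator(1)[OF Bm(2)], rule Ui)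
    finally have "(b - a) * (real j * prob (B (grid m) j)) \<le> (b - a) * (\<integral>x. real (?U x) \<partial>M)"
      using ab by (intro mult_left_mono) auto
    also have "\<dots> \<le> max a 0" by (rule upcrossing_inequality[OF Z nn ab])
    finally have "(b - a) * (real j * prob (B (grid m) j)) \<le> max a 0" .
    then show ?thesis using ab that by (simp add: pos_le_divide_eq mult_ac)
  qed
  have "prob (B dyadics j) \<le> max a 0 / (b - a) / real j" if j: "0 < j" for j
  proof -
    have "incseq (\<lambda>m. B (grid m) j)"
      by (auto simp: incseq_def B_def intro: chain_mono[OF grid_mono])
    then have "(\<lambda>m. prob (B (grid m) j)) \<longlonglongrightarrow> prob (\<Union>m. B (grid m) j)"
      using Bm by (intro finite_Lim_measure_incseq) auto
    moreover have "(\<Union>m. B (grid m) j) = B dyadics j"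
    proof
      have "grid m \<subseteq> dyadics" for m by (auto simp: dyadics_def)
      then show "(\<Union>m. B (grid m) j) \<subseteq> B dyadics j"
        by (intro UN_least subsetI) (auto simp: B_def intro: chain_mono)
      show "B dyadics j \<subseteq> (\<Union>m. B (grid m) j)" by (auto simp: B_def dest: chain_grid)
    qed
    ultimately have "(\<lambda>m. prob (B (grid m) j)) \<longlonglongrightarrow> prob (B dyadics j)" by simp
    then show ?thesis by (rule LIMSEQ_le_const2) (use grid_le[OF j] in blast)
  qed
  then have "AE x in M. \<exists>j>0. x \<notin> B dyadics j" using Bm by (intro AE_from_probability_bounds)
  then show ?thesis using AE_space by eventually_elim (auto simp: B_def)
qed

text \<open>The sign of S after \<open>T\<close> is unknown. On a grid, one stops at the first time
  that is before \<open>T\<close> with S \<ge> \<kappa>, or not before \<open>T\<close> with S \<ge>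
  -1. As S is 0 at \<open>T\<close> with right limit 0, fine grids contain a time of the second kind
  right after \<open>T\<close>, unless the horizon comes first. The stopped value is then at least
  \<kappa> on the event in question and at least -1 elsewhere, which explains the summand 1 in the
  bound.\<close>

lemma supermartingale_maximal_inequality_before:
  fixes T :: "'a \<Rightarrow> ereal"
  assumes S: "supermartingale M F S"
    and T: "\<And>u. 0 \<le> u \<Longrightarrow> {x\<in>space M. ereal u < T x} \<in> sets (F u)"
    and T0: "\<And>x. x \<in> space M \<Longrightarrow> 0 \<le> T x"
    and nn: "\<And>t x. x \<in> space M \<Longrightarrow> 0 \<le> t \<Longrightarrow> ereal t < T x \<Longrightarrow> 0 \<le> S t x"
    and zero: "AE x in M. \<forall>t. T x = ereal t \<longrightarrow> S t x = 0 \<and> ((\<lambda>s. S s x) \<longlongrightarrow> 0) (at_right t)"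
    and \<kappa>: "0 < \<kappa>"
  shows "{x\<in>space M. \<exists>q\<in>dyadics. ereal q < T x \<and> \<kappa> \<le> S q x} \<in> sets M"
    and "prob {x\<in>space M. \<exists>q\<in>dyadics. ereal q < T x \<and> \<kappa> \<le> S q x} \<le> ((\<integral>x. S 0 x \<partial>M) + 1) / \<kappa>"
proof -
  let ?E = "{x\<in>space M. \<exists>q\<in>dyadics. ereal q < T x \<and> \<kappa> \<le> S q x}"
  define B where "B D N = {x\<in>space M. \<exists>q\<in>D \<inter> {..real N}. ereal q < T x \<and> \<kappa> \<le> S q x}" for D and N :: nat
  have ge: "{x\<in>space M. c \<le> S q x} \<in> sets (F q)" if "0 \<le> q" for c q
  proof -
    have "{x\<in>space (F q). c \<le> S q x} \<in> sets (F q)"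
      using supermartingale_measurable(1)[OF S that] by measurable
    then show ?thesis by simp
  qed
  have Bm: "B D N \<in> sets M" if "D \<subseteq> dyadics" for D N
  proof -
    let ?C = "\<lambda>q. {x\<in>space M. ereal q < T x} \<inter> {x\<in>space M. \<kappa> \<le> S q x}"
    have "(\<Union>q\<in>D \<inter> {..real N}. ?C q) \<in> sets M"
    proof (rule sets.countable_UN'')
      show "countable (D \<inter> {..real N})" by (rule countable_subset[OF _ countable_dyadics]) (use that in auto)
      fix q assume "q \<in> D \<inter> {..real N}"
      then have "0 \<le> q" using that dyadics_nonneg by blast
      then show "?C q \<in> sets M"
        by (intro sets.Int sets_F_M[OF T] sets_F_M[OF ge])
    qed
    also have "(\<Union>q\<in>D \<inter> {..real N}. ?C q) = B D N"
      by (auto simp: B_def)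
    finally show ?thesis .
  qed
  have gd: "grid m \<subseteq> dyadics" for m by (auto simp: dyadics_def)
  let ?t = "\<lambda>m i::nat. real i / 2 ^ m"
  \<comment> \<open>Paths that have reached \<open>T\<close> by time N although the grid offers no
    time from \<open>T\<close> on with S \<ge> -1. Unless stopped before \<open>T\<close>, they end
    at N with a negative value that has no fixed bound.\<close>
  define bad where "bad N m = {x\<in>space M. T x \<le> ereal (real N) \<and> (\<forall>i\<le>N * 2 ^ m. T x \<le> ereal (?t m i) \<longrightarrow> S (?t m i) x < -1)}" for N m
  have Tle: "{x\<in>space M. T x \<le> ereal u} \<in> sets (F u)" if "0 \<le> u" for u
  proof -
    have "space (F u) - {x\<in>space M. ereal u < T x} \<in> sets (F u)" using T[OF that] by (rule sets.compl_sets)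
    also have "space (F u) - {x\<in>space M. ereal u < T x} = {x\<in>space M. T x \<le> ereal u}" by (auto simp: not_less)
    finally show ?thesis .
  qed
  have badm: "bad N m \<in> sets M" for N m
  proof -
    let ?A = "\<lambda>i. {x\<in>space M. T x \<le> ereal (?t m i)} \<inter> {x\<in>space M. -1 \<le> S (?t m i) x}"
    have "?A i \<in> sets M" for i by (intro sets.Int sets_F_M[OF Tle] sets_F_M[OF ge]) auto
    then have "{x\<in>space M. T x \<le> ereal (real N)} - (\<Union>i\<in>{..N * 2 ^ m}. ?A i) \<in> sets M"
      using sets_F_M[OF Tle[of "real N"]] by (intro sets.Diff sets.finite_UN) auto
    also have "{x\<in>space M. T x \<le> ereal (real N)} - (\<Union>i\<in>{..N * 2 ^ m}. ?A i) = bad N m"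
    proof (intro set_eqI iffI)
      show "x \<in> bad N m" if "x \<in> {x\<in>space M. T x \<le> ereal (real N)} - (\<Union>i\<in>{..N * 2 ^ m}. ?A i)" for x
        using that unfolding bad_def not_le[symmetric] by blast
    qed (auto simp: bad_def)
    finally show ?thesis .
  qed
  \<comment> \<open>An integrable lower bound for the value at the horizon that is the same for
    every mesh, as dominated convergence requires.\<close>
  define Sm where "Sm N x = min (S (real N) x) 0" for N :: nat and x
  have SN: "integrable M (S (real N))" for N :: nat using S by (simp add: supermartingale_def)
  have Smi: "integrable M (Sm N)" for N unfolding Sm_def[abs_def] using SN by simp
  have Smb: "integrable M (\<lambda>x. indicator (bad N m) x * Sm N x)" for N m
    using integrable_mult_indicator[OF badm Smi] by simp
  have bound: "\<kappa> * prob (B (grid m) N) - 1 + (\<integral>x. indicator (bad N m) x * Sm N x \<partial>M) \<le> (\<integral>x. S 0 x \<partial>M)" for N m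
  proof -
    let ?n = "N * 2 ^ m"
    define P where "P i x \<longleftrightarrow> (ereal (?t m i) < T x \<and> \<kappa> \<le> S (?t m i) x) \<or> (T x \<le> ereal (?t m i) \<and> -1 \<le> S (?t m i) x)" for i x
    have Pm: "{x\<in>space M. P i x} \<in> sets (F (?t m i))" for i
    proof -
      let ?A = "({x\<in>space M. ereal (?t m i) < T x} \<inter> {x\<in>space M. \<kappa> \<le> S (?t m i) x}) \<union>
        ({x\<in>space M. T x \<le> ereal (?t m i)} \<inter> {x\<in>space M. -1 \<le> S (?t m i) x})"
      have "?A \<in> sets (F (?t m i))"
        by (intro sets.Un sets.Int T Tle ge) auto
      also have "?A = {x\<in>space M. P i x}"
        by (auto simp: P_def)
      finally show ?thesis .
    qed
    define \<rho> where "\<rho> x = (LEAST i. P i x \<or> i = ?n)" for x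
    note os = optional_stopping[OF S grid_mono_seq[of m], of ?n P, OF Pm, folded \<rho>_def]
    have "\<kappa> * prob (B (grid m) N) - 1 + (\<integral>x. indicator (bad N m) x * Sm N x \<partial>M)
        = (\<integral>x. \<kappa> * indicator (B (grid m) N) x - 1 + indicator (bad N m) x * Sm N x \<partial>M)"
      using scaled_indicator[OF Bm[OF gd], of \<kappa>] Smb
      by (simp add: prob_space sets.Int_space_eq2[OF Bm[OF gd]])
    also have "\<dots> \<le> (\<integral>x. S (?t m (\<rho> x)) x \<partial>M)"
    proof (rule integral_mono)
      show "integrable M (\<lambda>x. \<kappa> * indicator (B (grid m) N) x - 1 + indicator (bad N m) x * Sm N x)"
        using scaled_indicator(1)[OF Bm[OF gd]] Smb by (intro Bochner_Integration.integrable_add Bochner_Integration.integrable_diff) auto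
      show "integrable M (\<lambda>x. S (?t m (\<rho> x)) x)" by (rule os(1))
      fix x assume w: "x \<in> space M"
      have P\<rho>: "P (\<rho> x) x \<or> \<rho> x = ?n" unfolding \<rho>_def by (rule LeastI[of _ ?n]) simp
      have \<rho>_le: "\<rho> x \<le> i" if "P i x" for i unfolding \<rho>_def using that by (intro Least_le) simp
      have \<rho>_n: "\<rho> x \<le> ?n" unfolding \<rho>_def by (intro Least_le) simp
      have Sm0: "indicator (bad N m) x * Sm N x \<le> 0" by (simp add: Sm_def indicator_def)
      show "\<kappa> * indicator (B (grid m) N) x - 1 + indicator (bad N m) x * Sm N x \<le> S (?t m (\<rho> x)) x"
      proof (cases "x \<in> B (grid m) N")
        case True
        then obtain i where i: "?t m i \<le> real N" "ereal (?t m i) < T x" "\<kappa> \<le> S (?t m i) x" by (auto simp: B_def grid_def)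
        have Pi: "P i x" using i by (simp add: P_def)
        have "real i \<le> real ?n" using i(1) by (simp add: pos_divide_le_eq)
        then have "i \<le> ?n" by (simp only: of_nat_le_iff)
        then have P: "P (\<rho> x) x" using P\<rho> \<rho>_le[OF Pi] Pi by (metis le_antisym)
        \<comment> \<open>Stopping takes place no later than at index i, hence before
          \<open>T\<close>, so only the first alternative of P can be the cause.\<close>
        have "?t m (\<rho> x) \<le> ?t m i" using \<rho>_le[OF Pi] by (simp add: divide_right_mono)
        then have "ereal (?t m (\<rho> x)) < T x" using i(2) by (meson ereal_less_eq(3) le_less_trans)
        then have "\<kappa> \<le> S (?t m (\<rho> x)) x" using P unfolding P_def by (auto simp: not_le[symmetric])
        then show ?thesis using Sm0 True by simp
      next
        case False
        have nB: "\<not> \<kappa> \<le> S (?t m i) x" if "i \<le> ?n" "ereal (?t m i) < T x" for i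
        proof -
          have "real i \<le> real ?n" using that(1) by (simp only: of_nat_le_iff)
          then have "?t m i \<le> real N" by (simp add: pos_divide_le_eq)
          then show ?thesis using False that w by (auto simp: B_def grid_def)
        qed
        show ?thesis
        proof (cases "P (\<rho> x) x")
          case True
          then have "-1 \<le> S (?t m (\<rho> x)) x" using nB[OF \<rho>_n] unfolding P_def by blast
          then show ?thesis using Sm0 False by simp
        next
          case nP: False
          then have \<rho>n: "\<rho> x = ?n" using P\<rho> by simp
          have tn: "?t m ?n = real N" by simp
          have nPi: "\<not> P i x" if "i \<le> ?n" for i using \<rho>_le[of i] that nP \<rho>n by (metis le_antisym)
          show ?thesis
          proof (cases "ereal (real N) < T x")
            case True
            then have "0 \<le> S (real N) x" using nn[OF w] by simp
            then show ?thesis using Sm0 False unfolding \<rho>n tn by simp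
          next
            case NT: False
            have "S (?t m i) x < -1" if "i \<le> ?n" "T x \<le> ereal (?t m i)" for i
              using nPi[OF that(1)] that(2) unfolding P_def by (meson not_le)
            then have "x \<in> bad N m" using w NT by (simp add: bad_def not_less)
            then show ?thesis using False unfolding \<rho>n tn by (simp add: Sm_def)
          qed
        qed
      qed
    qed
    also have "\<dots> \<le> (\<integral>x. S 0 x \<partial>M)" using os(2) by simp
    finally show ?thesis .
  qed
  have lim0: "(\<lambda>m. \<integral>x. indicator (bad N m) x * Sm N x \<partial>M) \<longlonglongrightarrow> 0" for N
  proof -
    have "(\<lambda>m. \<integral>x. indicator (bad N m) x * Sm N x \<partial>M) \<longlonglongrightarrow> (\<integral>x. 0 \<partial>M)"
    proof (rule integral_dominated_convergence[where w="\<lambda>x. \<bar>Sm N x\<bar>"])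
      show "AE x in M. (\<lambda>m. indicator (bad N m) x * Sm N x) \<longlonglongrightarrow> 0"
        using zero AE_space
      proof eventually_elim
        case (elim x)
        have "\<forall>\<^sub>F m in sequentially. x \<notin> bad N m"
        proof (cases "T x \<le> ereal (real N)")
          case False
          then show ?thesis by (simp add: bad_def)
        next
          case True
          then obtain t where t: "T x = ereal t" "0 \<le> t" "t \<le> real N" using T0[OF elim(2)] by (cases "T x") auto
          have St: "S t x = 0" "((\<lambda>s. S s x) \<longlongrightarrow> 0) (at_right t)" using elim(1) t by auto
          show ?thesis
          \<comment> \<open>If \<open>T\<close> equals N, the last grid point is \<open>T\<close>
            itself, where S is 0. Otherwise the grid point just above \<open>T\<close> does not
            exceed N once the grid is fine enough.\<close>
          proof (cases "t = real N")
            case True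
            have "x \<notin> bad N m" for m
            proof
              assume "x \<in> bad N m"
              then have "S (?t m (N * 2 ^ m)) x < -1" using t(1) True unfolding bad_def by (auto dest!: spec[of _ "N * 2 ^ m"])
              then show False using St True by simp
            qed
            then show ?thesis by simp
          next
            case False
            then have tN: "t < real N" using t by simp
            have "\<forall>\<^sub>F r in at_right t. -1 < S r x"
              using St(2) by (rule order_tendstoD) simp
            then obtain d where d: "t < d" "\<And>r. t < r \<Longrightarrow> r < d \<Longrightarrow> -1 < S r x"
              unfolding eventually_at_right_field by blast
            have "\<forall>\<^sub>F m in sequentially. dyadic_above m t < min d (real N)"
              using dyadic_above_tendsto by (rule order_tendstoD) (use d tN in simp)
            then show ?thesis
            proof eventually_elim
              case (elim m)
              obtain i where i: "dyadic_above m t = ?t m i" using dyadic_above_grid[OF t(2), of m] by (auto simp: grid_def)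
              have lt: "t < ?t m i" using dyadic_above_gt[of t m] i by simp
              have "?t m i \<le> real N" using elim i by simp
              then have "real i \<le> real (N * 2 ^ m)" by (simp add: pos_divide_le_eq)
              then have "i \<le> N * 2 ^ m" by (simp only: of_nat_le_iff)
              moreover have "-1 < S (?t m i) x" using d(2)[OF lt] elim i by simp
              ultimately show ?case using lt t(1) by (auto simp: bad_def intro!: exI[of _ i])
            qed
          qed
        qed
        then show ?case by (intro tendsto_eventually) (auto elim!: eventually_mono)
      qed
    qed (use Smi Smb badm in \<open>auto simp: indicator_def\<close>)
    then show ?thesis by simp
  qed
  let ?c = "((\<integral>x. S 0 x \<partial>M) + 1) / \<kappa>"
  have BN: "prob (B dyadics N) \<le> ?c" for N
  proof -
    have "incseq (\<lambda>m. B (grid m) N)" unfolding incseq_def B_def using grid_mono by blast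
    then have "(\<lambda>m. prob (B (grid m) N)) \<longlonglongrightarrow> prob (\<Union>m. B (grid m) N)"
      using Bm[OF gd] by (intro finite_Lim_measure_incseq) auto
    moreover have "(\<Union>m. B (grid m) N) = B dyadics N" by (auto simp: B_def dyadics_def)
    ultimately have "(\<lambda>m. prob (B (grid m) N)) \<longlonglongrightarrow> prob (B dyadics N)" by simp
    then have "(\<lambda>m. \<kappa> * prob (B (grid m) N) - 1 + (\<integral>x. indicator (bad N m) x * Sm N x \<partial>M)) \<longlonglongrightarrow> \<kappa> * prob (B dyadics N) - 1 + 0"
      using lim0 by (intro tendsto_intros)
    then have "\<kappa> * prob (B dyadics N) - 1 + 0 \<le> (\<integral>x. S 0 x \<partial>M)"
      by (rule LIMSEQ_le_const2) (use bound in blast)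
    then show ?thesis using \<kappa> by (simp add: pos_le_divide_eq mult.commute)
  qed
  have U: "(\<Union>N. B dyadics N) = ?E"
    by (auto simp: B_def) (metis IntI atMost_iff real_arch_simple)
  have inc: "incseq (B dyadics)" by (force simp: incseq_def B_def)
  have "(\<lambda>N. prob (B dyadics N)) \<longlonglongrightarrow> prob (\<Union>N. B dyadics N)"
    using Bm inc by (intro finite_Lim_measure_incseq) auto
  then have "prob (\<Union>N. B dyadics N) \<le> ?c" by (rule LIMSEQ_le_const2) (use BN in blast)
  then show "prob ?E \<le> ?c" unfolding U .
  have "(\<Union>N. B dyadics N) \<in> sets M" using Bm by blast
  then show "?E \<in> sets M" unfolding U .
qed

text \<open>With \<open>T\<close> infinite the maximal inequality covers the whole time axis, and
  level k is reached with probability of order 1/k. The maximum with 1 keeps the level positive at k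
  = 0.\<close>

lemma supermartingale_bounded_on_dyadics:
  assumes Z: "supermartingale M F Z" and nn: "\<And>t x. 0 \<le> t \<Longrightarrow> x \<in> space M \<Longrightarrow> 0 \<le> Z t x"
  shows "AE x in M. \<exists>K. \<forall>q\<in>dyadics. Z q x \<le> K"
proof -
  let ?B = "\<lambda>k. {x\<in>space M. \<exists>q\<in>dyadics. ereal q < \<infinity> \<and> max (real k) 1 \<le> Z q x}"
  have B: "?B k \<in> sets M" "prob (?B k) \<le> ((\<integral>x. Z 0 x \<partial>M) + 1) / max (real k) 1" for k :: nat
    by (rule supermartingale_maximal_inequality_before[OF Z, where T="\<lambda>_. \<infinity>"]; use nn in simp)+
  have "AE x in M. \<exists>k>0. x \<notin> ?B k"
  proof (rule AE_from_probability_bounds[OF B(1)])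
    show "prob (?B k) \<le> ((\<integral>x. Z 0 x \<partial>M) + 1) / real k" if "0 < k" for k
      using B(2)[of k] that by (simp add: max_absorb1)
  qed
  then show ?thesis using AE_space
  proof eventually_elim
    case (elim x)
    then obtain k :: nat where "x \<notin> ?B k" by blast
    then show ?case using elim(2) by (intro exI[of _ "max (real k) 1"]) (auto simp: not_le intro: less_imp_le)
  qed
qed

lemma supermartingale_right_limits:
  assumes Z: "supermartingale M F Z" and nn: "\<And>t x. 0 \<le> t \<Longrightarrow> x \<in> space M \<Longrightarrow> 0 \<le> Z t x"
  shows "AE x in M. \<forall>t\<ge>0. \<exists>l. ((\<lambda>q. Z q x) \<longlongrightarrow> l) (right_dyadic t)"
proof -
  have "AE x in M. \<forall>a\<in>\<rat>. \<forall>b\<in>\<rat>. a < b \<longrightarrow> (\<exists>j. \<not> chain dyadics (\<lambda>t. Z t x) a b j (real N))" for N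
    using supermartingale_finitely_many_oscillations[OF Z nn] by (simp add: AE_ball_countable countable_rat)
  then have "AE x in M. \<forall>N. \<forall>a\<in>\<rat>. \<forall>b\<in>\<rat>. a < b \<longrightarrow> (\<exists>j. \<not> chain dyadics (\<lambda>t. Z t x) a b j (real N))"
    by (simp add: AE_all_countable)
  moreover have "AE x in M. \<exists>K. \<forall>q\<in>dyadics. Z q x \<le> K"
    by (rule supermartingale_bounded_on_dyadics[OF Z nn])
  ultimately show ?thesis using AE_space
  proof eventually_elim
    case (elim x)
    show ?case
    proof (intro allI impI)
      fix t :: real assume t: "0 \<le> t"
      obtain N :: nat where N: "t < real N" using reals_Archimedean2 by blast
      obtain K where K: "\<And>q. q \<in> dyadics \<Longrightarrow> Z q x \<le> K" using elim(2) by blast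
      show "\<exists>l. ((\<lambda>q. Z q x) \<longlongrightarrow> l) (right_dyadic t)"
        by (rule right_limit_exists[OF t N, of "\<lambda>q. Z q x" K])
          (use elim K nn dyadics_nonneg in blast)+
    qed
  qed
qed

text \<open>Fatou's lemma only compares the right limit at t with earlier times q > s; truncation at K allows
  q to decrease to s by dominated convergence.\<close>

lemma regularised_supermartingale:
  assumes N: "supermartingale M F N" and nn: "\<And>t x. 0 \<le> t \<Longrightarrow> x \<in> space M \<Longrightarrow> 0 \<le> N t x"
    and ad: "adapted F N'" and nn': "\<And>t x. 0 \<le> t \<Longrightarrow> x \<in> space M \<Longrightarrow> 0 \<le> N' t x"
    and lim: "\<And>t. 0 \<le> t \<Longrightarrow> AE x in M. (\<lambda>n. N (dyadic_above n t) x) \<longlonglongrightarrow> N' t x"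
  shows "supermartingale M F N'"
proof -
  let ?I = "\<lambda>f B. \<integral>\<^sup>+x. ennreal (f x) * indicator B x \<partial>M"
  have Nm: "N t \<in> borel_measurable M" if "0 \<le> t" for t using supermartingale_measurable(2)[OF N that] .
  have N'm: "N' t \<in> borel_measurable M" if "0 \<le> t" for t using ad that measurable_F_M by (auto simp: adapted_def)
  have d0: "0 \<le> dyadic_above n t" if "0 \<le> t" for n t using dyadic_above_gt[of t n] that by simp
  have fatou: "?I (N' t) B \<le> ?I (N q) B"
    if q: "0 \<le> q" "q \<le> t" and B: "B \<in> sets (F q)" for q t B
  proof -
    have t: "0 \<le> t" using q by simp
    note [measurable] = sets_F_M[OF B] Nm[OF d0[OF t]]
    have "?I (N' t) B
        = (\<integral>\<^sup>+x. liminf (\<lambda>n. ennreal (N (dyadic_above n t) x) * indicator B x) \<partial>M)"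
    proof (rule nn_integral_cong_AE)
      show "AE x in M. ennreal (N' t x) * indicator B x = liminf (\<lambda>n. ennreal (N (dyadic_above n t) x) * indicator B x)"
        using lim[OF t]
      proof eventually_elim
        case (elim x)
        then have "(\<lambda>n. ennreal (N (dyadic_above n t) x)) \<longlonglongrightarrow> ennreal (N' t x)" by (rule tendsto_ennrealI)
        then show ?case by (cases "x \<in> B") (simp_all add: lim_imp_Liminf Liminf_const)
      qed
    qed
    also have "\<dots> \<le> liminf (\<lambda>n. \<integral>\<^sup>+x. ennreal (N (dyadic_above n t) x) * indicator B x \<partial>M)"
      by (rule nn_integral_liminf) measurable
    also have "\<dots> \<le> liminf (\<lambda>n. \<integral>\<^sup>+x. ennreal (N q x) * indicator B x \<partial>M)"
    proof (intro Liminf_mono always_eventually allI)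
      fix n
      show "?I (N (dyadic_above n t)) B \<le> ?I (N q) B"
        using q dyadic_above_gt[of t n] by (intro supermartingale_nn_integral_le[OF N nn] B) auto
    qed
    also have "\<dots> = ?I (N q) B" by (simp add: Liminf_const)
    finally show ?thesis .
  qed
  show ?thesis
  proof (rule supermartingaleI_nn_integral[OF ad nn'])
    have "(\<integral>\<^sup>+x. ennreal (N' 0 x) \<partial>M) = ?I (N' 0) (space M)"
      by (intro nn_integral_cong) simp
    also have "\<dots> \<le> ?I (N 0) (space M)" by (rule fatou) auto
    also have "\<dots> = (\<integral>\<^sup>+x. ennreal (N 0 x) \<partial>M)" by (intro nn_integral_cong) simp
    also have "\<dots> = ennreal (\<integral>x. N 0 x \<partial>M)"
      using N nn by (intro nn_integral_eq_integral) (auto simp: supermartingale_def)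
    finally show "(\<integral>\<^sup>+x. ennreal (N' 0 x) \<partial>M) < \<infinity>" by (simp add: le_less_trans)
    fix s t :: real and A assume st: "0 \<le> s" "s \<le> t" and A: "A \<in> sets (F s)"
    have t: "0 \<le> t" using st by simp
    show "?I (N' t) A \<le> ?I (N' s) A"
    proof (cases "s = t")
      case False
      then have st': "s < t" using st by simp
      let ?K = "\<lambda>(k::nat) f. \<integral>\<^sup>+x. min (ennreal (f x)) (of_nat k) * indicator A x \<partial>M"
      note [measurable] = sets_F_M[OF A] N'm[OF t] N'm[OF st(1)]
      have trunc: "?K k (N' t)
          \<le> ?K k (N q)" if q: "s \<le> q" "q \<le> t" for q and k :: nat
      proof -
        have q0: "0 \<le> q" using q st by simp
        \<comment> \<open>Fatou's comparison is used only where \<open>N q\<close> \<le> k, an event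
          of \<open>F q\<close>. Elsewhere k bounds the truncation of \<open>N' t\<close> and equals
          that of \<open>N q\<close>.\<close>
        define G where "G = {x\<in>space (F q). N q x \<le> real k}"
        have G: "G \<in> sets (F q)" unfolding G_def using supermartingale_measurable(1)[OF N q0] by measurable
        have AF: "A \<in> sets (F q)" using sets_F_mono[OF st(1) q(1) A] .
        note [measurable] = sets_F_M[OF G] Nm[OF q0]
        have "?K k (N' t)
            \<le> (\<integral>\<^sup>+x. ennreal (N' t x) * indicator (A \<inter> G) x + of_nat k * indicator (A - G) x \<partial>M)"
          by (intro nn_integral_mono) (auto simp: indicator_def)
        also have "\<dots> = ?I (N' t) (A \<inter> G) + (\<integral>\<^sup>+x. of_nat k * indicator (A - G) x \<partial>M)"
          by (rule nn_integral_add) measurable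
        also have "\<dots> \<le> ?I (N q) (A \<inter> G) + (\<integral>\<^sup>+x. of_nat k * indicator (A - G) x \<partial>M)"
          using AF G by (intro add_right_mono fatou q0 q sets.Int)
        also have "\<dots> = (\<integral>\<^sup>+x. ennreal (N q x) * indicator (A \<inter> G) x + of_nat k * indicator (A - G) x \<partial>M)"
          by (rule nn_integral_add[symmetric]) measurable
        also have "\<dots> = ?K k (N q)"
        proof (rule nn_integral_cong)
          fix x assume w: "x \<in> space M"
          have "min (ennreal (N q x)) (of_nat k) = (if x \<in> G then ennreal (N q x) else of_nat k)"
            using w by (auto simp: G_def min_def ennreal_of_nat_eq_real_of_nat)
          then show "ennreal (N q x) * indicator (A \<inter> G) x + of_nat k * indicator (A - G) x = min (ennreal (N q x)) (of_nat k) * indicator A x"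
            by (auto simp: indicator_def)
        qed
        finally show ?thesis .
      qed
      have k_le: "?K k (N' t)
          \<le> ?I (N' s) A" for k :: nat
      proof -
        have "(\<lambda>n. \<integral>\<^sup>+x. min (ennreal (N (dyadic_above n s) x)) (of_nat k) * indicator A x \<partial>M)
            \<longlonglongrightarrow> ?K k (N' s)"
        proof (rule nn_integral_dominated_convergence[where w="\<lambda>_. of_nat k"])
          note [measurable] = Nm[OF d0[OF st(1)]]
          show "(\<lambda>x. min (ennreal (N (dyadic_above n s) x)) (of_nat k) * indicator A x) \<in> borel_measurable M" for n by measurable
          show "(\<lambda>x. min (ennreal (N' s x)) (of_nat k) * indicator A x) \<in> borel_measurable M" by measurable
          show "(\<integral>\<^sup>+x. of_nat k \<partial>M) < \<infinity>" by (simp add: emeasure_space_1 of_nat_less_top)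
          show "AE x in M. min (ennreal (N (dyadic_above n s) x)) (of_nat k) * indicator A x \<le> of_nat k" for n
            by (auto simp: indicator_def)
          show "AE x in M. (\<lambda>n. min (ennreal (N (dyadic_above n s) x)) (of_nat k) * indicator A x)
              \<longlonglongrightarrow> min (ennreal (N' s x)) (of_nat k) * indicator A x"
            using lim[OF st(1)]
          proof eventually_elim
            case (elim x)
            then have "(\<lambda>n. min (ennreal (N (dyadic_above n s) x)) (of_nat k)) \<longlonglongrightarrow> min (ennreal (N' s x)) (of_nat k)"
              by (intro tendsto_min tendsto_ennrealI tendsto_const)
            then show ?case by (cases "x \<in> A") auto
          qed
        qed simp
        moreover have "\<exists>n0. \<forall>n\<ge>n0. ?K k (N' t)
            \<le> ?K k (N (dyadic_above n s))"
        proof -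
          have "\<forall>\<^sub>F n in sequentially. dyadic_above n s < t" using dyadic_above_tendsto st' by (rule order_tendstoD)
          then obtain n0 where "\<And>n. n0 \<le> n \<Longrightarrow> dyadic_above n s < t" by (auto simp: eventually_sequentially)
          then show ?thesis using dyadic_above_gt[of s] by (intro exI[of _ n0] allI impI trunc) (auto intro: less_imp_le)
        qed
        ultimately have "?K k (N' t)
            \<le> ?K k (N' s)" by (rule LIMSEQ_le_const)
        also have "\<dots> \<le> ?I (N' s) A"
          by (intro nn_integral_mono mult_right_mono) auto
        finally show ?thesis .
      qed
      have "?I (N' t) A
          = (\<integral>\<^sup>+x. (SUP k. min (ennreal (N' t x)) (of_nat k) * indicator A x) \<partial>M)"
      proof (rule nn_integral_cong)
        fix x
        have "(SUP k. min (ennreal (N' t x)) (of_nat k)) = ennreal (N' t x)"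
        proof (rule antisym)
          obtain k :: nat where "N' t x \<le> real k" using real_arch_simple by blast
          then have "min (ennreal (N' t x)) (of_nat k) = ennreal (N' t x)"
            by (simp add: min_def ennreal_of_nat_eq_real_of_nat)
          then show "ennreal (N' t x) \<le> (SUP k. min (ennreal (N' t x)) (of_nat k))" by (intro SUP_upper2[of k]) auto
        qed (auto intro: SUP_least)
        then show "ennreal (N' t x) * indicator A x = (SUP k. min (ennreal (N' t x)) (of_nat k) * indicator A x)"
          by (simp add: SUP_mult_right_ennreal[symmetric])
      qed
      also have "\<dots> = (SUP k. \<integral>\<^sup>+x. min (ennreal (N' t x)) (of_nat k) * indicator A x \<partial>M)"
      proof (rule nn_integral_monotone_convergence_SUP)
        show "incseq (\<lambda>k x. min (ennreal (N' t x)) (of_nat k) * indicator A x)"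
          by (auto simp: incseq_def le_fun_def intro!: mult_right_mono min.mono)
      qed measurable
      also have "\<dots> \<le> ?I (N' s) A" by (intro SUP_least k_le)
      finally show ?thesis .
    qed simp
  qed
qed

text \<open>For any s > t all but finitely many approximations lie before s, and dropping the others
  never changes \<open>lim\<close>, not even where the sequence diverges and \<open>lim\<close> is a
  default value. Right continuity of the filtration then gives measurability at t.\<close>

lemma measurable_right_limit:
  assumes w: "\<And>t. 0 \<le> t \<Longrightarrow> w t \<in> borel_measurable (F t)" and t: "0 \<le> t"
  shows "(\<lambda>x. lim (\<lambda>n. w (dyadic_above n t) x) :: real) \<in> borel_measurable (F t)"
proof (rule measurableI)
  fix B :: "real set" assume B: "B \<in> sets borel"
  show "(\<lambda>x. lim (\<lambda>n. w (dyadic_above n t) x)) -` B \<inter> space (F t) \<in> sets (F t)"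
  proof (rule sets_F_right[OF t])
    fix s assume s: "t < s"
    have "\<forall>\<^sub>F n in sequentially. dyadic_above n t < s" using dyadic_above_tendsto s by (rule order_tendstoD)
    then obtain n0 where n0: "\<And>n. n0 \<le> n \<Longrightarrow> dyadic_above n t < s" by (auto simp: eventually_sequentially)
    have "w (dyadic_above (n + n0) t) \<in> borel_measurable (F s)" for n
      using t n0[of "n + n0"] dyadic_above_gt[of t "n + n0"] by (intro measurable_F_mono[OF _ _ w]) auto
    then have "(\<lambda>x. lim (\<lambda>n. w (dyadic_above (n + n0) t) x)) \<in> borel_measurable (F s)" by measurable
    moreover have "lim (\<lambda>n. w (dyadic_above (n + n0) t) x) = lim (\<lambda>n. w (dyadic_above n t) x)" for x
      unfolding lim_def
      by (intro arg_cong[where f=The] ext iffI)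
        (erule LIMSEQ_offset[of "\<lambda>n. w (dyadic_above n t) x" n0], erule LIMSEQ_ignore_initial_segment)
    ultimately have "(\<lambda>x. lim (\<lambda>n. w (dyadic_above n t) x)) \<in> borel_measurable (F s)" by simp
    from measurable_sets[OF this B] show "(\<lambda>x. lim (\<lambda>n. w (dyadic_above n t) x)) -` B \<inter> space (F t) \<in> sets (F s)" by simp
  qed
qed simp

section \<open>The first zero is a stopping time\<close>

lemma stopping_time_less:
  assumes "\<And>t. 0 \<le> t \<Longrightarrow> {x\<in>space M. \<sigma> x \<le> t} \<in> sets (F t)" "\<And>x. x \<in> space M \<Longrightarrow> 0 \<le> \<sigma> x" "0 \<le> t"
  shows "{x\<in>space M. \<sigma> x < (t::real)} \<in> sets (F t)"
proof -
  let ?S = "\<lambda>r. {x\<in>space M. \<sigma> x \<le> r}"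
  have "(\<Union>r\<in>dyadics \<inter> {..<t}. ?S r) \<in> sets (F t)"
  proof (rule sets.countable_UN'')
    show "countable (dyadics \<inter> {..<t})" by (simp add: countable_dyadics)
    fix r assume r: "r \<in> dyadics \<inter> {..<t}"
    then have "0 \<le> r" by (simp add: dyadics_nonneg)
    then show "?S r \<in> sets (F t)" using r by (intro sets_F_mono[OF _ _ assms(1)]) auto
  qed
  also have "(\<Union>r\<in>dyadics \<inter> {..<t}. ?S r) = {x\<in>space M. \<sigma> x < t}"
  proof
    show "{x\<in>space M. \<sigma> x < t} \<subseteq> (\<Union>r\<in>dyadics \<inter> {..<t}. ?S r)"
    proof
      fix x assume w: "x \<in> {x\<in>space M. \<sigma> x < t}"
      then obtain q where "q \<in> dyadics" "\<sigma> x < q" "q < t" using dyadic_dense[of "\<sigma> x" t] assms(2) by auto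
      then show "x \<in> (\<Union>r\<in>dyadics \<inter> {..<t}. ?S r)" using w by (auto intro!: bexI[of _ q])
    qed
  qed auto
  finally show ?thesis .
qed

lemma stopping_time_from_less:
  assumes less: "\<And>t. 0 < t \<Longrightarrow> {x\<in>space M. \<sigma> x < t} \<in> sets (F t)" and t: "0 \<le> t"
  shows "{x\<in>space M. \<sigma> x \<le> (t::real)} \<in> sets (F t)"
proof (rule sets_F_right[OF t])
  fix s assume s: "t < s"
  let ?S = "\<lambda>r. {x\<in>space M. \<sigma> x < r}"
  obtain r0 where r0: "r0 \<in> dyadics" "t < r0" "r0 < s" using dyadic_dense[OF t s] by blast
  have "(\<Inter>r\<in>dyadics \<inter> {t<..<s}. ?S r) \<in> sets (F s)"
  proof (rule sets.countable_INT')
    show "countable (dyadics \<inter> {t<..<s})" by (simp add: countable_dyadics)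
    show "dyadics \<inter> {t<..<s} \<noteq> {}" using r0 by auto
    show "?S ` (dyadics \<inter> {t<..<s}) \<subseteq> sets (F s)"
    proof (rule image_subsetI)
      fix r assume "r \<in> dyadics \<inter> {t<..<s}"
      then show "?S r \<in> sets (F s)" using t by (intro sets_F_mono[OF _ _ less]) auto
    qed
  qed
  also have "(\<Inter>r\<in>dyadics \<inter> {t<..<s}. ?S r) = {x\<in>space M. \<sigma> x \<le> t}"
  proof
    show "(\<Inter>r\<in>dyadics \<inter> {t<..<s}. ?S r) \<subseteq> {x\<in>space M. \<sigma> x \<le> t}"
    proof
      fix x assume w: "x \<in> (\<Inter>r\<in>dyadics \<inter> {t<..<s}. ?S r)"
      have "\<sigma> x \<le> t"
      proof (rule ccontr)
        assume "\<not> \<sigma> x \<le> t"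
        then obtain r where r: "r \<in> dyadics" "t < r" "r < min s (\<sigma> x)"
          using dyadic_dense[OF t, of "min s (\<sigma> x)"] s by auto
        then have "x \<in> ?S r" using w by (intro INT_D[OF w]) auto
        then show False using r by simp
      qed
      then show "x \<in> {x\<in>space M. \<sigma> x \<le> t}" using w r0 by auto
    qed
  qed auto
  finally show "{x\<in>space M. \<sigma> x \<le> t} \<in> sets (F s)" .
qed

text \<open>Without left limits the zero set cannot be approached by level crossings; instead one takes the
  largest stopping time below the first zero and notes that it could be enlarged if the process were
  positive there.\<close>

lemma first_zero_stopping_time:
  assumes ad: "adapted F X" and nn: "\<And>t x. 0 \<le> t \<Longrightarrow> x \<in> space M \<Longrightarrow> 0 \<le> X t x"
    and rc: "as_right_continuous M X" and u: "0 \<le> u"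
  shows "{x\<in>space M. ereal u < first_zero X x} \<in> sets (F u)"
proof -
  \<comment> \<open>The cap makes expectations finite. Placing it strictly above u leaves room to
    the right of a stopping time whose value is at most u.\<close>
  define U where "U = u + 1"
  define S where "S = {\<tau>::'a \<Rightarrow> real. (\<forall>x\<in>space M. 0 \<le> \<tau> x \<and> \<tau> x \<le> U) \<and>
    (\<forall>t\<ge>0. {x\<in>space M. \<tau> x \<le> t} \<in> sets (F t)) \<and> (AE x in M. ereal (\<tau> x) \<le> first_zero X x)}"
  have Sm: "\<tau> \<in> borel_measurable M" if "\<tau> \<in> S" for \<tau>
    unfolding borel_measurable_iff_le
  proof
    fix t
    show "{x\<in>space M. \<tau> x \<le> t} \<in> sets M"
    proof (cases "0 \<le> t")
      case True
      then show ?thesis using that by (auto simp: S_def intro: sets_F_M)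
    next
      case False
      then have "{x\<in>space M. \<tau> x \<le> t} = {}" using that by (force simp: S_def)
      then show ?thesis by (simp only: sets.empty_sets)
    qed
  qed
  have Si: "integrable M \<tau>" if "\<tau> \<in> S" for \<tau>
    by (rule integrable_const_bound[where B=U]) (use that Sm[OF that] in \<open>auto simp: S_def\<close>)
  have S0: "(\<lambda>_. 0) \<in> S" using u first_zero_nonneg[of X] sets.top[of "F _"] by (auto simp: S_def U_def zero_ereal_def[symmetric])
  define I where "I \<tau> = (\<integral>x. \<tau> x \<partial>M)" for \<tau> :: "'a \<Rightarrow> real"
  have IU: "I \<tau> \<le> U" if "\<tau> \<in> S" for \<tau>
  proof -
    have "I \<tau> \<le> (\<integral>x. U \<partial>M)" unfolding I_def by (rule integral_mono[OF Si[OF that]]) (use that in \<open>auto simp: S_def\<close>)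
    then show ?thesis by (simp add: prob_space)
  qed
  define s where "s = Sup (I ` S)"
  have bdd: "bdd_above (I ` S)" using IU by (auto intro!: bdd_aboveI[of _ U])
  have I_le: "I \<tau> \<le> s" if "\<tau> \<in> S" for \<tau> unfolding s_def using bdd that by (auto intro: cSup_upper)
  have "\<exists>\<tau>\<in>S. s - 1 / real (Suc n) < I \<tau>" for n
  proof -
    have "s - 1 / real (Suc n) < Sup (I ` S)" by (simp add: s_def)
    moreover have "I ` S \<noteq> {}" using S0 by blast
    ultimately have "\<exists>y\<in>I ` S. s - 1 / real (Suc n) < y" using bdd by (metis less_cSup_iff)
    then show ?thesis by auto
  qed
  then obtain \<tau> where \<tau>S: "\<And>n. \<tau> n \<in> S" and \<tau>I: "\<And>n. s - 1 / real (Suc n) < I (\<tau> n)" by metis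
  \<comment> \<open>The supremum of a maximising sequence is again a stopping time, as it is at most
    t exactly where all members are. Hence the maximal expectation is attained.\<close>
  define \<sigma> where "\<sigma> x = (SUP n. \<tau> n x)" for x
  have \<tau>b: "bdd_above (range (\<lambda>n. \<tau> n x))" if "x \<in> space M" for x
    using \<tau>S that by (auto simp: S_def intro!: bdd_aboveI[of _ U])
  have \<tau>\<sigma>: "\<tau> n x \<le> \<sigma> x" if "x \<in> space M" for n x unfolding \<sigma>_def using \<tau>b[OF that] by (rule cSUP_upper2) auto
  have \<sigma>_le: "\<sigma> x \<le> c" if "\<And>n. \<tau> n x \<le> c" for x c unfolding \<sigma>_def using that by (intro cSUP_least) auto
  have \<sigma>S: "\<sigma> \<in> S"
  proof -
    have "0 \<le> \<sigma> x" "\<sigma> x \<le> U" if "x \<in> space M" for x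
    proof -
      have b: "0 \<le> \<tau> n x" "\<tau> n x \<le> U" for n using \<tau>S[of n] that by (simp_all add: S_def)
      show "0 \<le> \<sigma> x" by (rule order_trans[OF b(1) \<tau>\<sigma>[OF that]])
      show "\<sigma> x \<le> U" by (rule \<sigma>_le[OF b(2)])
    qed
    moreover have "{x\<in>space M. \<sigma> x \<le> t} \<in> sets (F t)" if "0 \<le> t" for t
    proof -
      have "(\<Inter>n. {x\<in>space M. \<tau> n x \<le> t}) \<in> sets (F t)" using \<tau>S that by (intro sets.countable_INT) (auto simp: S_def)
      also have "(\<Inter>n. {x\<in>space M. \<tau> n x \<le> t}) = {x\<in>space M. \<sigma> x \<le> t}"
        using \<tau>\<sigma> \<sigma>_le by (auto intro: order_trans)
      finally show ?thesis .
    qed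
    moreover have "AE x in M. ereal (\<sigma> x) \<le> first_zero X x"
    proof -
      have "AE x in M. \<forall>n. ereal (\<tau> n x) \<le> first_zero X x" using \<tau>S by (auto simp: AE_all_countable S_def)
      then show ?thesis
      proof eventually_elim
        case (elim x)
        show ?case
        proof (cases "first_zero X x")
          case (real r)
          then show ?thesis using elim by (simp add: \<sigma>_le)
        qed (use first_zero_nonneg[of X x] in auto)
      qed
    qed
    ultimately show ?thesis by (auto simp: S_def)
  qed
  have I\<sigma>: "I \<sigma> = s"
  proof (rule antisym[OF I_le[OF \<sigma>S]])
    have "s - 1 / real (Suc n) \<le> I \<sigma>" for n
      using \<tau>I[of n] integral_mono[OF Si[OF \<tau>S[of n]] Si[OF \<sigma>S] \<tau>\<sigma>] by (simp add: I_def)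
    moreover have "(\<lambda>n. s - 1 / real (Suc n)) \<longlonglongrightarrow> s" by real_asymp
    ultimately show "s \<le> I \<sigma>" by (intro LIMSEQ_le_const2) auto
  qed
  have \<sigma>0: "0 \<le> \<sigma> x" "\<sigma> x \<le> U" if "x \<in> space M" for x using \<sigma>S that by (auto simp: S_def)
  \<comment> \<open>Candidates for enlarging \<sigma>: wait for the next dyadic time with X < c, at
    most until the cap. By right continuity a zero is followed at once by such times, so almost
    surely the enlargement does not pass the first zero.\<close>
  define hits where "hits c x = {q\<in>dyadics. \<sigma> x < q \<and> X q x < c}" for c x
  define \<sigma>' where "\<sigma>' c x = Inf (insert U (hits c x))" for c x
  have hb: "bdd_below (insert U (hits c x))" if "x \<in> space M" for c x
    using \<sigma>0[OF that] by (auto simp: hits_def intro!: bdd_belowI[of _ "\<sigma> x"])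
  have \<sigma>'_le: "\<sigma>' c x \<le> q" if "x \<in> space M" "q \<in> insert U (hits c x)" for c x q
    unfolding \<sigma>'_def using hb that by (intro cInf_lower) auto
  have \<sigma>\<sigma>': "\<sigma> x \<le> \<sigma>' c x" if "x \<in> space M" for c x
    unfolding \<sigma>'_def using \<sigma>0[OF that] by (intro cInf_greatest) (auto simp: hits_def)
  have \<sigma>'S: "\<sigma>' c \<in> S" if c: "0 < c" for c
  proof -
    have "0 \<le> \<sigma>' c x \<and> \<sigma>' c x \<le> U" if "x \<in> space M" for x
      using \<sigma>0[OF that] \<sigma>\<sigma>'[OF that] \<sigma>'_le[OF that, of U] by (meson insertI1 order_trans)
    moreover have "{x\<in>space M. \<sigma>' c x \<le> t} \<in> sets (F t)" if t: "0 \<le> t" for t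
    proof (rule stopping_time_from_less[OF _ t])
      fix v :: real assume v: "0 < v"
      have "(\<Union>q\<in>dyadics \<inter> {..<v}. {x\<in>space M. \<sigma> x < q} \<inter> {x\<in>space M. X q x < c}) \<in> sets (F v)"
      proof (rule sets.countable_UN'')
        show "countable (dyadics \<inter> {..<v})" by (simp add: countable_dyadics)
        fix q assume q: "q \<in> dyadics \<inter> {..<v}"
        have q0: "0 \<le> q" using q dyadics_nonneg by auto
        have "{x\<in>space M. \<sigma> x < q} \<in> sets (F q)"
          using \<sigma>S \<sigma>0 q0 by (intro stopping_time_less) (auto simp: S_def)
        moreover have "{x\<in>space (F q). X q x < c} \<in> sets (F q)"
          using ad q0 by (intro borel_measurable_less) (auto simp: adapted_def)
        ultimately have "{x\<in>space M. \<sigma> x < q} \<inter> {x\<in>space M. X q x < c} \<in> sets (F q)" by (auto intro: sets.Int)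
        then show "{x\<in>space M. \<sigma> x < q} \<inter> {x\<in>space M. X q x < c} \<in> sets (F v)"
          using q0 q by (intro sets_F_mono[of q v]) auto
      qed
      moreover have "{x\<in>space M. \<sigma>' c x < v} = (if U < v then space (F v) else
          (\<Union>q\<in>dyadics \<inter> {..<v}. {x\<in>space M. \<sigma> x < q} \<inter> {x\<in>space M. X q x < c}))"
      proof -
        have "\<sigma>' c x < v \<longleftrightarrow> (\<exists>q\<in>insert U (hits c x). q < v)" if "x \<in> space M" for x
          unfolding \<sigma>'_def using hb[OF that] by (intro cInf_less_iff) auto
        then show ?thesis by (auto simp: hits_def)
      qed
      ultimately show "{x\<in>space M. \<sigma>' c x < v} \<in> sets (F v)" by (simp del: space_F)
    qed
    moreover have "AE x in M. ereal (\<sigma>' c x) \<le> first_zero X x"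
    proof -
      have "AE x in M. ereal (\<sigma> x) \<le> first_zero X x" using \<sigma>S by (simp add: S_def)
      then show ?thesis using rc[unfolded as_right_continuous_def] AE_space
      proof eventually_elim
        case (elim x)
        show ?case
          unfolding first_zero_def
        proof (rule Inf_greatest)
          fix z assume "z \<in> {ereal t | t. 0 \<le> t \<and> X t x = 0}"
          then obtain t where t: "z = ereal t" "0 \<le> t" "X t x = 0" by auto
          have st: "\<sigma> x \<le> t" using elim(1) first_zero_le[of t X x] t by (metis ereal_less_eq(3) order_trans)
          have "\<forall>\<^sub>F r in at_right t. X r x < c"
            using elim(2) t c by (intro order_tendstoD(2)[of "\<lambda>r. X r x" "X t x"]) auto
          then obtain d where d: "t < d" "\<And>r. t < r \<Longrightarrow> r < d \<Longrightarrow> X r x < c"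
            unfolding eventually_at_right_field by blast
          have "\<sigma>' c x \<le> t"
          proof (rule field_le_epsilon)
            fix e :: real assume e: "0 < e"
            obtain q where q: "q \<in> dyadics" "t < q" "q < min d (t + e)"
              using dyadic_dense[OF t(2), of "min d (t + e)"] d(1) e by auto
            then have "q \<in> hits c x" using st d(2)[of q] by (auto simp: hits_def)
            then show "\<sigma>' c x \<le> t + e" using \<sigma>'_le[OF elim(3), of q c] q(3) by simp
          qed
          then show "ereal (\<sigma>' c x) \<le> z" using t by simp
        qed
      qed
    qed
    ultimately show ?thesis by (auto simp: S_def)
  qed
  \<comment> \<open>The expectation of \<sigma> is maximal, so the enlargement, which is never
    smaller, coincides with it almost surely.\<close>
  have \<sigma>'eq: "AE x in M. \<sigma>' c x = \<sigma> x" if "0 < c" for c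
  proof -
    have i: "integrable M (\<lambda>x. \<sigma>' c x - \<sigma> x)" using Si[OF \<sigma>'S[OF that]] Si[OF \<sigma>S] by simp
    have nn: "AE x in M. 0 \<le> \<sigma>' c x - \<sigma> x" using \<sigma>\<sigma>' by (auto intro!: AE_I2)
    have "(\<integral>x. \<sigma>' c x - \<sigma> x \<partial>M) = I (\<sigma>' c) - I \<sigma>"
      unfolding I_def using Si[OF \<sigma>'S[OF that]] Si[OF \<sigma>S] by simp
    also have "\<dots> \<le> 0" using I_le[OF \<sigma>'S[OF that]] I\<sigma> by simp
    finally have "AE x in M. \<sigma>' c x - \<sigma> x = 0"
      using integral_nonneg_eq_0_iff_AE[OF i nn] integral_nonneg_AE[OF nn] by simp
    then show ?thesis by eventually_elim simp
  qed
  have "AE x in M. \<forall>k::nat. \<sigma>' (1 / real (Suc k)) x = \<sigma> x"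
    unfolding AE_all_countable using \<sigma>'eq by simp
  moreover have "AE x in M. ereal (\<sigma> x) \<le> first_zero X x" using \<sigma>S by (simp add: S_def)
  ultimately have AE: "AE x in M. (x \<in> space (F u) - {x\<in>space M. \<sigma> x \<le> u}) \<longleftrightarrow> x \<in> {x\<in>space M. ereal u < first_zero X x}"
    using rc[unfolded as_right_continuous_def] AE_space
  proof eventually_elim
    case (elim x)
    have "first_zero X x \<le> ereal u" if su: "\<sigma> x \<le> u"
    proof -
      \<comment> \<open>A larger value would persist for a while after \<sigma> and delay the next
        value below 1/(k+1), making the enlargement strictly larger than \<sigma>, which lies below
        the cap.\<close>
      have "X (\<sigma> x) x \<le> 1 / real (Suc k)" for k
      proof (rule ccontr)
        assume "\<not> ?thesis"
        then have "\<forall>\<^sub>F r in at_right (\<sigma> x). 1 / real (Suc k) < X r x"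
          using elim(3) \<sigma>0[OF elim(4)] by (intro order_tendstoD(1)[of "\<lambda>r. X r x" "X (\<sigma> x) x"]) auto
        then obtain d where d: "\<sigma> x < d" "\<And>r. \<sigma> x < r \<Longrightarrow> r < d \<Longrightarrow> 1 / real (Suc k) < X r x"
          unfolding eventually_at_right_field by blast
        have "min d U \<le> \<sigma>' (1 / real (Suc k)) x"
          unfolding \<sigma>'_def using d(2) by (intro cInf_greatest) (force simp: hits_def)+
        then show False using elim(1) d(1) su by (auto simp: U_def)
      qed
      moreover have "(\<lambda>k. 1 / real (Suc k)) \<longlonglongrightarrow> 0" by real_asymp
      ultimately have "X (\<sigma> x) x \<le> 0" by (intro LIMSEQ_le_const) auto
      then have "X (\<sigma> x) x = 0" using nn \<sigma>0[OF elim(4)] elim(4) by (intro antisym) auto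
      then have "first_zero X x \<le> ereal (\<sigma> x)" using \<sigma>0[OF elim(4)] by (intro first_zero_le)
      then show ?thesis using su by (meson ereal_less_eq(3) order_trans)
    qed
    moreover have "ereal u < first_zero X x" if "u < \<sigma> x" using that elim(2) by (metis less_ereal.simps(1) less_le_trans)
    ultimately show ?case using elim(4) by (cases "\<sigma> x \<le> u") auto
  qed
  have "space (F u) - {x\<in>space M. \<sigma> x \<le> u} \<in> sets (F u)" using \<sigma>S u by (intro sets.compl_sets) (auto simp: S_def)
  then show ?thesis using u _ AE by (rule AE_sets_F) auto
qed

end

section \<open>From a deflator to dynamic share viability\<close>

locale dominated_processes = usual_filtration M F for M :: "'a measure" and F +
  fixes \<X> :: "(real \<Rightarrow> 'a \<Rightarrow> real) set" and Xh :: "real \<Rightarrow> 'a \<Rightarrow> real"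
  assumes SPD: "SPD M F \<X>" and dominating: "dominating_process M \<X> Xh"
begin

abbreviation T :: "'a \<Rightarrow> ereal" where "T \<equiv> first_zero Xh"

abbreviation limit_ratio :: "(real \<Rightarrow> 'a \<Rightarrow> real) \<Rightarrow> 'a \<Rightarrow> ereal" where
  "limit_ratio X x \<equiv> left_liminf (\<lambda>t. ratio (X t x) (Xh t x)) (T x)"

lemma Xh_in: "Xh \<in> \<X>"
  using dominating by (simp add: dominating_process_def)

lemma process:
  assumes "X \<in> \<X>"
  shows process_adapted: "adapted F X"
    and process_nonneg: "0 \<le> t \<Longrightarrow> x \<in> space M \<Longrightarrow> 0 \<le> X t x"
    and process_right_continuous: "AE x in M. \<forall>t\<ge>0. ((\<lambda>s. X s x) \<longlongrightarrow> X t x) (at_right t)"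
    and process_0: "x \<in> space M \<Longrightarrow> X 0 x = 1"
  using SPD assms by (auto simp: SPD_def set_of_processes_def as_right_continuous_def)

lemma process_measurable:
  assumes "X \<in> \<X>" "0 \<le> t"
  shows "X t \<in> borel_measurable (F t)" "X t \<in> borel_measurable M"
  using process_adapted[OF assms(1)] assms(2) measurable_F_M by (auto simp: adapted_def)

lemma dominated: "X \<in> \<X> \<Longrightarrow> 0 \<le> t \<Longrightarrow> x \<in> space M \<Longrightarrow> Xh t x = 0 \<Longrightarrow> X t x = 0"
  using dominating by (auto simp: dominating_process_def)

lemma Xh_pos: "0 \<le> t \<Longrightarrow> x \<in> space M \<Longrightarrow> ereal t < T x \<Longrightarrow> 0 < Xh t x"
  using process_nonneg[OF Xh_in, of t x] before_first_zero[of t Xh x] by simp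

lemma T_stopping_time: "0 \<le> u \<Longrightarrow> {x\<in>space M. ereal u < T x} \<in> sets (F u)"
  by (rule first_zero_stopping_time[OF process_adapted[OF Xh_in] process_nonneg[OF Xh_in]])
    (use process_right_continuous[OF Xh_in] in \<open>simp_all add: as_right_continuous_def\<close>)

lemma T_attained: "AE x in M. \<forall>t. T x = ereal t \<longrightarrow> Xh t x = 0"
  using process_right_continuous[OF Xh_in]
  by eventually_elim (use first_zero_attained[of Xh] in blast)

text \<open>At \<open>T\<close> = 0 the left limit inferior ranges over an empty set of times and is
  infinite. The initial value 1 together with right continuity excludes this almost surely.\<close>

lemma T_pos: "AE x in M. 0 < T x"
  using T_attained AE_space
proof eventually_elim
  case (elim x)
  have "T x \<noteq> 0"
  proof
    assume "T x = 0"
    then have "Xh 0 x = 0" using elim(1) by (simp add: zero_ereal_def)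
    then show False using process_0[OF Xh_in elim(2)] by simp
  qed
  then show ?case using first_zero_nonneg[of Xh x] by (simp add: less_le)
qed

lemma deflator_imp_DSV:
  assumes SMD: "SMD M F \<X> Y" and Yad: "adapted F Y" and Yrc: "as_right_continuous M Y"
    and Ypos: "\<And>x t. x \<in> space M \<Longrightarrow> 0 \<le> t \<Longrightarrow> ereal t < T x \<Longrightarrow> 0 < Y t x"
    and lim: "AE x in M. 0 < left_liminf (\<lambda>t. Xh t x * Y t x) (T x)"
  shows "DSV M \<X> Xh"
  unfolding DSV_def bounded_in_L0_def
proof (intro allI impI)
  fix \<epsilon> :: real assume \<epsilon>: "0 < \<epsilon>"
  \<comment> \<open>On \<open>A n\<close> the product of Xh and Y is at least 1/(n+1) at all dyadic
    times close to \<open>T\<close>. The restriction to dyadics makes this an event, and positivity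
    of the limit inferior makes these events exhaust almost all outcomes.\<close>
  define A where "A n = {x\<in>space M. \<forall>q\<in>dyadics. ereal q < T x \<longrightarrow>
      real n \<le> q \<or> T x \<le> ereal (q + 1 / real (Suc n)) \<longrightarrow> 1 / real (Suc n) \<le> Xh q x * Y q x}" for n
  have Tm[measurable]: "Measurable.pred M (\<lambda>x. ereal u < T x)" if "0 \<le> u" for u
    using sets_F_M[OF T_stopping_time[OF that]] by (simp add: pred_def)
  have Zm[measurable]: "(\<lambda>x. Xh q x * Y q x) \<in> borel_measurable M" if "0 \<le> q" for q
    using process_measurable(2)[OF Xh_in that] Yad that measurable_F_M unfolding adapted_def by (intro borel_measurable_times) auto
  have Am: "A n \<in> sets M" for n
  proof -
    let ?A = "\<lambda>q. {x\<in>space M. ereal q < T x \<longrightarrow>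
      real n \<le> q \<or> \<not> ereal (q + 1 / real (Suc n)) < T x \<longrightarrow> 1 / real (Suc n) \<le> Xh q x * Y q x}"
    have "A n = (\<Inter>q\<in>dyadics. ?A q)"
      using nat_dyadic by (auto simp: A_def not_less)
    also have "\<dots> \<in> sets M"
    proof (rule sets.countable_INT')
      show "?A ` dyadics \<subseteq> sets M"
      proof (rule image_subsetI)
        fix q assume "q \<in> dyadics"
        then have q: "0 \<le> q" by (rule dyadics_nonneg)
        have q': "0 \<le> q + 1 / real (Suc n)" using q by simp
        note [measurable] = Tm[OF q] Tm[OF q'] Zm[OF q]
        show "?A q \<in> sets M" by measurable
      qed
    qed (use countable_dyadics nat_dyadic in auto)
    finally show ?thesis .
  qed
  have Ainc: "incseq A"
    unfolding incseq_def
  proof (intro allI impI subsetI)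
    fix m n x assume mn: "m \<le> n" and w: "x \<in> A m"
    have r: "1 / real (Suc n) \<le> 1 / real (Suc m)" using mn by (intro divide_left_mono) auto
    have "1 / real (Suc n) \<le> Xh q x * Y q x" if "q \<in> dyadics" "ereal q < T x"
        "real n \<le> q \<or> T x \<le> ereal (q + 1 / real (Suc n))" for q
    proof -
      have "ereal (q + 1 / real (Suc n)) \<le> ereal (q + 1 / real (Suc m))" using r by simp
      then have "real m \<le> q \<or> T x \<le> ereal (q + 1 / real (Suc m))"
        using that(3) mn by (meson of_nat_mono order_trans)
      then show ?thesis using w that(1,2) r unfolding A_def by (auto intro: order_trans)
    qed
    then show "x \<in> A n" using w by (simp add: A_def)
  qed
  have AE_A: "AE x in M. x \<in> (\<Union>n. A n)"
    using lim AE_space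
  proof eventually_elim
    case (elim x)
    then show ?case
      using left_liminf_pos_imp_bounded_below[OF elim(1) first_zero_nonneg] dyadics_nonneg by (auto simp: A_def)
  qed
  have "(\<lambda>n. prob (A n)) \<longlonglongrightarrow> prob (\<Union>n. A n)" using Am Ainc by (intro finite_Lim_measure_incseq) auto
  moreover have "prob (\<Union>n. A n) = 1" using AE_A Am by (subst prob_eq_1) auto
  ultimately have "\<forall>\<^sub>F n in sequentially. 1 - \<epsilon> / 2 < prob (A n)" using \<epsilon> by (intro order_tendstoD(1)) auto
  then obtain n where n: "1 - \<epsilon> / 2 < prob (A n)" by (auto simp: eventually_sequentially)
  \<comment> \<open>Every X starts at 1, so K is the initial expectation of XY for all X at once.
    The level \<kappa> turns the maximal inequality into the bound \<epsilon>/2; the absolute value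
    makes it positive without a discussion of the sign of K.\<close>
  define K where "K = (\<integral>x. Y 0 x \<partial>M)"
  define \<kappa> where "\<kappa> = 2 * (\<bar>K\<bar> + 1) / \<epsilon>"
  have \<kappa>: "0 < \<kappa>" using \<epsilon> by (simp add: \<kappa>_def)
  obtain N0 where N0: "N0 \<in> null_sets M" "{x\<in>space M. \<not> 0 < T x} \<subseteq> N0"
    using T_pos by (auto simp: eventually_ae_filter)
  show "\<exists>c::real. \<forall>\<xi>\<in>limit_ratio ` \<X>.
      \<exists>N\<in>sets M. {x\<in>space M. ereal c < \<bar>\<xi> x\<bar>} \<subseteq> N \<and> prob N \<le> \<epsilon>"
  \<comment> \<open>Outside a set of probability at most \<epsilon>, the ratio at dyadic times near
    \<open>T\<close> is XY \<le> \<kappa> divided by a number that is at least 1/(n+1).\<close>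
  proof (intro exI[of _ "\<kappa> * real (Suc n)"] ballI)
    fix \<xi> assume "\<xi> \<in> limit_ratio ` \<X>"
    then obtain X where X: "X \<in> \<X>" and \<xi>: "\<xi> = limit_ratio X" by auto
    define B where "B = {x\<in>space M. \<exists>q\<in>dyadics. ereal q < T x \<and> \<kappa> \<le> X q x * Y q x}"
    have SX: "supermartingale M F (\<lambda>t x. X t x * Y t x)" using SMD X by (simp add: SMD_def)
    have rc: "as_right_continuous M (\<lambda>t x. X t x * Y t x)"
      using process_right_continuous[OF X] Yrc unfolding as_right_continuous_def
      by eventually_elim (auto intro: tendsto_mult)
    have zero: "AE x in M. \<forall>t. T x = ereal t \<longrightarrow>
        X t x * Y t x = 0 \<and> ((\<lambda>s. X s x * Y s x) \<longlongrightarrow> 0) (at_right t)"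
      using T_attained rc[unfolded as_right_continuous_def] AE_space
    proof eventually_elim
      case (elim x)
      show ?case
      proof (intro allI impI)
        fix t assume t: "T x = ereal t"
        then have t0: "0 \<le> t" using first_zero_nonneg[of Xh x] by simp
        then have "X t x = 0" using dominated[OF X] elim t by simp
        then show "X t x * Y t x = 0 \<and> ((\<lambda>s. X s x * Y s x) \<longlongrightarrow> 0) (at_right t)"
          using elim(2) t0 by force
      qed
    qed
    have nn: "0 \<le> X t x * Y t x" if "x \<in> space M" "0 \<le> t" "ereal t < T x" for t x
      using process_nonneg[OF X] Ypos that by (intro mult_nonneg_nonneg) (auto intro: less_imp_le)
    note mi = supermartingale_maximal_inequality_before[OF SX T_stopping_time first_zero_nonneg nn zero \<kappa>, folded B_def]
    have "(\<integral>x. X 0 x * Y 0 x \<partial>M) = K"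
      unfolding K_def using process_0[OF X] by (intro Bochner_Integration.integral_cong) auto
    then have "prob B \<le> (K + 1) / \<kappa>" using mi(2) by simp
    also have "\<dots> \<le> (\<bar>K\<bar> + 1) / \<kappa>" using \<kappa> by (intro divide_right_mono) auto
    also have "\<dots> = \<epsilon> / 2" unfolding \<kappa>_def using \<epsilon> by (simp add: field_simps)
    finally have PB: "prob B \<le> \<epsilon> / 2" .
    show "\<exists>N\<in>sets M. {x\<in>space M. ereal (\<kappa> * real (Suc n)) < \<bar>\<xi> x\<bar>} \<subseteq> N \<and> prob N \<le> \<epsilon>"
    proof (intro bexI[of _ "(space M - A n) \<union> B \<union> N0"] conjI subsetI)
      have "prob ((space M - A n) \<union> B \<union> N0) \<le> prob ((space M - A n) \<union> B) + prob N0"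
        using Am mi(1) N0(1) by (intro measure_Un_le) auto
      also have "prob ((space M - A n) \<union> B) \<le> prob (space M - A n) + prob B"
        using Am mi(1) by (intro measure_Un_le) auto
      also have "prob (space M - A n) = 1 - prob (A n)" using Am by (rule prob_compl)
      also have "prob N0 = 0" using N0(1) by (simp add: measure_eq_0_null_sets)
      finally show "prob ((space M - A n) \<union> B \<union> N0) \<le> \<epsilon>" using n PB by simp
      show "(space M - A n) \<union> B \<union> N0 \<in> sets M" using Am mi(1) N0(1) by auto
    next
      fix x assume w: "x \<in> {x\<in>space M. ereal (\<kappa> * real (Suc n)) < \<bar>\<xi> x\<bar>}"
      show "x \<in> (space M - A n) \<union> B \<union> N0"
      proof (rule ccontr)
        assume "x \<notin> (space M - A n) \<union> B \<union> N0"
        then have wA: "x \<in> A n" and wB: "x \<notin> B" and wT: "0 < T x" and ws: "x \<in> space M" using w N0(2) by auto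
        have "limit_ratio X x \<le> ereal (\<kappa> * real (Suc n))"
        proof (rule left_liminf_le[OF wT])
          fix q assume q: "q \<in> dyadics" "ereal q < T x" "real n \<le> q \<or> T x \<le> ereal (q + 1 / real (Suc n))"
          have q0: "0 \<le> q" using q(1) by (rule dyadics_nonneg)
          have Z: "1 / real (Suc n) \<le> Xh q x * Y q x" using wA q by (auto simp: A_def)
          have S: "X q x * Y q x \<le> \<kappa>" using wB q ws by (force simp: B_def)
          have pos: "0 < Xh q x" "0 < Y q x" using Xh_pos[OF q0 ws q(2)] Ypos[OF ws q0 q(2)] by auto
          have "ratio (X q x) (Xh q x) = (X q x * Y q x) / (Xh q x * Y q x)" using pos by (simp add: ratio_def)
          also have "\<dots> \<le> \<kappa> / (1 / real (Suc n))"
            using S Z \<kappa> by (intro frac_le) auto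
          finally show "ratio (X q x) (Xh q x) \<le> \<kappa> * real (Suc n)" by simp
        qed
        moreover have "0 \<le> limit_ratio X x"
        proof -
          have r: "0 \<le> ratio (X t x) (Xh t x)" if "0 \<le> t" for t
            using process_nonneg[OF X that ws] process_nonneg[OF Xh_in that ws] by (simp add: ratio_def)
          have "\<forall>\<^sub>F t in at_top. 0 \<le> ereal (ratio (X t x) (Xh t x))"
            using eventually_ge_at_top[of "0::real"] by eventually_elim (simp add: r)
          moreover have "\<forall>\<^sub>F t in at (real_of_ereal (T x)) within {0..<real_of_ereal (T x)}. 0 \<le> ereal (ratio (X t x) (Xh t x))"
            unfolding eventually_at using r by (intro exI[of _ 1]) auto
          ultimately show ?thesis by (auto simp: left_liminf_def intro!: Liminf_bounded)
        qed
        ultimately show False using w by (auto simp: \<xi> abs_of_nonneg)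
      qed
    qed
  qed
qed

section \<open>From dynamic share viability to a deflator\<close>

lemma process_convex:
  assumes "X \<in> \<X>" "X' \<in> \<X>" "0 \<le> a" "a \<le> 1"
  obtains V where "V \<in> \<X>" "\<And>t x. 0 \<le> t \<Longrightarrow> x \<in> space M \<Longrightarrow> V t x = (1 - a) * X t x + a * X' t x"
proof -
  have "in_procs M (\<lambda>t x. (1 - a) * X t x + a * X' t x) \<X>"
    using SPD assms by (simp add: SPD_def set_of_processes_def)
  then show thesis using that by (auto simp: in_procs_def same_process_def)
qed

lemma process_concat:
  assumes "0 \<le> t" "A \<in> sets (F t)" "X \<in> \<X>" "X' \<in> \<X>" "\<And>x. x \<in> A \<Longrightarrow> X' t x = 0 \<Longrightarrow> X t x = 0"
  obtains V where "V \<in> \<X>" "\<And>s x. 0 \<le> s \<Longrightarrow> x \<in> space M \<Longrightarrow> V s x = concat_proc A t X X' s x"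
proof -
  have "in_procs M (concat_proc A t X X') \<X>"
    using SPD assms by (simp add: SPD_def set_of_processes_def)
  then show thesis using that by (auto simp: in_procs_def same_process_def)
qed

text \<open>Domination near T, rather than at a fixed time, puts payoffs attained at different times into one
  convex set.\<close>

definition payoff :: "(real \<Rightarrow> 'a \<Rightarrow> real) \<Rightarrow> ('a \<Rightarrow> real) \<Rightarrow> bool" where
  "payoff X f \<longleftrightarrow> f \<in> borel_measurable M \<and> (\<forall>x\<in>space M. 0 \<le> f x \<and>
     (\<exists>s. ereal s < T x \<and> (\<forall>v. 0 \<le> v \<longrightarrow> s \<le> v \<longrightarrow> ereal v < T x \<longrightarrow> f x * Xh v x \<le> X v x)))"

lemma payoffD:
  assumes "payoff X f"
  shows "f \<in> borel_measurable M" "x \<in> space M \<Longrightarrow> 0 \<le> f x"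
    "x \<in> space M \<Longrightarrow> \<exists>s. ereal s < T x \<and> (\<forall>v. 0 \<le> v \<longrightarrow> s \<le> v \<longrightarrow> ereal v < T x \<longrightarrow> f x * Xh v x \<le> X v x)"
  using assms by (auto simp: payoff_def)

text \<open>The witness -1 for the starting time of a domination precedes \<open>T\<close> even
  where \<open>T\<close> is 0, and it excludes no time v \<ge> 0.\<close>

lemma negative_before_T: "ereal (-1) < T x"
  using first_zero_nonneg[of Xh x] by (rule less_le_trans[rotated]) simp

lemma payoff_le_left_liminf:
  assumes X: "payoff X f" and w: "x \<in> space M"
  shows "ereal (f x) \<le> limit_ratio X x"
proof -
  obtain s where s: "ereal s < T x" "\<And>v. 0 \<le> v \<Longrightarrow> s \<le> v \<Longrightarrow> ereal v < T x \<Longrightarrow> f x * Xh v x \<le> X v x"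
    using payoffD(3)[OF X w] by blast
  have le: "f x \<le> ratio (X v x) (Xh v x)" if "0 \<le> v" "s \<le> v" "ereal v < T x" for v
  proof -
    have "0 < Xh v x" using Xh_pos that w by blast
    then show ?thesis using s(2)[OF that] by (simp add: ratio_def pos_le_divide_eq)
  qed
  show ?thesis
  proof (cases "T x")
    case (real t)
    have "\<forall>\<^sub>F v in at t within {0..<t}. ereal (f x) \<le> ereal (ratio (X v x) (Xh v x))"
      unfolding eventually_at using s(1) real le
      by (intro exI[of _ "t - s"]) (auto simp: dist_real_def)
    then show ?thesis using real by (simp add: left_liminf_def Liminf_bounded)
  next
    case PInf
    have "\<forall>\<^sub>F v in at_top. ereal (f x) \<le> ereal (ratio (X v x) (Xh v x))"
      using eventually_ge_at_top[of "max s 0"] by eventually_elim (use PInf le in simp)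
    then show ?thesis using PInf by (simp add: left_liminf_def Liminf_bounded)
  qed (use first_zero_nonneg[of Xh x] in simp)
qed

lemma payoff_convex:
  assumes f: "payoff X f" and f': "payoff X' f'" and a: "0 \<le> a" "a \<le> 1"
    and V: "\<And>t x. 0 \<le> t \<Longrightarrow> x \<in> space M \<Longrightarrow> V t x = (1 - a) * X t x + a * X' t x"
  shows "payoff V (\<lambda>x. (1 - a) * f x + a * f' x)"
  unfolding payoff_def
proof (intro conjI ballI)
  show "(\<lambda>x. (1 - a) * f x + a * f' x) \<in> borel_measurable M" using payoffD(1)[OF f] payoffD(1)[OF f'] by simp
  fix x assume w: "x \<in> space M"
  show "0 \<le> (1 - a) * f x + a * f' x" using payoffD(2)[OF f w] payoffD(2)[OF f' w] a by simp
  obtain s s' where s: "ereal s < T x" "\<And>v. 0 \<le> v \<Longrightarrow> s \<le> v \<Longrightarrow> ereal v < T x \<Longrightarrow> f x * Xh v x \<le> X v x"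
    and s': "ereal s' < T x" "\<And>v. 0 \<le> v \<Longrightarrow> s' \<le> v \<Longrightarrow> ereal v < T x \<Longrightarrow> f' x * Xh v x \<le> X' v x"
    using payoffD(3)[OF f w] payoffD(3)[OF f' w] by blast
  show "\<exists>s. ereal s < T x \<and> (\<forall>v. 0 \<le> v \<longrightarrow> s \<le> v \<longrightarrow> ereal v < T x \<longrightarrow> ((1 - a) * f x + a * f' x) * Xh v x \<le> V v x)"
  proof (intro exI[of _ "max s s'"] conjI allI impI)
    show "ereal (max s s') < T x" using s s' by (simp add: max_def)
    fix v assume v: "0 \<le> v" "max s s' \<le> v" "ereal v < T x"
    have "(1 - a) * (f x * Xh v x) + a * (f' x * Xh v x) \<le> (1 - a) * X v x + a * X' v x"
      using v a s(2)[of v] s'(2)[of v] by (intro add_mono mult_left_mono) auto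
    then show "((1 - a) * f x + a * f' x) * Xh v x \<le> V v x" using V[OF v(1) w] by (simp add: algebra_simps)
  qed
qed

text \<open>Payoffs are measurable and lie below the limit ratio, so the outer bounds in
  \<open>DSV\<close> become bounds on genuine probabilities. Convexity of the set of processes makes
  the payoffs of all processes together a convex set.\<close>

lemma DSV_imp_payoffs_L1_bounded:
  assumes DSV: "DSV M \<X> Xh"
  obtains g where "g \<in> borel_measurable M" "\<And>x. x \<in> space M \<Longrightarrow> 0 < g x"
    "\<And>X f. X \<in> \<X> \<Longrightarrow> payoff X f \<Longrightarrow> (\<integral>\<^sup>+x. ennreal (g x * f x) \<partial>M) \<le> 1"
proof -
  define C where "C = {f. \<exists>X\<in>\<X>. payoff X f}"
  have "\<exists>g\<in>borel_measurable M. (\<forall>x\<in>space M. 0 < g x) \<and> (\<forall>f\<in>C. (\<integral>\<^sup>+x. ennreal (g x * f x) \<partial>M) \<le> 1)"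
  proof (rule convex_L0_bounded_imp_L1_bounded)
    have "payoff Xh (\<lambda>_. 0)"
      unfolding payoff_def using negative_before_T process_nonneg[OF Xh_in] by auto
    then show "C \<noteq> {}" using Xh_in by (auto simp: C_def)
    show "f \<in> borel_measurable M" if "f \<in> C" for f using that payoffD(1) by (auto simp: C_def)
    show "0 \<le> f x" if "f \<in> C" "x \<in> space M" for f x using that payoffD(2) by (auto simp: C_def)
    fix f f' and a :: real assume "f \<in> C" "f' \<in> C" and a: "0 \<le> a" "a \<le> 1"
    then obtain X X' where X: "X \<in> \<X>" "payoff X f" "X' \<in> \<X>" "payoff X' f'" by (auto simp: C_def)
    obtain V where V: "V \<in> \<X>" "\<And>t x. 0 \<le> t \<Longrightarrow> x \<in> space M \<Longrightarrow> V t x = (1 - a) * X t x + a * X' t x"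
      using process_convex[OF X(1,3) a] by blast
    show "(\<lambda>x. (1 - a) * f x + a * f' x) \<in> C"
      using payoff_convex[OF X(2,4) a V(2)] V(1) by (auto simp: C_def)
  next
    fix \<epsilon> :: real assume "0 < \<epsilon>"
    have D: "\<forall>\<epsilon>>0. \<exists>c::real. \<forall>X\<in>\<X>. \<exists>N\<in>sets M.
        {x\<in>space M. ereal c < \<bar>limit_ratio X x\<bar>} \<subseteq> N \<and> prob N \<le> \<epsilon>"
      using DSV unfolding DSV_def bounded_in_L0_def by simp
    obtain c :: real where c: "\<forall>X\<in>\<X>. \<exists>N\<in>sets M.
        {x\<in>space M. ereal c < \<bar>limit_ratio X x\<bar>} \<subseteq> N \<and> prob N \<le> \<epsilon>"
      using D[THEN spec, THEN mp, OF \<open>0 < \<epsilon>\<close>] by (rule exE)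
    have "prob {x\<in>space M. c < f x} \<le> \<epsilon>" if fC: "f \<in> C" for f
    proof -
      obtain X where X: "X \<in> \<X>" "payoff X f" using fC by (auto simp: C_def)
      obtain N where N: "N \<in> sets M" "{x\<in>space M. ereal c < \<bar>limit_ratio X x\<bar>} \<subseteq> N" "prob N \<le> \<epsilon>"
        using c[THEN bspec, OF X(1)] by blast
      have "{x\<in>space M. c < f x} \<subseteq> N"
      proof
        fix x assume w: "x \<in> {x\<in>space M. c < f x}"
        then have "ereal c < ereal (f x)" by simp
        also have "\<dots> \<le> limit_ratio X x" using payoff_le_left_liminf[OF X(2)] w by auto
        also have "x \<le> \<bar>x\<bar>" for x :: ereal by (cases x) auto
        finally show "x \<in> N" using w N(2) by auto
      qed
      then show ?thesis using finite_measure_mono[OF _ N(1)] N(3) by (meson order_trans)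
    qed
    then show "\<exists>c. \<forall>f\<in>C. prob {x\<in>space M. c < f x} \<le> \<epsilon>" by blast
  qed
  then show thesis using that by (auto simp: C_def)
qed

text \<open>Agreement with \<open>Xh\<close> at time t normalises R to 1 there, so that such a
  process can be attached to any X at time t with factor X/Xh. Setting f to 0 where \<open>T\<close>
  \<le> t matches a value process that vanishes from \<open>T\<close> on.\<close>

definition payoffs_from :: "real \<Rightarrow> ('a \<Rightarrow> real) set" where
  "payoffs_from t = {f. (\<exists>X\<in>\<X>. payoff X f \<and> (\<forall>x\<in>space M. X t x = Xh t x)) \<and> (\<forall>x\<in>space M. T x \<le> ereal t \<longrightarrow> f x = 0)}"

lemma payoffI_from:
  assumes V: "V \<in> \<X>" and f: "f \<in> borel_measurable M" "\<And>x. x \<in> space M \<Longrightarrow> 0 \<le> f x"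
    and 0: "\<And>x. x \<in> space M \<Longrightarrow> T x \<le> ereal t \<Longrightarrow> f x = 0"
    and le: "\<And>x. x \<in> space M \<Longrightarrow> ereal t < T x \<Longrightarrow> \<exists>s. ereal s < T x \<and>
      (\<forall>v. 0 \<le> v \<longrightarrow> s \<le> v \<longrightarrow> t \<le> v \<longrightarrow> ereal v < T x \<longrightarrow> f x * Xh v x \<le> V v x)"
  shows "payoff V f"
  unfolding payoff_def
proof (intro conjI ballI f)
  fix x assume w: "x \<in> space M"
  show "\<exists>s. ereal s < T x \<and> (\<forall>v. 0 \<le> v \<longrightarrow> s \<le> v \<longrightarrow> ereal v < T x \<longrightarrow> f x * Xh v x \<le> V v x)"
  proof (cases "ereal t < T x")
    case True
    then obtain s where "ereal s < T x" "\<forall>v. 0 \<le> v \<longrightarrow> s \<le> v \<longrightarrow> t \<le> v \<longrightarrow> ereal v < T x \<longrightarrow> f x * Xh v x \<le> V v x"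
      using le[OF w] by blast
    then show ?thesis using True by (intro exI[of _ "max s t"]) (simp add: max_def)
  next
    case False
    then show ?thesis using 0[OF w] negative_before_T process_nonneg[OF V _ w] by (intro exI[of _ "-1"]) auto
  qed
qed

text \<open>Both processes agree with \<open>Xh\<close> at t, so concatenating them on A multiplies
  by 1; by the convention 0/0 = 1 this includes the outcomes where they vanish.\<close>

lemma payoffs_from_paste:
  assumes t: "0 \<le> t" and A: "A \<in> sets (F t)" and f: "f \<in> payoffs_from t" and h: "h \<in> payoffs_from t"
  shows "(\<lambda>x. if x \<in> A then f x else h x) \<in> payoffs_from t"
proof -
  obtain X1 where X1: "X1 \<in> \<X>" "payoff X1 f" "\<And>x. x \<in> space M \<Longrightarrow> X1 t x = Xh t x"
    using f by (auto simp: payoffs_from_def)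
  obtain X2 where X2: "X2 \<in> \<X>" "payoff X2 h" "\<And>x. x \<in> space M \<Longrightarrow> X2 t x = Xh t x"
    using h by (auto simp: payoffs_from_def)
  have AM: "A \<in> sets M" using A by (rule sets_F_M)
  then have Asp: "A \<subseteq> space M" by (rule sets.sets_into_space)
  have "X2 t x = 0" if "x \<in> A" "X1 t x = 0" for x using that X1(3) X2(3) Asp by auto
  then obtain V where V: "V \<in> \<X>" "\<And>s x. 0 \<le> s \<Longrightarrow> x \<in> space M \<Longrightarrow> V s x = concat_proc A t X2 X1 s x"
    using process_concat[OF t A X2(1) X1(1)] by blast
  have V1: "V v x = (if x \<in> A then X1 v x else X2 v x)" if "t \<le> v" "x \<in> space M" for v x
    using V(2)[of v x] that t X1(3) X2(3) by (auto simp: concat_proc_def ratio_def)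
  have 0: "(if x \<in> A then f x else h x) = 0" if "x \<in> space M" "T x \<le> ereal t" for x
    using f h that by (auto simp: payoffs_from_def)
  have "payoff V (\<lambda>x. if x \<in> A then f x else h x)"
  proof (rule payoffI_from[OF V(1), of _ t])
    show "(\<lambda>x. if x \<in> A then f x else h x) \<in> borel_measurable M"
      using AM payoffD(1)[OF X1(2)] payoffD(1)[OF X2(2)] by (intro measurable_If_set) auto
    show "0 \<le> (if x \<in> A then f x else h x)" if "x \<in> space M" for x
      using payoffD(2)[OF X1(2) that] payoffD(2)[OF X2(2) that] by simp
    show "\<exists>s. ereal s < T x \<and> (\<forall>v. 0 \<le> v \<longrightarrow> s \<le> v \<longrightarrow> t \<le> v \<longrightarrow> ereal v < T x \<longrightarrow>
        (if x \<in> A then f x else h x) * Xh v x \<le> V v x)" if w: "x \<in> space M" "ereal t < T x" for x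
      using payoffD(3)[OF X1(2) w(1)] payoffD(3)[OF X2(2) w(1)] V1[OF _ w(1)] by (cases "x \<in> A") (simp, metis)+
  qed (rule 0)
  moreover have "V t x = Xh t x" if "x \<in> space M" for x using V1[OF order_refl that] X1(3) X2(3) that by simp
  ultimately show ?thesis using V(1) 0 by (auto simp: payoffs_from_def)
qed

text \<open>Realised by \<open>Xh\<close> itself, for which R is 1 before \<open>T\<close>. This
  payoff later bounds the value process from below by conditional expectations of g.\<close>

lemma indicator_payoff:
  assumes t: "0 \<le> t"
  shows "(\<lambda>x. indicator {x\<in>space M. ereal t < T x} x) \<in> payoffs_from t"
proof -
  have "payoff Xh (\<lambda>x. indicator {x\<in>space M. ereal t < T x} x)"
    by (rule payoffI_from[OF Xh_in, of _ t])
      (use sets_F_M[OF T_stopping_time[OF t]] negative_before_T in \<open>auto simp: not_less indicator_def\<close>)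
  then show ?thesis using Xh_in by (auto simp: payoffs_from_def)
qed

text \<open>Concatenating X until t with a strategy realising f, mixing with Xh to stay positive at s, and
  restarting from Xh at s.\<close>

lemma payoffs_from_shift:
  assumes X: "X \<in> \<X>" and st: "0 \<le> s" "s \<le> t" and f: "f \<in> payoffs_from t" and a: "0 < a" "a < 1"
  shows "(\<lambda>x. (1 - a) * (X t x / Xh t x) * f x / ((1 - a) * (X s x / Xh s x) + a)) \<in> payoffs_from s"
proof -
  \<comment> \<open>For v \<ge> t the restarted process is W multiplied by
    \<open>Xh s / W s\<close>, and W contains the fraction 1 - a of X continued after t by X' with
    factor X/Xh. Dividing \<open>W s\<close> = (1 - a) X + a Xh by \<open>Xh s\<close> yields the
    denominator.\<close>
  define k where "k x = (1 - a) * (X t x / Xh t x) * f x / ((1 - a) * (X s x / Xh s x) + a)" for x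
  have t: "0 \<le> t" using st by simp
  obtain X' where X': "X' \<in> \<X>" "payoff X' f" "\<And>x. x \<in> space M \<Longrightarrow> X' t x = Xh t x"
    using f by (auto simp: payoffs_from_def)
  have spF: "space M \<in> sets (F r)" for r using sets.top[of "F r"] by simp
  have "X t x = 0" if "x \<in> space M" "X' t x = 0" for x using dominated[OF X t that(1)] X'(3) that by simp
  then obtain V where V: "V \<in> \<X>" "\<And>v x. 0 \<le> v \<Longrightarrow> x \<in> space M \<Longrightarrow> V v x = concat_proc (space M) t X X' v x"
    using process_concat[OF t spF X X'(1)] by blast
  obtain W where W: "W \<in> \<X>" "\<And>v x. 0 \<le> v \<Longrightarrow> x \<in> space M \<Longrightarrow> W v x = (1 - a) * V v x + a * Xh v x"
    using process_convex[OF V(1) Xh_in, of a] a by auto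
  have Ws: "W s x = (1 - a) * X s x + a * Xh s x" if "x \<in> space M" for x
    using W(2)[OF st(1) that] V(2)[OF st(1) that] st that by (simp add: concat_proc_def)
  have "Xh s x = 0" if "x \<in> space M" "W s x = 0" for x
  proof -
    have "0 \<le> (1 - a) * X s x" using process_nonneg[OF X st(1) that(1)] a by simp
    moreover have "0 \<le> a * Xh s x" using process_nonneg[OF Xh_in st(1) that(1)] a by simp
    ultimately show ?thesis using Ws[OF that(1)] that(2) a by (simp add: add_nonneg_eq_0_iff)
  qed
  then obtain U where U: "U \<in> \<X>" "\<And>v x. 0 \<le> v \<Longrightarrow> x \<in> space M \<Longrightarrow> U v x = concat_proc (space M) s Xh W v x"
    using process_concat[OF st(1) spF Xh_in W(1)] by blast
  have f0: "f x = 0" if "x \<in> space M" "T x \<le> ereal t" for x using f that by (auto simp: payoffs_from_def)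
  have R0: "0 \<le> X r x / Xh r x" if "0 \<le> r" "x \<in> space M" for r x
    using process_nonneg[OF X that] process_nonneg[OF Xh_in that] by simp
  have "payoff U k"
  proof (rule payoffI_from[OF U(1), of _ t])
    note [measurable] = process_measurable(2)[OF X st(1)] process_measurable(2)[OF X t]
      process_measurable(2)[OF Xh_in st(1)] process_measurable(2)[OF Xh_in t] payoffD(1)[OF X'(2)]
    show "k \<in> borel_measurable M" unfolding k_def by measurable
    show "0 \<le> k x" if "x \<in> space M" for x
    proof -
      have "0 \<le> (1 - a) * (X t x / Xh t x) * f x"
        using a by (intro mult_nonneg_nonneg[OF mult_nonneg_nonneg[OF _ R0[OF t that]] payoffD(2)[OF X'(2) that]]) simp
      moreover have "0 \<le> (1 - a) * (X s x / Xh s x) + a"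
        using a by (intro add_nonneg_nonneg mult_nonneg_nonneg[OF _ R0[OF st(1) that]]) auto
      ultimately show ?thesis unfolding k_def by (rule divide_nonneg_nonneg)
    qed
    show "k x = 0" if "x \<in> space M" "T x \<le> ereal t" for x using f0[OF that] by (simp add: k_def)
    fix x assume w: "x \<in> space M" and tT: "ereal t < T x"
    have sT: "ereal s < T x" using st tT by (meson ereal_less_eq(3) le_less_trans)
    have pos: "0 < Xh t x" "0 < Xh s x" using Xh_pos w t st tT sT by auto
    obtain r where r: "ereal r < T x" "\<And>v. 0 \<le> v \<Longrightarrow> r \<le> v \<Longrightarrow> ereal v < T x \<Longrightarrow> f x * Xh v x \<le> X' v x"
      using payoffD(3)[OF X'(2) w] by blast
    have "k x * Xh v x \<le> U v x" if v: "0 \<le> v" "r \<le> v" "t \<le> v" "ereal v < T x" for v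
    proof -
      have Wspos: "0 < W s x"
        unfolding Ws[OF w] using pos a process_nonneg[OF X st(1) w] by (intro add_nonneg_pos) auto
      have Vv: "V v x = X t x / Xh t x * X' v x"
        using V(2)[OF v(1) w] w v pos X'(3)[OF w] by (auto simp: concat_proc_def ratio_def)
      have Uv: "U v x = Xh s x / W s x * W v x"
      proof (cases "v = s")
        case True
        then show ?thesis using U(2)[OF v(1) w] w Wspos by (simp add: concat_proc_def)
      next
        case False
        then have "\<not> v \<le> s" using v st by simp
        then show ?thesis using U(2)[OF v(1) w] w Wspos by (simp add: concat_proc_def ratio_def)
      qed
      have kk: "k x = Xh s x / W s x * ((1 - a) * (X t x / Xh t x) * f x)"
      proof -
        have "(1 - a) * (X s x / Xh s x) + a = W s x / Xh s x"
          unfolding Ws[OF w] using pos by (simp add: field_simps)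
        then show ?thesis unfolding k_def by (simp add: ac_simps)
      qed
      have "(1 - a) * (X t x / Xh t x) * (f x * Xh v x) \<le> (1 - a) * (X t x / Xh t x) * X' v x"
        using r(2)[OF v(1,2,4)] R0[OF t w] a by (intro mult_left_mono mult_nonneg_nonneg) auto
      also have "\<dots> = (1 - a) * V v x" unfolding Vv by simp
      \<comment> \<open>The fraction a of \<open>Xh\<close> only had to keep \<open>W s\<close>
        positive; its contribution at time v is dropped.\<close>
      also have "\<dots> \<le> W v x"
        unfolding W(2)[OF v(1) w] using a process_nonneg[OF Xh_in v(1) w] by simp
      finally have "Xh s x / W s x * ((1 - a) * (X t x / Xh t x) * (f x * Xh v x)) \<le> U v x"
        unfolding Uv using pos Wspos by (intro mult_left_mono) auto
      then show ?thesis unfolding kk by (simp only: mult.assoc)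
    qed
    then show "\<exists>r. ereal r < T x \<and> (\<forall>v. 0 \<le> v \<longrightarrow> r \<le> v \<longrightarrow> t \<le> v \<longrightarrow> ereal v < T x \<longrightarrow> k x * Xh v x \<le> U v x)"
      using r(1) by blast
  qed
  moreover have "U s x = Xh s x" if "x \<in> space M" for x using U(2)[OF st(1) that] that by (simp add: concat_proc_def)
  moreover have "k x = 0" if "x \<in> space M" "T x \<le> ereal s" for x
  proof -
    have "T x \<le> ereal t" using that st by (meson ereal_less_eq(3) order_trans)
    then show ?thesis using f0 that by (simp add: k_def)
  qed
  ultimately have "k \<in> payoffs_from s" using U(1) by (auto simp: payoffs_from_def)
  then show ?thesis by (simp add: k_def[abs_def])
qed

text \<open>The process w dominates the conditional expectations of the strictly positive g, so stopping it
  when it falls below e shows that the g-weighted mass of this event is at most e.\<close>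

lemma bounded_below_before_T:
  assumes g[measurable]: "g \<in> borel_measurable M" and gpos: "\<And>x. x \<in> space M \<Longrightarrow> 0 < (g x :: real)"
    and w: "\<And>t. 0 \<le> t \<Longrightarrow> w t \<in> borel_measurable (F t)"
    and lower: "\<And>t A. 0 \<le> t \<Longrightarrow> A \<in> sets (F t) \<Longrightarrow> (\<integral>\<^sup>+x. ennreal (g x) * indicator (A \<inter> {x\<in>space M. ereal t < T x}) x \<partial>M)
        \<le> (\<integral>\<^sup>+x. ennreal (w t x) * indicator (A \<inter> {x\<in>space M. ereal t < T x}) x \<partial>M)"
  shows "AE x in M. \<exists>c>0. \<forall>q\<in>dyadics. ereal q < T x \<longrightarrow> c \<le> w q x"
proof -
  define \<mu> where "\<mu> = density M (\<lambda>x. ennreal (g x))"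
  have s\<mu>[simp, measurable_cong]: "sets \<mu> = sets M" by (simp add: \<mu>_def)
  have e\<mu>: "emeasure \<mu> A = (\<integral>\<^sup>+x. ennreal (g x) * indicator A x \<partial>M)" if "A \<in> sets M" for A
    unfolding \<mu>_def using that by (intro emeasure_density) auto
  define E where "E D e = {x\<in>space M. \<exists>q\<in>D. ereal q < T x \<and> w q x < e}" for D and e :: real
  let ?H = "\<lambda>q e. {x\<in>space M. ereal q < T x \<and> w q x < e}"
  have Eq: "?H q e \<in> sets (F q)" if "0 \<le> q" for q e
  proof -
    have "{x\<in>space (F q). w q x < e} \<in> sets (F q)" using w[OF that] by measurable
    then have "{x\<in>space M. ereal q < T x} \<inter> {x\<in>space M. w q x < e} \<in> sets (F q)"
      using T_stopping_time[OF that] by (intro sets.Int) simp_all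
    also have "{x\<in>space M. ereal q < T x} \<inter> {x\<in>space M. w q x < e} = ?H q e" by auto
    finally show ?thesis .
  qed
  have gd: "grid m \<subseteq> dyadics" for m by (auto simp: dyadics_def)
  have Em: "E D e \<in> sets M" if "D \<subseteq> dyadics" for D e
  proof -
    have "(\<Union>q\<in>D. ?H q e) \<in> sets M"
    proof (rule sets.countable_UN'')
      show "countable D" by (rule countable_subset[OF that countable_dyadics])
      show "?H q e \<in> sets M" if "q \<in> D" for q
        using sets_F_M[OF Eq] dyadics_nonneg \<open>D \<subseteq> dyadics\<close> that by blast
    qed
    also have "(\<Union>q\<in>D. ?H q e) = E D e" by (auto simp: E_def)
    finally show ?thesis .
  qed
  have grid_le: "emeasure \<mu> (E (grid m) e) \<le> ennreal e" if e: "0 < e" for m e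
  proof -
    let ?t = "\<lambda>i::nat. real i / 2 ^ m"
    define G where "G i = {x\<in>space M. ereal (?t i) < T x \<and> w (?t i) x < e}" for i
    have Gm: "G i \<in> sets (F (?t i))" for i unfolding G_def by (rule Eq) simp
    \<comment> \<open>\<open>disjointed G i\<close> is the event that i is the first grid index at
      which w is below e before \<open>T\<close>. It is known at that time, so \<open>lower\<close>
      applies to it; the events are disjoint, hence the bounds add up to at most e.\<close>
    have dm: "disjointed G i \<in> sets (F (?t i))" for i
    proof -
      have "G k \<in> sets (F (?t i))" if "k < i" for k
        by (rule sets_F_mono[OF _ _ Gm[of k]]) (use that in \<open>auto intro: divide_right_mono\<close>)
      then show ?thesis unfolding disjointed_def using Gm by (intro sets.Diff sets.finite_UN) auto
    qed
    have dM: "disjointed G i \<in> sets M" for i using sets_F_M[OF dm] .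
    have "emeasure \<mu> (disjointed G i) \<le> ennreal e * emeasure M (disjointed G i)" for i
    proof -
      have dG: "disjointed G i \<subseteq> G i" by (rule disjointed_subset)
      then have dT: "disjointed G i \<inter> {x\<in>space M. ereal (?t i) < T x} = disjointed G i" by (auto simp: G_def)
      have "emeasure \<mu> (disjointed G i) = (\<integral>\<^sup>+x. ennreal (g x) * indicator (disjointed G i) x \<partial>M)" using dM by (rule e\<mu>)
      also have "\<dots> \<le> (\<integral>\<^sup>+x. ennreal (w (?t i) x) * indicator (disjointed G i) x \<partial>M)"
        using lower[OF _ dm, of i] unfolding dT by simp
      also have "\<dots> \<le> (\<integral>\<^sup>+x. ennreal e * indicator (disjointed G i) x \<partial>M)"
        using dG by (intro nn_integral_mono) (auto simp: indicator_def G_def intro!: ennreal_leI)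
      also have "\<dots> = ennreal e * emeasure M (disjointed G i)" using dM by (simp add: nn_integral_cmult_indicator)
      finally show ?thesis .
    qed
    then have "(\<Sum>i. emeasure \<mu> (disjointed G i)) \<le> (\<Sum>i. ennreal e * emeasure M (disjointed G i))"
      by (intro suminf_le) auto
    also have "\<dots> = ennreal e * (\<Sum>i. emeasure M (disjointed G i))" by (rule ennreal_suminf_cmult)
    also have "(\<Sum>i. emeasure M (disjointed G i)) = emeasure M (\<Union>i. disjointed G i)"
      using dM by (intro suminf_emeasure disjoint_family_disjointed) auto
    also have "ennreal e * \<dots> \<le> ennreal e * 1" by (intro mult_left_mono emeasure_le_1) auto
    also have "(\<Sum>i. emeasure \<mu> (disjointed G i)) = emeasure \<mu> (\<Union>i. disjointed G i)"
      using dM by (intro suminf_emeasure disjoint_family_disjointed) auto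
    also have "(\<Union>i. disjointed G i) = E (grid m) e"
      unfolding UN_disjointed_eq by (auto simp: G_def E_def grid_def)
    finally show ?thesis by simp
  qed
  have E_le: "emeasure \<mu> (E dyadics e) \<le> ennreal e" if e: "0 < e" for e
  proof -
    have inc: "incseq (\<lambda>m. E (grid m) e)" unfolding incseq_def E_def using grid_mono by blast
    have "(\<Union>m. E (grid m) e) = E dyadics e" by (auto simp: E_def dyadics_def)
    then have "emeasure \<mu> (E dyadics e) = (SUP m. emeasure \<mu> (E (grid m) e))"
      using SUP_emeasure_incseq[OF _ inc, of \<mu>] Em[OF gd] by (simp add: image_subset_iff)
    also have "\<dots> \<le> ennreal e" by (intro SUP_least grid_le e)
    finally show ?thesis .
  qed
  define N where "N = (\<Inter>n. E dyadics (1 / real (Suc n)))"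
  have Nm: "N \<in> sets M" unfolding N_def using Em[OF order_refl] by (intro sets.countable_INT) auto
  have "emeasure \<mu> N \<le> ennreal (1 / real (Suc n))" for n
  proof -
    have "emeasure \<mu> N \<le> emeasure \<mu> (E dyadics (1 / real (Suc n)))" using Em[OF order_refl] by (intro emeasure_mono) (auto simp: N_def)
    also have "\<dots> \<le> ennreal (1 / real (Suc n))" by (rule E_le) simp
    finally show ?thesis .
  qed
  moreover have "(\<lambda>n. ennreal (1 / real (Suc n))) \<longlonglongrightarrow> ennreal 0" by (intro tendsto_ennrealI) real_asymp
  ultimately have "emeasure \<mu> N \<le> ennreal 0" by (intro LIMSEQ_le_const[of "\<lambda>n. ennreal (1 / real (Suc n))"]) auto
  \<comment> \<open>As g is strictly positive, a set of g-weighted mass 0 is a null set of the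
    original measure.\<close>
  then have "(\<integral>\<^sup>+x. ennreal (g x) * indicator N x \<partial>M) = 0" using e\<mu>[OF Nm] by simp
  then have "AE x in M. ennreal (g x) * indicator N x = 0" using Nm by (subst (asm) nn_integral_0_iff_AE) auto
  then show ?thesis using AE_space
  proof eventually_elim
    case (elim x)
    then have "x \<notin> N" using gpos[of x] by (auto simp: indicator_def)
    then obtain n where "x \<notin> E dyadics (1 / real (Suc n))" by (auto simp: N_def)
    then have "1 / real (Suc n) \<le> w q x" if "q \<in> dyadics" "ereal q < T x" for q using that elim(2) by (force simp: E_def)
    then show ?case by (intro exI[of _ "1 / real (Suc n)"]) auto
  qed
qed

text \<open>A payoff from t, multiplied by the growth factor of R from s to t, is nearly a payoff
  from s; comparing essential suprema gives the supermartingale property. The common bound 1 on the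
  expectations of g f makes w integrable.\<close>

lemma DSV_imp_value_process:
  assumes DSV: "DSV M \<X> Xh"
  obtains w where "\<And>t. 0 \<le> t \<Longrightarrow> w t \<in> borel_measurable (F t)" "\<And>t x. 0 \<le> w t x"
    "\<And>t x. x \<in> space M \<Longrightarrow> T x \<le> ereal t \<Longrightarrow> w t x = 0"
    "AE x in M. \<exists>c>0. \<forall>q\<in>dyadics. ereal q < T x \<longrightarrow> c \<le> w q x"
    "\<And>X. X \<in> \<X> \<Longrightarrow> supermartingale M F (\<lambda>t x. w t x * (X t x / Xh t x))"
proof -
  let ?J = "\<lambda>f \<xi>. \<integral>\<^sup>+x. f x * \<xi> x \<partial>M"
  obtain g where g[measurable]: "g \<in> borel_measurable M" and gpos: "\<And>x. x \<in> space M \<Longrightarrow> 0 < g x"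
    and g1: "\<And>X f. X \<in> \<X> \<Longrightarrow> payoff X f \<Longrightarrow> (\<integral>\<^sup>+x. ennreal (g x * f x) \<partial>M) \<le> 1"
    using DSV_imp_payoffs_L1_bounded[OF DSV] by blast
  have pm: "f \<in> borel_measurable M" "(\<integral>\<^sup>+x. ennreal (g x * f x) \<partial>M) \<le> 1" if "f \<in> payoffs_from t" for f t
    using that payoffD(1) g1 by (auto simp: payoffs_from_def)
  have p0: "f x = 0" if "f \<in> payoffs_from t" "x \<in> space M" "T x \<le> ereal t" for f t x
    using that by (auto simp: payoffs_from_def)
  define C where "C t = (\<lambda>f x. ennreal (g x * f x)) ` payoffs_from t" for t
  define Q where "Q t Z \<longleftrightarrow> Z \<in> borel_measurable (F t) \<and>
      (\<forall>f\<in>C t. \<forall>\<xi>\<in>borel_measurable (F t). ?J f \<xi> \<le> ?J Z \<xi>) \<and>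
      (\<forall>\<xi>\<in>borel_measurable (F t). ?J Z \<xi> \<le> (SUP f\<in>C t. \<integral>\<^sup>+x. f x * \<xi> x \<partial>M))" for t Z
  have "\<exists>Z. Q t Z" if t: "0 \<le> t" for t
    unfolding Q_def bex_simps(1)[symmetric] Bex_def[symmetric]
  proof (rule essential_supremum_of_pasting_family[OF subalg])
    show "C t \<noteq> {}" using indicator_payoff[OF t] by (auto simp: C_def)
    show "f \<in> borel_measurable M" if "f \<in> C t" for f using that pm(1) by (auto simp: C_def)
    show "(\<integral>\<^sup>+x. f x \<partial>M) \<le> 1" if "f \<in> C t" for f using that pm(2) by (auto simp: C_def)
    fix f h A assume "f \<in> C t" "h \<in> C t" and A: "A \<in> sets (F t)"
    then obtain f' h' where fh: "f' \<in> payoffs_from t" "h' \<in> payoffs_from t"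
        "f = (\<lambda>x. ennreal (g x * f' x))" "h = (\<lambda>x. ennreal (g x * h' x))" by (auto simp: C_def)
    have "(\<lambda>x. if x \<in> A then f x else h x) = (\<lambda>x. ennreal (g x * (if x \<in> A then f' x else h' x)))"
      by (auto simp: fh(3,4))
    then show "(\<lambda>x. if x \<in> A then f x else h x) \<in> C t"
      using payoffs_from_paste[OF t A fh(1,2)] by (auto simp: C_def)
  qed
  then obtain Z where ZQ: "\<And>t. 0 \<le> t \<Longrightarrow> Q t (Z t)" by metis
  have Z: "Z t \<in> borel_measurable (F t)" if "0 \<le> t" for t
    using ZQ[OF that] by (simp add: Q_def)
  have Zge: "?J f \<xi> \<le> ?J (Z t) \<xi>"
    if "0 \<le> t" "f \<in> C t" "\<xi> \<in> borel_measurable (F t)" for t f \<xi>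
    using ZQ[OF that(1)] that(2,3) by (simp add: Q_def)
  have Zle: "?J (Z t) \<xi> \<le> (SUP f\<in>C t. \<integral>\<^sup>+x. f x * \<xi> x \<partial>M)"
    if "0 \<le> t" "\<xi> \<in> borel_measurable (F t)" for t \<xi>
    using ZQ[OF that(1)] that(2) by (simp add: Q_def)
  define B where "B t = {x\<in>space M. ereal t < T x}" for t
  have Bm: "B t \<in> sets (F t)" if "0 \<le> t" for t unfolding B_def using T_stopping_time[OF that] .
  \<comment> \<open>A real version of Z: \<open>enn2real\<close> alters Z only where it is infinite,
    which is a null set, and the indicator makes w vanish from \<open>T\<close> on for every
    outcome.\<close>
  define w where "w t x = enn2real (Z t x) * indicator (B t) x" for t x
  have wm: "w t \<in> borel_measurable (F t)" if "0 \<le> t" for t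
    unfolding w_def[abs_def] using Z[OF that] Bm[OF that] by measurable
  have w0: "0 \<le> w t x" for t x by (simp add: w_def)
  have Zfin: "(\<integral>\<^sup>+x. Z t x \<partial>M) \<le> 1" if t: "0 \<le> t" for t
  proof -
    have "(\<integral>\<^sup>+x. Z t x * 1 \<partial>M) \<le> (SUP f\<in>C t. \<integral>\<^sup>+x. f x * 1 \<partial>M)" by (rule Zle[OF t]) simp
    also have "\<dots> \<le> 1" using pm(2) by (intro SUP_least) (auto simp: C_def)
    finally show ?thesis by simp
  qed
  have AEw: "AE x in M. ennreal (w t x) = Z t x * indicator (B t) x" if t: "0 \<le> t" for t
  proof -
    have "(\<integral>\<^sup>+x. Z t x \<partial>M) \<noteq> \<infinity>" using Zfin[OF t] by (auto simp: top_unique)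
    then have "AE x in M. Z t x \<noteq> \<infinity>" using measurable_F_M[OF Z[OF t]] by (intro nn_integral_PInf_AE)
    then show ?thesis by eventually_elim (simp add: w_def indicator_def less_top)
  qed
  let ?Jf = "\<lambda>f \<xi>. \<integral>\<^sup>+x. ennreal (g x * f x) * \<xi> x \<partial>M"
    and ?Jw = "\<lambda>t \<xi>. \<integral>\<^sup>+x. ennreal (w t x) * \<xi> x \<partial>M"
  \<comment> \<open>The two halves of the essential supremum property carried over to w:
    \<open>wge\<close> for a single payoff, \<open>wle\<close> for a common bound. The indicator
    does no harm since payoffs from t vanish where \<open>T\<close> \<le> t.\<close>
  have wge: "?Jf f \<xi> \<le> ?Jw t \<xi>"
    if t: "0 \<le> t" and f: "f \<in> payoffs_from t" and \<xi>: "\<xi> \<in> borel_measurable (F t)" for t f \<xi>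
  proof -
    have m: "(\<lambda>x. indicator (B t) x * \<xi> x) \<in> borel_measurable (F t)" using \<xi> Bm[OF t] by measurable
    have "?Jf f \<xi> = (\<integral>\<^sup>+x. ennreal (g x * f x) * (indicator (B t) x * \<xi> x) \<partial>M)"
      using p0[OF f] by (intro nn_integral_cong) (auto simp: B_def indicator_def not_less)
    also have "\<dots> \<le> (\<integral>\<^sup>+x. Z t x * (indicator (B t) x * \<xi> x) \<partial>M)"
      using f by (intro Zge[OF t _ m]) (auto simp: C_def)
    also have "\<dots> = ?Jw t \<xi>"
      by (rule nn_integral_cong_AE) (use AEw[OF t] in \<open>eventually_elim, simp add: mult.assoc\<close>)
    finally show ?thesis .
  qed
  have wle: "?Jw t \<xi> \<le> K"
    if t: "0 \<le> t" and \<xi>: "\<xi> \<in> borel_measurable (F t)"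
      and K: "\<And>f. f \<in> payoffs_from t \<Longrightarrow> ?Jf f \<xi> \<le> K" for t \<xi> K
  proof -
    have m: "(\<lambda>x. indicator (B t) x * \<xi> x) \<in> borel_measurable (F t)" using \<xi> Bm[OF t] by measurable
    have "?Jw t \<xi> = (\<integral>\<^sup>+x. Z t x * (indicator (B t) x * \<xi> x) \<partial>M)"
      by (rule nn_integral_cong_AE) (use AEw[OF t] in \<open>eventually_elim, simp add: mult.assoc\<close>)
    also have "\<dots> \<le> (SUP f\<in>C t. \<integral>\<^sup>+x. f x * (indicator (B t) x * \<xi> x) \<partial>M)" by (rule Zle[OF t m])
    also have "\<dots> \<le> K"
    proof (rule SUP_least)
      fix h assume "h \<in> C t"
      then obtain f where f: "f \<in> payoffs_from t" "h = (\<lambda>x. ennreal (g x * f x))" by (auto simp: C_def)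
      have "(\<integral>\<^sup>+x. h x * (indicator (B t) x * \<xi> x) \<partial>M) \<le> ?Jf f \<xi>"
        by (intro nn_integral_mono) (auto simp: f(2) indicator_def)
      also have "\<dots> \<le> K" by (rule K[OF f(1)])
      finally show "(\<integral>\<^sup>+x. h x * (indicator (B t) x * \<xi> x) \<partial>M) \<le> K" .
    qed
    finally show ?thesis .
  qed
  have w1: "(\<integral>\<^sup>+x. ennreal (w t x) \<partial>M) \<le> 1" if t: "0 \<le> t" for t
    using wle[OF t, of "\<lambda>_. 1" 1] pm(2) by simp
  have R0: "0 \<le> X r x / Xh r x" if "X \<in> \<X>" "0 \<le> r" "x \<in> space M" for X r x
    using process_nonneg[OF that] process_nonneg[OF Xh_in that(2,3)] by simp
  have Rm: "(\<lambda>x. X r x / Xh r x) \<in> borel_measurable (F r)" if "X \<in> \<X>" "0 \<le> r" for X r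
    using process_measurable(1)[OF that] process_measurable(1)[OF Xh_in that(2)] by measurable
  \<comment> \<open>By \<open>wle\<close> it suffices to treat one payoff f from t. Its shift k is a
    payoff from s and is compared with \<open>w s\<close> by \<open>wge\<close>.\<close>
  have key: "(\<integral>\<^sup>+x. ennreal (w t x) * (ennreal (X t x / Xh t x) * indicator A x) \<partial>M)
      \<le> (\<integral>\<^sup>+x. ennreal (w s x) * (ennreal (X s x / Xh s x) * indicator A x) \<partial>M)"
    if X: "X \<in> \<X>" and st: "0 \<le> s" "s \<le> t" and A: "A \<in> sets (F s)" for X s t A
  proof (rule wle)
    show t: "0 \<le> t" using st by simp
    have At: "A \<in> sets (F t)" using sets_F_mono[OF st A] .
    show "(\<lambda>x. ennreal (X t x / Xh t x) * indicator A x) \<in> borel_measurable (F t)"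
      using Rm[OF X t] At by measurable
    fix f assume f: "f \<in> payoffs_from t"
    let ?R = "\<lambda>r x. X r x / Xh r x"
    let ?L = "\<integral>\<^sup>+x. ennreal (g x * f x) * (ennreal (?R t x) * indicator A x) \<partial>M"
    let ?S = "\<integral>\<^sup>+x. ennreal (w s x) * (ennreal (?R s x) * indicator A x) \<partial>M"
    have f0: "0 \<le> f x" if "x \<in> space M" for x using f payoffD(2) that by (auto simp: payoffs_from_def)
    have [measurable]: "f \<in> borel_measurable M" "A \<in> sets M" "?R t \<in> borel_measurable M" "?R s \<in> borel_measurable M" "w s \<in> borel_measurable M"
      using pm(1)[OF f] sets_F_M[OF A] measurable_F_M[OF Rm[OF X t]] measurable_F_M[OF Rm[OF X st(1)]] measurable_F_M[OF wm[OF st(1)]] by auto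
    show "?L
        \<le> ?S"
    proof (rule ennreal_le_of_perturbed)
      fix a :: real assume a: "0 < a" "a < 1"
      define k where "k x = (1 - a) * ?R t x * f x / ((1 - a) * ?R s x + a)" for x
      have kP: "k \<in> payoffs_from s" using payoffs_from_shift[OF X st f a] by (simp add: k_def[abs_def])
      \<comment> \<open>The weight is the denominator of k, so that k times \<xi> is (1 - a) f times
        R at t, restricted to A. It is measurable at time s, as a test function has to be.\<close>
      let ?\<xi> = "\<lambda>x. ennreal ((1 - a) * ?R s x + a) * indicator A x"
      have "ennreal (1 - a) * ?L
          = (\<integral>\<^sup>+x. ennreal (1 - a) * (ennreal (g x * f x) * (ennreal (?R t x) * indicator A x)) \<partial>M)"
        by (rule nn_integral_cmult[symmetric]) measurable
      also have "\<dots> = (\<integral>\<^sup>+x. ennreal (g x * k x) * ?\<xi> x \<partial>M)"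
      proof (rule nn_integral_cong)
        fix x assume w: "x \<in> space M"
        have d: "0 < (1 - a) * ?R s x + a" using a R0[OF X st(1) w] by (intro add_nonneg_pos mult_nonneg_nonneg) auto
        have k0: "0 \<le> k x" using kP payoffD(2) w by (auto simp: payoffs_from_def)
        have "(1 - a) * ((g x * f x) * ?R t x) = (g x * k x) * ((1 - a) * ?R s x + a)"
          unfolding k_def using d by (simp add: less_imp_neq[THEN not_sym])
        then have "ennreal (1 - a) * (ennreal (g x * f x) * ennreal (?R t x)) = ennreal (g x * k x) * ennreal ((1 - a) * ?R s x + a)"
          using a gpos[OF w] f0[OF w] R0[OF X t w] k0 d by (simp add: ennreal_mult[symmetric] del: times_divide_eq_right times_divide_eq_left)
        then show "ennreal (1 - a) * (ennreal (g x * f x) * (ennreal (?R t x) * indicator A x)) = ennreal (g x * k x) * ?\<xi> x"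
          by (simp add: mult.assoc[symmetric])
      qed
      also have "\<dots> \<le> (\<integral>\<^sup>+x. ennreal (w s x) * ?\<xi> x \<partial>M)"
      proof (rule wge[OF st(1) kP])
        note [measurable] = process_measurable(1)[OF X st(1)] process_measurable(1)[OF Xh_in st(1)] A
        show "?\<xi> \<in> borel_measurable (F s)" by measurable
      qed
      also have "\<dots> \<le> (\<integral>\<^sup>+x. ennreal (w s x) * (ennreal (?R s x) * indicator A x) + ennreal a * ennreal (w s x) \<partial>M)"
      proof (rule nn_integral_mono)
        fix x assume w: "x \<in> space M"
        have "w s x * ((1 - a) * ?R s x + a) \<le> w s x * (?R s x + a)"
          using w0 R0[OF X st(1) w] a by (intro mult_left_mono add_right_mono mult_left_le_one_le) auto
        then have "ennreal (w s x * ((1 - a) * ?R s x + a)) \<le> ennreal (w s x * ?R s x + a * w s x)"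
          by (intro ennreal_leI) (simp add: algebra_simps)
        also have "\<dots> = ennreal (w s x) * ennreal (?R s x) + ennreal a * ennreal (w s x)"
          using w0 R0[OF X st(1) w] a by (simp add: ennreal_mult ennreal_plus del: times_divide_eq_right)
        finally have "ennreal (w s x) * ennreal ((1 - a) * ?R s x + a) \<le> ennreal (w s x) * ennreal (?R s x) + ennreal a * ennreal (w s x)"
          using w0 by (simp add: ennreal_mult'' ennreal_mult' del: times_divide_eq_right)
        then show "ennreal (w s x) * ?\<xi> x \<le> ennreal (w s x) * (ennreal (?R s x) * indicator A x) + ennreal a * ennreal (w s x)"
          by (auto simp: indicator_def)
      qed
      also have "\<dots> = ?S + ennreal a * (\<integral>\<^sup>+x. ennreal (w s x) \<partial>M)"
        by (subst nn_integral_add) (auto simp: nn_integral_cmult)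
      \<comment> \<open>The mixing costs a times the expectation of \<open>w s\<close>, which is at
        most 1, so the error vanishes with a.\<close>
      also have "\<dots> \<le> ?S + ennreal a * 1"
        using w1[OF st(1)] by (intro add_left_mono mult_left_mono) auto
      finally show "ennreal (1 - a) * ?L
          \<le> ?S + ennreal a" by simp
    qed
  qed
  have SM: "supermartingale M F (\<lambda>t x. w t x * (X t x / Xh t x))" if X: "X \<in> \<X>" for X
  proof (rule supermartingaleI_nn_integral)
    show "adapted F (\<lambda>t x. w t x * (X t x / Xh t x))"
      using wm Rm[OF X] by (auto simp: adapted_def simp del: times_divide_eq_right intro!: borel_measurable_times)
    show "0 \<le> w t x * (X t x / Xh t x)" if "0 \<le> t" "x \<in> space M" for t x
      using w0 R0[OF X that] by (rule mult_nonneg_nonneg)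
    have "(\<integral>\<^sup>+x. ennreal (w 0 x * (X 0 x / Xh 0 x)) \<partial>M) = (\<integral>\<^sup>+x. ennreal (w 0 x) \<partial>M)"
      by (intro nn_integral_cong) (simp add: process_0[OF X] process_0[OF Xh_in])
    also have "\<dots> \<le> 1" by (rule w1) simp
    finally show "(\<integral>\<^sup>+x. ennreal (w 0 x * (X 0 x / Xh 0 x)) \<partial>M) < \<infinity>" by (auto simp: less_top[symmetric] top_unique)
    fix s t :: real and A assume st: "0 \<le> s" "s \<le> t" and A: "A \<in> sets (F s)"
    have e: "(\<integral>\<^sup>+x. ennreal (w r x * (X r x / Xh r x)) * indicator A x \<partial>M)
        = (\<integral>\<^sup>+x. ennreal (w r x) * (ennreal (X r x / Xh r x) * indicator A x) \<partial>M)" if "0 \<le> r" for r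
      using R0[OF X that] w0 by (intro nn_integral_cong) (simp add: ennreal_mult mult.assoc del: times_divide_eq_right)
    show "(\<integral>\<^sup>+x. ennreal (w t x * (X t x / Xh t x)) * indicator A x \<partial>M)
        \<le> (\<integral>\<^sup>+x. ennreal (w s x * (X s x / Xh s x)) * indicator A x \<partial>M)"
      using key[OF X st A] e[of s] e[of t] st by simp
  qed
  have lower: "(\<integral>\<^sup>+x. ennreal (g x) * indicator (A \<inter> B t) x \<partial>M)
        \<le> (\<integral>\<^sup>+x. ennreal (w t x) * indicator (A \<inter> B t) x \<partial>M)" if t: "0 \<le> t" and A: "A \<in> sets (F t)" for t A
  proof -
    have "(\<integral>\<^sup>+x. ennreal (g x) * indicator (A \<inter> B t) x \<partial>M)
        = (\<integral>\<^sup>+x. ennreal (g x * indicator {x\<in>space M. ereal t < T x} x) * indicator (A \<inter> B t) x \<partial>M)"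
      by (intro nn_integral_cong) (auto simp: indicator_def B_def)
    also have "\<dots> \<le> (\<integral>\<^sup>+x. ennreal (w t x) * indicator (A \<inter> B t) x \<partial>M)"
    proof (rule wge[OF t indicator_payoff[OF t]])
      have "A \<inter> B t \<in> sets (F t)" using A Bm[OF t] by (rule sets.Int)
      then show "indicator (A \<inter> B t) \<in> borel_measurable (F t)" by (rule borel_measurable_indicator)
    qed
    finally show ?thesis .
  qed
  have wT: "w t x = 0" if "x \<in> space M" "T x \<le> ereal t" for t x
    using that by (simp add: w_def B_def not_less[symmetric])
  have "AE x in M. \<exists>c>0. \<forall>q\<in>dyadics. ereal q < T x \<longrightarrow> c \<le> w q x"
    using g gpos wm lower[unfolded B_def] by (rule bounded_below_before_T)
  from that[OF wm w0 wT this SM] show thesis .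
qed

lemma DSV_imp_deflator:
  assumes DSV: "DSV M \<X> Xh"
  shows "\<exists>Y. SMD M F \<X> Y \<and> adapted F Y \<and> as_right_continuous M Y \<and>
         (\<forall>x\<in>space M. \<forall>t\<ge>0. ereal t < T x \<longrightarrow> 0 < Y t x) \<and>
         (AE x in M. 0 < left_liminf (\<lambda>t. Xh t x * Y t x) (T x))"
proof -
  obtain w where w: "\<And>t. 0 \<le> t \<Longrightarrow> w t \<in> borel_measurable (F t)" and w0: "\<And>t x. 0 \<le> w t x"
    and wT: "\<And>t x. x \<in> space M \<Longrightarrow> T x \<le> ereal t \<Longrightarrow> w t x = 0"
    and lower: "AE x in M. \<exists>c>0. \<forall>q\<in>dyadics. ereal q < T x \<longrightarrow> c \<le> w q x"
    and SM: "\<And>X. X \<in> \<X> \<Longrightarrow> supermartingale M F (\<lambda>t x. w t x * (X t x / Xh t x))"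
    by (rule DSV_imp_value_process[OF DSV]) (rule that)
  define l where "l t x = lim (\<lambda>n. w (dyadic_above n t) x)" for t x
  \<comment> \<open>For X = Xh the quotient is 1 before \<open>T\<close>, and from \<open>T\<close>
    on w is 0. Hence w itself is the supermartingale belonging to \<open>Xh\<close>, and its right
    limits along the dyadics exist.\<close>
  have wXh: "w t x * (Xh t x / Xh t x) = w t x" if "0 \<le> t" "x \<in> space M" for t x
    using Xh_pos[OF that] wT[OF that(2), of t] by (cases "ereal t < T x") (auto simp: not_less)
  have AElim: "AE x in M. \<forall>t\<ge>0. ((\<lambda>q. w q x) \<longlongrightarrow> l t x) (right_dyadic t)"
  proof -
    have "AE x in M. \<forall>t\<ge>0. \<exists>c. ((\<lambda>q. w q x * (Xh q x / Xh q x)) \<longlongrightarrow> c) (right_dyadic t)"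
    proof (rule supermartingale_right_limits[OF SM[OF Xh_in]])
      show "0 \<le> w t x * (Xh t x / Xh t x)" if "0 \<le> t" "x \<in> space M" for t x using w0 by (simp add: wXh[OF that])
    qed
    then show ?thesis using AE_space
    proof eventually_elim
      case (elim x)
      show ?case
      proof (intro allI impI)
        fix t :: real assume t: "0 \<le> t"
        obtain c where c: "((\<lambda>q. w q x * (Xh q x / Xh q x)) \<longlongrightarrow> c) (right_dyadic t)" using elim(1) t by blast
        have "\<forall>\<^sub>F q in right_dyadic t. w q x * (Xh q x / Xh q x) = w q x"
        proof (rule eventually_mono[OF right_dyadic_eventually_less[of t "t + 1"]])
          show "w q x * (Xh q x / Xh q x) = w q x" if "t < q \<and> q < t + 1 \<and> q \<in> dyadics" for q
            using that elim(2) by (intro wXh dyadics_nonneg) auto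
        qed simp
        with c have c': "((\<lambda>q. w q x) \<longlongrightarrow> c) (right_dyadic t)" by (rule Lim_transform_eventually)
        then have "(\<lambda>n. w (dyadic_above n t) x) \<longlonglongrightarrow> c" using dyadic_above_filterlim[OF t] by (rule filterlim_compose)
        then have "l t x = c" unfolding l_def by (rule limI)
        then show "((\<lambda>q. w q x) \<longlongrightarrow> l t x) (right_dyadic t)" using c' by simp
      qed
    qed
  qed
  \<comment> \<open>One exceptional set for all times at once, so that l can be studied path by
    path.\<close>
  define good where "good x \<longleftrightarrow> (\<forall>t\<ge>0. ((\<lambda>q. w q x) \<longlongrightarrow> l t x) (right_dyadic t)) \<and>
    (\<exists>c>0. \<forall>q\<in>dyadics. ereal q < T x \<longrightarrow> c \<le> w q x)" for x
  have AEgood: "AE x in M. good x" using AElim lower by eventually_elim (simp add: good_def)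
  have near: "\<forall>\<^sub>F s in at_right t. ereal s < T x" if tT: "ereal t < T x" for t x
  proof -
    obtain u where u: "ereal t < ereal u" "ereal u < T x" using ereal_dense2[OF tT] by blast
    show ?thesis unfolding eventually_at_right_field
    proof (intro exI[of _ u] conjI allI impI)
      fix s assume "t < s" "s < u"
      then show "ereal s < T x" using u(2) by (meson less_ereal.simps(1) less_trans)
    qed (use u in simp)
  qed
  have good_lower: "\<exists>c>0. \<forall>t\<ge>0. ereal t < T x \<longrightarrow> c \<le> l t x" if good: "good x" for x
  proof -
    obtain c where c: "0 < c" "\<And>q. q \<in> dyadics \<Longrightarrow> ereal q < T x \<Longrightarrow> c \<le> w q x" using good by (auto simp: good_def)
    have "c \<le> l t x" if t: "0 \<le> t" "ereal t < T x" for t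
    proof (rule tendsto_lowerbound)
      show "((\<lambda>q. w q x) \<longlongrightarrow> l t x) (right_dyadic t)" using good t by (simp add: good_def)
      obtain u where u: "ereal t < ereal u" "ereal u < T x" using ereal_dense2[OF t(2)] by blast
      have "\<forall>\<^sub>F q in right_dyadic t. t < q \<and> q < u \<and> q \<in> dyadics" using u by (intro right_dyadic_eventually_less) simp
      then show "\<forall>\<^sub>F q in right_dyadic t. c \<le> w q x"
      proof eventually_elim
        case (elim q)
        then have "ereal q < T x" using u(2) by (meson less_ereal.simps(1) less_trans)
        then show ?case using c(2) elim by blast
      qed
      show "right_dyadic t \<noteq> bot" by (rule right_dyadic_nontrivial[OF t(1)])
    qed
    then show ?thesis using c(1) by blast
  qed
  have l_rc: "((\<lambda>s. l s x) \<longlongrightarrow> l t x) (at_right t)" if "good x" "0 \<le> t" for x t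
    by (rule right_limits_right_continuous[where N="t + 1" and x="\<lambda>q. w q x"]) (use that in \<open>auto simp: good_def\<close>)
  \<comment> \<open>Y is 0 from \<open>T\<close> on, whatever \<open>Xh\<close> does there. Off the
    good outcomes it is 1 before \<open>T\<close>, because positivity there is required of every
    outcome; adaptedness survives as these outcomes lie in a null set.\<close>
  define Y where "Y t x = (if T x \<le> ereal t then 0 else if good x then l t x / Xh t x else 1)" for t x
  have Ypos: "0 < Y t x" if x: "x \<in> space M" and t: "0 \<le> t" "ereal t < T x" for x t
  proof (cases "good x")
    case True
    then have "0 < l t x" using good_lower[OF True] t by force
    then show ?thesis using True t Xh_pos[OF t(1) x t(2)] by (simp add: Y_def)
  qed (use t in \<open>simp add: Y_def\<close>)
  have Y0: "0 \<le> Y t x" if "x \<in> space M" "0 \<le> t" for t x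
    using Ypos[OF that] by (cases "ereal t < T x") (auto simp: Y_def)
  have Yad: "adapted F Y"
    unfolding adapted_def
  proof (intro allI impI)
    fix t :: real assume t: "0 \<le> t"
    have m: "(\<lambda>x. indicator {x\<in>space M. ereal t < T x} x * (l t x / Xh t x)) \<in> borel_measurable (F t)"
      unfolding l_def
      by (intro borel_measurable_times borel_measurable_divide borel_measurable_indicator T_stopping_time t
          measurable_right_limit w process_measurable(1)[OF Xh_in])
    show "Y t \<in> borel_measurable (F t)"
    proof (rule AE_measurable_F[OF m t])
      show "AE x in M. indicator {x\<in>space M. ereal t < T x} x * (l t x / Xh t x) = Y t x"
        using AEgood AE_space by eventually_elim (auto simp: Y_def indicator_def)
    qed
  qed
  have Yrc: "as_right_continuous M Y"
    unfolding as_right_continuous_def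
    using AEgood process_right_continuous[OF Xh_in] AE_space
  proof eventually_elim
    case (elim x)
    show ?case
    proof (intro allI impI)
      fix t :: real assume t: "0 \<le> t"
      show "((\<lambda>s. Y s x) \<longlongrightarrow> Y t x) (at_right t)"
      proof (cases "ereal t < T x")
        case True
        have "((\<lambda>s. l s x / Xh s x) \<longlongrightarrow> l t x / Xh t x) (at_right t)"
          using l_rc[OF elim(1) t] elim(2) t Xh_pos[OF t elim(3) True] by (intro tendsto_divide) auto
        moreover have "\<forall>\<^sub>F s in at_right t. l s x / Xh s x = Y s x"
          using near[OF True] by eventually_elim (use elim(1) in \<open>simp add: Y_def\<close>)
        ultimately have "((\<lambda>s. Y s x) \<longlongrightarrow> l t x / Xh t x) (at_right t)" by (rule Lim_transform_eventually)
        then show ?thesis using True[folded not_le] elim(1) by (simp add: Y_def)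
      next
        case False
        have "\<forall>\<^sub>F s in at_right t. 0 = Y s x"
          unfolding eventually_at_right_field
        proof (intro exI[of _ "t + 1"] conjI allI impI)
          fix s assume "t < s" "s < t + 1"
          then have "T x \<le> ereal s" using False by (meson ereal_less_eq(3) less_imp_le not_less order_trans)
          then show "0 = Y s x" by (simp add: Y_def)
        qed simp
        then have "((\<lambda>s. Y s x) \<longlongrightarrow> 0) (at_right t)" by (rule Lim_transform_eventually[OF tendsto_const])
        then show ?thesis using False by (simp add: Y_def not_less)
      qed
    qed
  qed
  have Ylim: "AE x in M. 0 < left_liminf (\<lambda>t. Xh t x * Y t x) (T x)"
    using AEgood AE_space
  proof eventually_elim
    case (elim x)
    obtain c where c: "0 < c" "\<And>t. 0 \<le> t \<Longrightarrow> ereal t < T x \<Longrightarrow> c \<le> l t x" using good_lower[OF elim(1)] by blast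
    have le: "c \<le> Xh t x * Y t x" if "0 \<le> t" "ereal t < T x" for t
      using c(2)[OF that] Xh_pos[OF that(1) elim(2) that(2)] elim(1) that(2)[folded not_le] by (simp add: Y_def)
    have "ereal c \<le> left_liminf (\<lambda>t. Xh t x * Y t x) (T x)"
    proof (cases "T x")
      case (real r)
      have "\<forall>\<^sub>F t in at r within {0..<r}. ereal c \<le> ereal (Xh t x * Y t x)"
        unfolding eventually_at using le real by (intro exI[of _ 1]) auto
      then show ?thesis using real by (simp add: left_liminf_def Liminf_bounded)
    next
      case PInf
      have "\<forall>\<^sub>F t in at_top. ereal c \<le> ereal (Xh t x * Y t x)"
        using eventually_ge_at_top[of "0::real"] by eventually_elim (use PInf le in simp)
      then show ?thesis using PInf by (simp add: left_liminf_def Liminf_bounded)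
    qed (use first_zero_nonneg[of Xh x] in simp)
    then show ?case using c(1) by (metis ereal_less(2) less_le_trans)
  qed
  have "SMD M F \<X> Y"
    unfolding SMD_def
  proof
    fix X assume X: "X \<in> \<X>"
    show "supermartingale M F (\<lambda>t x. X t x * Y t x)"
    \<comment> \<open>XY is the right limit of w R along the dyadics: before \<open>T\<close> by
      right continuity of X and \<open>Xh\<close>, and from \<open>T\<close> on because w and Y are
      0.\<close>
    proof (rule regularised_supermartingale[OF SM[OF X]])
      show "0 \<le> w t x * (X t x / Xh t x)" if "0 \<le> t" "x \<in> space M" for t x
        using w0 process_nonneg[OF X that] process_nonneg[OF Xh_in that] by (intro mult_nonneg_nonneg divide_nonneg_nonneg) auto
      show "adapted F (\<lambda>t x. X t x * Y t x)"
        using process_adapted[OF X] Yad by (auto simp: adapted_def intro!: borel_measurable_times)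
      show "0 \<le> X t x * Y t x" if "0 \<le> t" "x \<in> space M" for t x
        using process_nonneg[OF X that] Y0 that by (intro mult_nonneg_nonneg) auto
      fix t :: real assume t: "0 \<le> t"
      let ?d = "\<lambda>n. dyadic_above n t"
      show "AE x in M. (\<lambda>n. w (?d n) x * (X (?d n) x / Xh (?d n) x)) \<longlonglongrightarrow> X t x * Y t x"
        using AEgood process_right_continuous[OF Xh_in]
          process_right_continuous[OF X] AE_space
      proof eventually_elim
        case (elim x)
        have seq: "filterlim ?d (at_right t) sequentially"
          using dyadic_above_tendsto[of t] dyadic_above_gt[of t] unfolding filterlim_at
          by (auto intro!: always_eventually) (metis less_irrefl)
        show ?case
        proof (cases "ereal t < T x")
          case True
          have a: "(\<lambda>n. w (?d n) x) \<longlonglongrightarrow> l t x"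
            using elim(1) t by (intro filterlim_compose[OF _ dyadic_above_filterlim[OF t]]) (simp add: good_def)
          have b: "(\<lambda>n. X (?d n) x) \<longlonglongrightarrow> X t x"
            using elim(3) t by (intro filterlim_compose[OF _ seq]) simp
          have c: "(\<lambda>n. Xh (?d n) x) \<longlonglongrightarrow> Xh t x"
            using elim(2) t by (intro filterlim_compose[OF _ seq]) simp
          have "(\<lambda>n. w (?d n) x * (X (?d n) x / Xh (?d n) x))
              \<longlonglongrightarrow> l t x * (X t x / Xh t x)"
            using Xh_pos[OF t elim(4) True] by (intro tendsto_mult tendsto_divide a b c) auto
          moreover have "l t x * (X t x / Xh t x) = X t x * Y t x" using elim(1) True by (simp add: Y_def)
          ultimately show ?thesis by simp
        next
          case False
          have "T x \<le> ereal (?d n)" for n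
            using False dyadic_above_gt[of t n] by (meson ereal_less_eq(3) less_imp_le not_less order_trans)
          then have "w (?d n) x = 0" for n using wT[OF elim(4)] by blast
          then show ?thesis using False[unfolded not_less] by (simp add: Y_def)
        qed
      qed
    qed
  qed
  then show ?thesis using Yad Yrc Ypos Ylim by blast
qed

end

theorem theorem1p18:
  fixes M :: "'a measure" and F :: "real \<Rightarrow> 'a measure"
    and \<X> :: "(real \<Rightarrow> 'a \<Rightarrow> real) set" and Xh :: "real \<Rightarrow> 'a \<Rightarrow> real"
  assumes "usual_filtered_prob_space M F"
    and "SPD M F \<X>"
    and "dominating_process M \<X> Xh"
  shows "DSV M \<X> Xh \<longleftrightarrow>
    (\<exists>Y. SMD M F \<X> Y \<and> adapted F Y \<and> as_right_continuous M Y \<and>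
         (\<forall>\<omega>\<in>space M. \<forall>t\<ge>0. ereal t < first_zero Xh \<omega> \<longrightarrow> 0 < Y t \<omega>) \<and>
         (AE \<omega> in M. 0 < left_liminf (\<lambda>t. Xh t \<omega> * Y t \<omega>) (first_zero Xh \<omega>)))"
proof -
  interpret prob_space M using assms(1) by (simp add: usual_filtered_prob_space_def)
  interpret dominated_processes M F \<X> Xh by unfold_locales (use assms in auto)
  show ?thesis using DSV_imp_deflator deflator_imp_DSV by blast
qed

end
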